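(* Let $U\in C^2(\mathbb{C})$ be a real-valued function such that $U(z)=u(|z|^2)$ for all $z\in\mathbb{C}$, for some real-valued function $u$ on $[0,\infty)$, and such that $U(z)\ge A-B|z|^2$ for all $z\in\mathbb{C}$, with some $A\in\mathbb{R}$ and $B>0$. Let $F=-\nabla U$. Let $\phi\in H^1(\mathbb{R})$ and let $\psi\in C(\mathbb{R},H^1(\mathbb{R}))$ be the unique solution to $$i\dot\psi(x,t)=-\psi''(x,t)-\delta(x)F(\psi(0,t)),\qquad x\in\mathbb{R},\ t\in\mathbb{R},$$ with $\psi|_{t=0}=\phi$. Then $\psi\in C^{(1/4)}(\mathbb{R}\times\mathbb{R})$.
   Context: Functions $\psi(x,t)$ are complex-valued. Dots and primes denote partial derivatives in $t$ and $x$, respectively; $\delta$ is the Dirac delta function; all derivatives in the equation are understood in the sense of distributions. $\mathbb{C}$ is identified with $\mathbb{R}^2$, and $\nabla$ is the real gradient with respect to $(\mathrm{Re}\,z,\mathrm{Im}\,z)$. It is known that under these hypotheses, for every $\phi\in H^1(\mathbb{R})$ there is a unique solution in $C(\mathbb{R},H^1(\mathbb{R}))$. $C^{(1/4)}(\mathbb{R}\times\mathbb{R})$ denotes the space of bounded functions of $(x,t)$ that are Hölder continuous with exponent $1/4$ on $\mathbb{R}\times\mathbb{R}$. *)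

theory Defs
  imports "HOL-Analysis.Analysis"
begin

definition dir_deriv ::
    "'a::euclidean_space \<Rightarrow> ('a \<Rightarrow> 'b::real_normed_vector) \<Rightarrow> 'a \<Rightarrow> 'b"
  where "dir_deriv v f = (\<lambda>x. frechet_derivative f (at x) v)"

primrec Ck :: "nat \<Rightarrow> ('a::euclidean_space \<Rightarrow> 'b::real_normed_vector) \<Rightarrow> bool"
  where
    "Ck 0 f \<longleftrightarrow> continuous_on UNIV f"
  | "Ck (Suc k) f \<longleftrightarrow> (\<forall>x. f differentiable (at x)) \<and> (\<forall>v. Ck k (dir_deriv v f))"

definition test_fun :: "('a::euclidean_space \<Rightarrow> complex) \<Rightarrow> bool"
  where "test_fun \<eta> \<longleftrightarrow> (\<forall>k. Ck k \<eta>) \<and> compact (closure {x. \<eta> x \<noteq> 0})"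

definition L2 :: "(real \<Rightarrow> complex) set"
  where "L2 = {f. f \<in> borel_measurable lborel \<and> integrable lborel (\<lambda>x. (norm (f x))\<^sup>2)}"

(* The pairing of distributions with test functions is bilinear, without complex conjugation. *)
definition weak_deriv :: "(real \<Rightarrow> complex) \<Rightarrow> (real \<Rightarrow> complex) \<Rightarrow> bool"
  where "weak_deriv f g \<longleftrightarrow>
    (\<forall>\<eta>. test_fun \<eta> \<longrightarrow>
      (LINT x|lborel. f x * dir_deriv 1 \<eta> x) = - (LINT x|lborel. g x * \<eta> x))"

(* Members of H1 are functions, not classes modulo equality almost everywhere. *)
definition H1 :: "(real \<Rightarrow> complex) set"
  where "H1 = {f \<in> L2. \<exists>g\<in>L2. weak_deriv f g}"

(* For f in H1 the chosen derivative is unique up to a null set, so the value does not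
   depend on the choice. *)
definition H1_norm :: "(real \<Rightarrow> complex) \<Rightarrow> real"
  where "H1_norm f =
    sqrt ((LINT x|lborel. (norm (f x))\<^sup>2)
        + (LINT x|lborel. (norm ((SOME g. g \<in> L2 \<and> weak_deriv f g) x))\<^sup>2))"

(* The curve t \<mapsto> \<psi>(.,t) is in C(R, H^1(R)). Every class in H^1(R) has exactly one continuous
   representative; \<psi>(.,t) is required to be that one, so that the value \<psi>(0,t) is meaningful. *)
definition C_H1 :: "(real \<Rightarrow> real \<Rightarrow> complex) \<Rightarrow> bool"
  where "C_H1 \<psi> \<longleftrightarrow>
    (\<forall>t. (\<lambda>x. \<psi> x t) \<in> H1 \<and> continuous_on UNIV (\<lambda>x. \<psi> x t)) \<and>
    (\<forall>t. ((\<lambda>s. H1_norm (\<lambda>x. \<psi> x s - \<psi> x t)) \<longlongrightarrow> 0) (at t))"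

(* i \<psi>_t = - \<psi>_xx - \<delta>(x) F(\<psi>(0,t)) in the sense of distributions on R x R, paired with a test
   function \<eta> of p = (x,t): all derivatives are moved onto \<eta>, and the term
   \<delta>(x) F(\<psi>(0,t)) acts by \<eta> \<mapsto> \<integral> F(\<psi>(0,t)) \<eta>(0,t) dt. *)
definition schroedinger_delta :: "(complex \<Rightarrow> complex) \<Rightarrow> (real \<Rightarrow> real \<Rightarrow> complex) \<Rightarrow> bool"
  where "schroedinger_delta F \<psi> \<longleftrightarrow>
    (\<forall>\<eta> :: real \<times> real \<Rightarrow> complex. test_fun \<eta> \<longrightarrow>
      - (LINT p|lborel. \<i> * \<psi> (fst p) (snd p) * dir_deriv (0, 1) \<eta> p)
      = - (LINT p|lborel. \<psi> (fst p) (snd p) * dir_deriv (1, 0) (dir_deriv (1, 0) \<eta>) p)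
        - (LINT t|lborel. F (\<psi> 0 t) * \<eta> (0, t)))"

definition bounded_hoelder :: "real \<Rightarrow> ('a::metric_space \<Rightarrow> 'b::real_normed_vector) \<Rightarrow> bool"
  where "bounded_hoelder \<alpha> f \<longleftrightarrow>
    bounded (range f) \<and> (\<exists>C. \<forall>p q. norm (f p - f q) \<le> C * dist p q powr \<alpha>)"

end

theory Submission
  imports Defs
begin

text \<open>
  Let \<open>p(t) = \<psi>(\<cdot>,t)\<close>, \<open>g(t) = \<psi>(0,t)\<close> and \<open>f = F(g)\<close>. For \<open>\<zeta>\<close> in \<open>H\<^sup>1\<close> the equation reads
  \<open>i \<langle>p(t) - p(s), \<zeta>\<rangle> = \<integral>\<^sub>s\<^sup>t (\<langle>p'(r), \<zeta>'\<rangle> - f(r) \<zeta>(0)) dr\<close>. If \<open>p\<close> is bounded in \<open>H\<^sup>1\<close>, choosing for \<open>\<zeta>\<close>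
  the conjugate of \<open>p(t) - p(s)\<close> gives \<open>\<parallel>p(t) - p(s)\<parallel>\<^sup>2 \<le> C |t - s|\<close> in \<open>L\<^sup>2\<close>, and \<open>|v|\<^sup>2 \<le> 2 \<parallel>v\<parallel> \<parallel>v'\<parallel>\<close> turns this
  into Hoelder continuity of exponent 1/4 in time; in space the exponent is 1/2 by Cauchy-Schwarz.

  The uniform bound in \<open>H\<^sup>1\<close> comes from the conservation of charge (\<open>F(z)\<close> is a real multiple of \<open>z\<close>) and of
  energy together with the lower bound on \<open>U\<close>. Since the time derivative of \<open>p\<close> is only in \<open>H\<^sup>-\<^sup>1\<close>, the energy cannot be
  differentiated directly. In the derivative of \<open>Re i\<langle>p(t), p(t+h)\<rangle>\<close>, however, the kinetic terms cancel, and
  integrating over \<open>[a,b]\<close>, dividing by \<open>h\<close> and letting \<open>h\<close> tend to 0 yields the energy identity up to a remainder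
  \<open>h\<^sup>-\<^sup>1 \<integral> o(|g(t+h) - g(t)|\<^sup>2) dt\<close>, the error of the trapezoidal rule for \<open>U\<close>. It vanishes because
  \<open>\<integral> |g(t+h) - g(t)|\<^sup>2 dt = O(h)\<close>: for \<open>w = p(t+h) - p(t)\<close> one differentiates \<open>\<langle>w, K w\<rangle>\<close>, where \<open>K\<close> is an
  antisymmetric operator whose commutator with \<open>\<partial>\<^sub>x\<^sup>2\<close> is \<open>\<delta>\<otimes>\<delta>\<close> up to an operator bounded in \<open>L\<^sup>2\<close>.
\<close>

subsection \<open>Test functions\<close>

text \<open>The potential is only C^2, so the trapezoidal error is o(|g(t+h) - g(t)|^2) without any
  rate, and division by h demands increments that are O(h) in mean square. Hoelder continuity of
  exponent 1/4 would give only O(h^(1/2)) for the squared increments; the missing half power is what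
  local smoothing supplies. That estimate needs bounds on compact time intervals only, so it is
  available before the global bound it serves to prove. The increments solve a linear equation whose
  source is dominated by their own trace, because F is locally Lipschitz. The equation is given
  against smooth compactly supported functions, while these arguments test it with solutions,
  increments or their images under K, which are merely in H1. Hence the passage to H1 by duality: a
  bounded functional that vanishes on smoothed indicators vanishes. Since the point interaction
  reads off values at 0, H1 functions are handled as primitives of L2 functions, never as classes;
  all product rules become integration by parts for such primitives.\<close>

lemma dir_deriv_eq: "(f has_derivative f') (at x) \<Longrightarrow> dir_deriv v f x = f' v"
  unfolding dir_deriv_def using frechet_derivative_at by metis

section \<open>Closure properties of C^k functions\<close>

lemma Ck_Suc_imp: "Ck (Suc k) f \<Longrightarrow> Ck k f"
proof (induction k arbitrary: f)
  case 0
  then show ?case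
    by (auto intro!: continuous_at_imp_continuous_on differentiable_imp_continuous_within)
next
  case (Suc k)
  then show ?case by auto
qed

lemma Ck_imp_continuous_on: "Ck k f \<Longrightarrow> continuous_on S f"
proof (induction k)
  case 0 then show ?case by (auto intro: continuous_on_subset)
next
  case (Suc k) then show ?case using Ck_Suc_imp by blast
qed

lemma Ck_bounded_linear:
  assumes h: "bounded_linear h"
  shows "Ck k f \<Longrightarrow> Ck k (\<lambda>x. h (f x))"
proof (induction k arbitrary: f)
  case 0
  then show ?case using bounded_linear.continuous_on[OF h] by auto
next
  case (Suc k)
  have d: "((\<lambda>x. h (f x)) has_derivative (\<lambda>v. h (frechet_derivative f (at x) v))) (at x)" for x
    using Suc.prems by (intro bounded_linear.has_derivative[OF h])
        (simp add: frechet_derivative_works[symmetric])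
  have "dir_deriv v (\<lambda>x. h (f x)) = (\<lambda>x. h (dir_deriv v f x))" for v
    using dir_deriv_eq[OF d] by (auto simp: dir_deriv_def)
  with Suc d show ?case by (auto simp: differentiable_def)
qed

lemma Ck_add: "Ck k f \<Longrightarrow> Ck k g \<Longrightarrow> Ck k (\<lambda>x. f x + g x)"
proof (induction k arbitrary: f g)
  case 0
  then show ?case by (auto intro: continuous_on_add)
next
  case (Suc k)
  have d: "((\<lambda>x. f x + g x) has_derivative
      (\<lambda>v. frechet_derivative f (at x) v + frechet_derivative g (at x) v)) (at x)" for x
    using Suc.prems by (intro has_derivative_add) (simp_all add: frechet_derivative_works[symmetric])
  have "dir_deriv v (\<lambda>x. f x + g x) = (\<lambda>x. dir_deriv v f x + dir_deriv v g x)" for v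
    using dir_deriv_eq[OF d] by (auto simp: dir_deriv_def)
  with Suc d show ?case by (auto simp: differentiable_def)
qed

lemma Ck_mult:
  fixes f g :: "'a::euclidean_space \<Rightarrow> 'b::real_normed_algebra"
  shows "Ck k f \<Longrightarrow> Ck k g \<Longrightarrow> Ck k (\<lambda>x. f x * g x)"
proof (induction k arbitrary: f g)
  case 0
  then show ?case by (auto intro: continuous_on_mult)
next
  case (Suc k)
  have d: "((\<lambda>x. f x * g x) has_derivative
      (\<lambda>v. f x * frechet_derivative g (at x) v + frechet_derivative f (at x) v * g x)) (at x)" for x
    using Suc.prems by (intro has_derivative_mult) (simp_all add: frechet_derivative_works[symmetric])
  have "dir_deriv v (\<lambda>x. f x * g x) = (\<lambda>x. f x * dir_deriv v g x + dir_deriv v f x * g x)" for v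
    using dir_deriv_eq[OF d] by (auto simp: dir_deriv_def)
  \<comment> \<open>The product rule leaves undifferentiated factors, whose order has to be lowered
    from k + 1 to k.\<close>
  moreover have "Ck k f" "Ck k g" using Suc.prems Ck_Suc_imp by blast+
  moreover have "(\<lambda>x. f x * g x) differentiable (at x)" for x
    using d differentiableI by blast
  ultimately show ?case using Suc by (auto intro!: Ck_add)
qed

lemma Ck_compose_affine:
  fixes f :: "'a::euclidean_space \<Rightarrow> 'b::real_normed_vector" and L :: "'c::euclidean_space \<Rightarrow> 'a"
  assumes L: "bounded_linear L"
  shows "Ck k f \<Longrightarrow> Ck k (\<lambda>x. f (L x + c))"
proof (induction k arbitrary: f)
  case 0
  have "continuous_on UNIV (\<lambda>x. L x + c)"
    by (intro continuous_on_add linear_continuous_on L continuous_on_const)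
  with 0 show ?case using continuous_on_compose2[of UNIV f UNIV "\<lambda>x. L x + c"] by simp
next
  case (Suc k)
  have d: "((\<lambda>x. f (L x + c)) has_derivative
      (\<lambda>v. frechet_derivative f (at (L x + c)) (L v))) (at x)" for x
  proof -
    have 1: "((\<lambda>x. L x + c) has_derivative L) (at x)"
      using has_derivative_add_const[OF bounded_linear_imp_has_derivative[OF L]] .
    have 2: "(f has_derivative frechet_derivative f (at (L x + c))) (at (L x + c))"
      using Suc.prems by (simp add: frechet_derivative_works[symmetric])
    from has_derivative_compose[OF 1 2] show ?thesis by simp
  qed
  have "dir_deriv v (\<lambda>x. f (L x + c)) = (\<lambda>x. dir_deriv (L v) f (L x + c))" for v
    using dir_deriv_eq[OF d] by (auto simp: dir_deriv_def)
  with Suc d show ?case by (auto simp: differentiable_def)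
qed

text \<open>On the line every directional derivative is a scalar multiple of \<open>f'\<close>, so
  the quantifier over directions in \<open>Ck\<close> collapses.\<close>

lemma Ck_SucI_real:
  fixes f :: "real \<Rightarrow> 'b::real_normed_vector"
  assumes "\<And>x. (f has_vector_derivative f' x) (at x)" and "Ck k f'"
  shows "Ck (Suc k) f"
proof -
  have d: "(f has_derivative (\<lambda>v. v *\<^sub>R f' x)) (at x)" for x
    using assms(1) by (simp add: has_vector_derivative_def)
  have "dir_deriv v f = (\<lambda>x. v *\<^sub>R f' x)" for v using dir_deriv_eq[OF d] by auto
  then show ?thesis using d Ck_bounded_linear[OF bounded_linear_scaleR_right assms(2)]
    by (auto simp: differentiable_def)
qed

lemma dir_deriv_vector_derivative:
  "(f has_vector_derivative d) (at x) \<Longrightarrow> dir_deriv v f x = v *\<^sub>R d"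
  unfolding has_vector_derivative_def by (rule dir_deriv_eq)

lemma has_real_derivative_cong_nhds:
  assumes "(f has_real_derivative d) (at x)" "\<forall>\<^sub>F y in nhds x. f y = g y"
  shows "(g has_real_derivative d) (at x)"
  using DERIV_cong_ev[OF refl assms(2) refl] assms(1) by blast

section \<open>Smooth cut-off functions on the line\<close>

definition flat_exp :: "real poly \<Rightarrow> real \<Rightarrow> real"
  where "flat_exp p x = (if x > 0 then poly p (1 / x) * exp (- (1 / x)) else 0)"

lemma poly_exp_tendsto_0: "((\<lambda>y::real. poly p y * exp (- y)) \<longlongrightarrow> 0) at_top"
proof -
  have "((\<lambda>y::real. \<Sum>i\<le>degree p. coeff p i * (y ^ i / exp y)) \<longlongrightarrow> (\<Sum>i\<le>degree p. coeff p i * 0)) at_top"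
    by (intro tendsto_intros tendsto_power_div_exp_0)
  moreover have "(\<Sum>i\<le>degree p. coeff p i * (y ^ i / exp y)) = poly p y * exp (- y)" for y
    unfolding poly_altdef sum_distrib_right
    by (intro sum.cong) (auto simp: exp_minus divide_inverse)
  ultimately show ?thesis by simp
qed

lemma flat_exp_tendsto_0: "((\<lambda>x. flat_exp p x / x) \<longlongrightarrow> 0) (at 0)"
proof -
  have "((\<lambda>x. flat_exp p x / x) \<longlongrightarrow> 0) (at_right 0)"
  proof -
    \<comment> \<open>Dividing by x multiplies the polynomial in 1/x by its variable, which is
      \<open>pCons 0 p\<close>.\<close>
    have "((\<lambda>x. poly (pCons 0 p) (inverse x) * exp (- inverse x)) \<longlongrightarrow> 0) (at_right (0::real))"
      using filterlim_compose[OF poly_exp_tendsto_0[of "pCons 0 p"] filterlim_inverse_at_top_right] .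
    moreover have "\<forall>\<^sub>F x in at_right (0::real).
        poly (pCons 0 p) (inverse x) * exp (- inverse x) = flat_exp p x / x"
      unfolding eventually_at_right_field
      by (intro exI[of _ 1]) (auto simp: flat_exp_def field_simps)
    ultimately show ?thesis using tendsto_cong by fastforce
  qed
  moreover have "((\<lambda>x. flat_exp p x / x) \<longlongrightarrow> 0) (at_left 0)"
  proof -
    have "\<forall>\<^sub>F x in at_left (0::real). 0 = flat_exp p x / x"
      unfolding eventually_at_left_field
      by (intro exI[of _ "-1"]) (auto simp: flat_exp_def)
    then show ?thesis by (rule Lim_transform_eventually[OF tendsto_const])
  qed
  ultimately show ?thesis by (simp add: filterlim_split_at)
qed

text \<open>The family p(1/x) exp(-1/x) is closed under differentiation: the chain rule contributes
  1/x^2, that is \<open>[:0, 0, 1:]\<close>, the exponential reproduces p and the polynomial gives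
  -p'. Keeping p general is what makes smoothness an induction on the order.\<close>

lemma flat_exp_deriv:
  "(flat_exp p has_real_derivative flat_exp ([:0, 0, 1:] * (p - pderiv p)) x) (at x)"
proof -
  consider "x > 0" | "x < 0" | "x = 0" by linarith
  then show ?thesis
  proof cases
    case 1
    have "((\<lambda>x. poly p (1 / x) * exp (- (1 / x))) has_real_derivative
        flat_exp ([:0, 0, 1:] * (p - pderiv p)) x) (at x)"
      using 1 by (auto intro!: derivative_eq_intros DERIV_chain2[OF poly_DERIV] simp: flat_exp_def
          field_simps power2_eq_square)
    moreover have "\<forall>\<^sub>F y in nhds x. poly p (1 / y) * exp (- (1 / y)) = flat_exp p y"
      using eventually_nhds_in_open[of "{0<..}" x] 1
      by (auto elim!: eventually_mono simp: flat_exp_def)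
    ultimately show ?thesis by (rule has_real_derivative_cong_nhds)
  next
    case 2
    have "((\<lambda>x. 0) has_real_derivative 0) (at x)" by simp
    moreover have "\<forall>\<^sub>F y in nhds x. 0 = flat_exp p y"
      using eventually_nhds_in_open[of "{..<0}" x] 2
      by (auto elim!: eventually_mono simp: flat_exp_def)
    ultimately have "(flat_exp p has_real_derivative 0) (at x)" by (rule has_real_derivative_cong_nhds)
    then show ?thesis using 2 by (auto simp: flat_exp_def)
  next
    case 3
    have "flat_exp q 0 = 0" for q by (simp add: flat_exp_def)
    then show ?thesis using flat_exp_tendsto_0[of p] 3
      by (simp add: has_field_derivative_iff)
  qed
qed

lemma Ck_flat_exp: "Ck k (flat_exp p)"
proof (induction k arbitrary: p)
  case 0
  show ?case using DERIV_isCont[OF flat_exp_deriv]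
    by (auto intro: continuous_at_imp_continuous_on)
next
  case (Suc k)
  then show ?case using flat_exp_deriv
    by (intro Ck_SucI_real) (auto simp: has_real_derivative_iff_has_vector_derivative)
qed

definition bump0 :: "real \<Rightarrow> real"
  where "bump0 x = flat_exp 1 (1 + x) * flat_exp 1 (1 - x)"

lemma Ck_bump0: "Ck k bump0"
proof -
  have "Ck k (\<lambda>x. flat_exp 1 (x + 1))"
    by (rule Ck_compose_affine[OF bounded_linear_ident Ck_flat_exp])
  moreover have "Ck k (\<lambda>x. flat_exp 1 (- x + 1))"
    by (rule Ck_compose_affine[OF bounded_linear_minus[OF bounded_linear_ident] Ck_flat_exp])
  ultimately have "Ck k (\<lambda>x. flat_exp 1 (x + 1) * flat_exp 1 (- x + 1))" by (rule Ck_mult)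
  moreover have "bump0 = (\<lambda>x. flat_exp 1 (x + 1) * flat_exp 1 (- x + 1))"
    by (auto simp: bump0_def add.commute)
  ultimately show ?thesis by simp
qed

lemma bump0_pos: "\<bar>x\<bar> < 1 \<Longrightarrow> bump0 x > 0"
  and bump0_nonneg: "bump0 x \<ge> 0"
  and bump0_eq_0: "\<bar>x\<bar> \<ge> 1 \<Longrightarrow> bump0 x = 0"
  by (auto simp: bump0_def flat_exp_def)

lemma continuous_bump0: "continuous_on S bump0"
  using Ck_imp_continuous_on[OF Ck_bump0[of 0]] .

lemma integral_bump0_pos: "integral {-1..1} bump0 > 0"
proof -
  have "integral {-1..1} bump0 \<noteq> 0"
  proof
    assume "integral {-1..1} bump0 = 0"
    then have "\<forall>x\<in>{-1..1}. bump0 x = 0"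
      by (subst (asm) integral_eq_0_iff) (auto simp: continuous_bump0 bump0_nonneg)
    then have "bump0 0 = 0" by simp
    with bump0_pos[of 0] show False by simp
  qed
  moreover have "integral {-1..1} bump0 \<ge> 0"
    by (intro integral_nonneg integrable_continuous_interval continuous_bump0) (simp add: bump0_nonneg)
  ultimately show ?thesis by linarith
qed

definition bump :: "real \<Rightarrow> real"
  where "bump x = bump0 x / integral {-1..1} bump0"

definition smooth_step :: "real \<Rightarrow> real"
  where "smooth_step x = (if x \<le> -1 then 0 else integral {-1..x} bump)"

lemma Ck_bump: "Ck k bump"
  using Ck_bounded_linear[OF bounded_linear_divide Ck_bump0] by (simp add: bump_def[abs_def])

lemma continuous_bump: "continuous_on S bump"
  using Ck_imp_continuous_on[OF Ck_bump[of 0]] .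

lemma bump_nonneg: "bump x \<ge> 0"
  and bump_eq_0: "\<bar>x\<bar> \<ge> 1 \<Longrightarrow> bump x = 0"
  using integral_bump0_pos by (simp_all add: bump_def bump0_nonneg bump0_eq_0)

lemma integral_bump: "integral {-1..1} bump = 1"
  using integral_bump0_pos by (simp add: bump_def[abs_def])

text \<open>The bump vanishes left of -1, so the lower limit can be moved to any -c. This gives a
  single formula around a given point, to which the fundamental theorem of calculus applies.\<close>

lemma smooth_step_ge: assumes "x \<ge> -c" "c \<ge> 1" shows "smooth_step x = integral {-c..x} bump"
proof (cases "x \<le> -1")
  case True
  have "integral {-c..x} bump = integral {-c..x} (\<lambda>x. 0)"
    using True by (intro integral_cong bump_eq_0) auto
  then show ?thesis using True by (simp add: smooth_step_def)
next
  case False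
  have "integral {-c..-1} bump = integral {-c..-1} (\<lambda>x. 0)"
    by (intro integral_cong bump_eq_0) auto
  moreover have "integral {-c..-1} bump + integral {-1..x} bump = integral {-c..x} bump"
    using False assms
    by (intro Henstock_Kurzweil_Integration.integral_combine integrable_continuous_interval
        continuous_bump) auto
  ultimately show ?thesis using False by (simp add: smooth_step_def)
qed

lemma smooth_step_deriv: "(smooth_step has_real_derivative bump x) (at x)"
proof -
  define c where "c = \<bar>x\<bar> + 2"
  have "((\<lambda>x. integral {-c..x} bump) has_real_derivative bump x) (at x within {-c..c})"
    by (rule integral_has_real_derivative) (auto simp: continuous_bump c_def)
  then have "((\<lambda>x. integral {-c..x} bump) has_real_derivative bump x) (at x)"
    using at_within_Icc_at[of "-c" x c] by (simp add: c_def abs_less_iff)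
  moreover have "\<forall>\<^sub>F y in nhds x. integral {-c..y} bump = smooth_step y"
  proof (rule eventually_mono)
    show "\<forall>\<^sub>F y in nhds x. y \<in> {-c<..}"
      by (rule eventually_nhds_in_open) (auto simp: c_def)
    show "integral {-c..y} bump = smooth_step y" if "y \<in> {-c<..}" for y
      using that by (intro smooth_step_ge[symmetric]) (auto simp: c_def)
  qed
  ultimately show ?thesis by (rule has_real_derivative_cong_nhds)
qed

lemma smooth_step_eq_0: "x \<le> -1 \<Longrightarrow> smooth_step x = 0"
  by (simp add: smooth_step_def)

lemma smooth_step_eq_1: assumes "x \<ge> 1" shows "smooth_step x = 1"
proof -
  have "integral {1..x} bump = integral {1..x} (\<lambda>x. 0)"
    by (intro integral_cong bump_eq_0) auto
  moreover have "integral {-1..1} bump + integral {1..x} bump = integral {-1..x} bump"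
    using assms
    by (intro Henstock_Kurzweil_Integration.integral_combine integrable_continuous_interval
        continuous_bump) auto
  ultimately show ?thesis using assms by (simp add: smooth_step_def integral_bump)
qed

lemma smooth_step_mono: "x \<le> y \<Longrightarrow> smooth_step x \<le> smooth_step y"
  using DERIV_nonneg_imp_nondecreasing[of x y smooth_step] smooth_step_deriv bump_nonneg by blast

lemma smooth_step_bounds: "0 \<le> smooth_step x" "smooth_step x \<le> 1"
proof -
  show "0 \<le> smooth_step x"
    using smooth_step_mono[of "-1" x] smooth_step_eq_0[of "-1"] smooth_step_eq_0[of x] by linarith
  show "smooth_step x \<le> 1"
    using smooth_step_mono[of x 1] smooth_step_eq_1[of 1] smooth_step_eq_1[of x] by linarith
qed

lemma Ck_smooth_step: "Ck k smooth_step"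
  using Ck_Suc_imp[OF Ck_SucI_real[OF _ Ck_bump]] smooth_step_deriv
  by (simp add: has_real_derivative_iff_has_vector_derivative)

section \<open>Test functions of one variable and their products\<close>

lemma test_funI:
  assumes "\<And>k. Ck k \<eta>" and "\<And>x. x \<notin> K \<Longrightarrow> \<eta> x = 0" and "compact K"
  shows "test_fun \<eta>"
proof -
  have "closure {x. \<eta> x \<noteq> 0} \<subseteq> K"
    using assms(2) by (intro closure_minimal compact_imp_closed[OF assms(3)]) auto
  then have "compact (closure {x. \<eta> x \<noteq> 0})"
    using assms(3) by (metis closed_closure compact_Int_closed inf.absorb2)
  with assms(1) show ?thesis by (simp add: test_fun_def)
qed

lemma test_fun_eq_0:
  fixes \<eta> :: "real \<Rightarrow> complex"
  assumes "test_fun \<eta>"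
  obtains R where "R > 0" "\<And>x. \<bar>x\<bar> \<ge> R \<Longrightarrow> \<eta> x = 0"
proof -
  have "bounded {x. \<eta> x \<noteq> 0}"
    using assms bounded_subset[OF compact_imp_bounded closure_subset] by (auto simp: test_fun_def)
  then obtain a where "\<forall>x\<in>{x. \<eta> x \<noteq> 0}. norm x \<le> a" by (auto simp: bounded_iff)
  then have "\<bar>x\<bar> \<ge> \<bar>a\<bar> + 1 \<Longrightarrow> \<eta> x = 0" for x by force
  then show ?thesis using that[of "\<bar>a\<bar> + 1"] by auto
qed

text \<open>Off its closed support the function vanishes on a whole neighbourhood, so the same
  compact set serves for the derivative.\<close>

lemma test_fun_dir_deriv:
  fixes \<eta> :: "'a::euclidean_space \<Rightarrow> complex"
  assumes "test_fun \<eta>" shows "test_fun (dir_deriv v \<eta>)"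
proof (rule test_funI)
  show "Ck k (dir_deriv v \<eta>)" for k
    using assms by (metis Ck.simps(2) test_fun_def)
  show "compact (closure {x. \<eta> x \<noteq> 0})" using assms by (simp add: test_fun_def)
  fix x assume x: "x \<notin> closure {x. \<eta> x \<noteq> 0}"
  define s where "s = - closure {x. \<eta> x \<noteq> 0}"
  have "0 = \<eta> y" if "y \<in> s" for y
    using that closure_subset[of "{x. \<eta> x \<noteq> 0}"] by (auto simp: s_def)
  moreover have "open s" "x \<in> s" using x open_Compl[OF closed_closure] by (simp_all add: s_def)
  moreover have "((\<lambda>x. 0) has_derivative (\<lambda>x. 0)) (at x)" by (rule has_derivative_const)
  ultimately have "(\<eta> has_derivative (\<lambda>x. 0)) (at x)"
    using has_derivative_transform_within_open by blast
  then show "dir_deriv v \<eta> x = 0" by (simp add: dir_deriv_eq)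
qed

lemma test_fun_vector_derivative:
  fixes \<eta> :: "real \<Rightarrow> complex"
  assumes "test_fun \<eta>"
  shows "(\<eta> has_vector_derivative dir_deriv 1 \<eta> x) (at x)"
proof -
  have "Ck (Suc 0) \<eta>" using assms unfolding test_fun_def by blast
  then have "\<eta> differentiable at x" by simp
  then show ?thesis using linear_frechet_derivative[of \<eta> "at x"]
    by (simp add: dir_deriv_def has_vector_derivative_def frechet_derivative_works[symmetric]
        linear_scale[symmetric])
qed

lemma continuous_test_fun: "test_fun \<eta> \<Longrightarrow> continuous_on S \<eta>"
  unfolding test_fun_def using Ck_imp_continuous_on by blast

lemma test_fun_prod:
  fixes \<xi> \<theta> :: "real \<Rightarrow> complex"
  assumes "test_fun \<xi>" "test_fun \<theta>"
  shows "test_fun (\<lambda>p. \<xi> (fst p) * \<theta> (snd p))"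
proof -
  obtain R where R: "\<And>x. \<bar>x\<bar> \<ge> R \<Longrightarrow> \<xi> x = 0" using test_fun_eq_0[OF assms(1)] by metis
  obtain T where T: "\<And>x. \<bar>x\<bar> \<ge> T \<Longrightarrow> \<theta> x = 0" using test_fun_eq_0[OF assms(2)] by metis
  show ?thesis
  proof (rule test_funI)
    show "Ck k (\<lambda>p. \<xi> (fst p) * \<theta> (snd p))" for k
    proof (rule Ck_mult)
      show "Ck k (\<lambda>p. \<xi> (fst p))"
        using Ck_compose_affine[OF bounded_linear_fst, of k \<xi> 0] assms by (simp add: test_fun_def)
      show "Ck k (\<lambda>p. \<theta> (snd p))"
        using Ck_compose_affine[OF bounded_linear_snd, of k \<theta> 0] assms by (simp add: test_fun_def)
    qed
    show "compact ({-R..R} \<times> {-T..T})" by (intro compact_Times compact_Icc)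
    show "\<xi> (fst p) * \<theta> (snd p) = 0" if "p \<notin> {-R..R} \<times> {-T..T}" for p
    proof -
      have "\<bar>fst p\<bar> \<ge> R \<or> \<bar>snd p\<bar> \<ge> T" using that by (cases p) auto
      then show ?thesis using R T by auto
    qed
  qed
qed

lemma test_fun_prod_dir_deriv:
  fixes \<xi> \<theta> :: "real \<Rightarrow> complex"
  assumes "test_fun \<xi>" "test_fun \<theta>"
  shows "dir_deriv (a, b) (\<lambda>p. \<xi> (fst p) * \<theta> (snd p)) =
    (\<lambda>p. of_real a * dir_deriv 1 \<xi> (fst p) * \<theta> (snd p) + of_real b * \<xi> (fst p) * dir_deriv 1 \<theta> (snd p))"
proof
  fix p :: "real \<times> real"
  have 1: "((\<lambda>p. \<xi> (fst p)) has_derivative (\<lambda>v. fst v *\<^sub>R dir_deriv 1 \<xi> (fst p))) (at p)"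
    using test_fun_vector_derivative[OF assms(1), of "fst p"] unfolding has_vector_derivative_def
    by (rule has_derivative_compose[OF has_derivative_fst[OF has_derivative_ident]])
  have 2: "((\<lambda>p. \<theta> (snd p)) has_derivative (\<lambda>v. snd v *\<^sub>R dir_deriv 1 \<theta> (snd p))) (at p)"
    using test_fun_vector_derivative[OF assms(2), of "snd p"] unfolding has_vector_derivative_def
    by (rule has_derivative_compose[OF has_derivative_snd[OF has_derivative_ident]])
  show "dir_deriv (a, b) (\<lambda>p. \<xi> (fst p) * \<theta> (snd p)) p =
    of_real a * dir_deriv 1 \<xi> (fst p) * \<theta> (snd p) + of_real b * \<xi> (fst p) * dir_deriv 1 \<theta> (snd p)"
    by (subst dir_deriv_eq[OF has_derivative_mult[OF 1 2]]) (simp add: scaleR_conv_of_real)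
qed

subsection \<open>Square integrable functions\<close>

text \<open>Without conjugation, like the pairing with test functions in the hypotheses;
  sesquilinear products carry an explicit \<open>cnj\<close> in the second argument.\<close>

definition pairing :: "(real \<Rightarrow> complex) \<Rightarrow> (real \<Rightarrow> complex) \<Rightarrow> complex"
  where "pairing f g = (LINT x|lborel. f x * g x)"

definition l2norm :: "(real \<Rightarrow> complex) \<Rightarrow> real"
  where "l2norm f = sqrt (LINT x|lborel. (norm (f x))\<^sup>2)"

lemma l2norm_nonneg [simp]: "0 \<le> l2norm f"
  by (simp add: l2norm_def)

lemma l2norm_square: "(l2norm f)\<^sup>2 = (LINT x|lborel. (norm (f x))\<^sup>2)"
  by (simp add: l2norm_def)

lemma L2_measurable [measurable_dest]: "f \<in> L2 \<Longrightarrow> f \<in> borel_measurable lborel"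
  by (simp add: L2_def)

lemma L2_integrable_norm: "f \<in> L2 \<Longrightarrow> integrable lborel (\<lambda>x. (norm (f x))\<^sup>2)"
  by (simp add: L2_def)

lemma L2_dominated:
  assumes "f \<in> borel_measurable lborel" "g \<in> L2" "\<And>x. norm (f x) \<le> C * norm (g x)"
  shows "f \<in> L2" "l2norm f \<le> \<bar>C\<bar> * l2norm g"
proof -
  have le: "(norm (f x))\<^sup>2 \<le> C\<^sup>2 * (norm (g x))\<^sup>2" for x
    using power_mono[OF assms(3)[of x], of 2] by (simp add: power_mult_distrib)
  have int: "integrable lborel (\<lambda>x. C\<^sup>2 * (norm (g x))\<^sup>2)"
    using L2_integrable_norm[OF assms(2)] by simp
  have intf: "integrable lborel (\<lambda>x. (norm (f x))\<^sup>2)"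
    by (rule Bochner_Integration.integrable_bound[OF int])
      (use assms(1) le in \<open>auto intro!: borel_measurable_power\<close>)
  then show "f \<in> L2" using assms(1) by (simp add: L2_def)
  have "(LINT x|lborel. (norm (f x))\<^sup>2) \<le> (LINT x|lborel. C\<^sup>2 * (norm (g x))\<^sup>2)"
    by (rule integral_mono[OF intf int le])
  also have "\<dots> = C\<^sup>2 * (LINT x|lborel. (norm (g x))\<^sup>2)" by simp
  finally show "l2norm f \<le> \<bar>C\<bar> * l2norm g"
    unfolding l2norm_def using real_sqrt_le_mono by (fastforce simp: real_sqrt_mult)
qed

lemma L2_mult_bounded:
  assumes "m \<in> borel_measurable lborel" "g \<in> L2" "\<And>x. norm (m x) \<le> C"
  shows "(\<lambda>x. m x * g x) \<in> L2" "l2norm (\<lambda>x. m x * g x) \<le> C * l2norm g"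
proof -
  have m: "(\<lambda>x. m x * g x) \<in> borel_measurable lborel"
    by (rule borel_measurable_times[OF assms(1) L2_measurable[OF assms(2)]])
  have C: "C \<ge> 0" using assms(3)[of 0] norm_ge_zero order_trans by blast
  have b: "norm (m x * g x) \<le> C * norm (g x)" for x
    by (simp add: norm_mult mult_right_mono assms(3))
  from L2_dominated[OF m assms(2) b] C
  show "(\<lambda>x. m x * g x) \<in> L2" "l2norm (\<lambda>x. m x * g x) \<le> C * l2norm g" by auto
qed

lemma L2_cmult: "f \<in> L2 \<Longrightarrow> (\<lambda>x. c * f x) \<in> L2"
  by (rule L2_mult_bounded(1)[where C = "norm c"]) auto

lemma L2_cnj: "f \<in> L2 \<Longrightarrow> (\<lambda>x. cnj (f x)) \<in> L2"
  by (rule L2_dominated(1)[where C = 1 and g = f])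
    (auto dest!: L2_measurable intro:
        borel_measurable_continuous_on[OF continuous_on_cnj[OF continuous_on_id]])

lemma L2_add:
  assumes "f \<in> L2" "g \<in> L2"
  shows "(\<lambda>x. f x + g x) \<in> L2"
proof -
  have m: "(\<lambda>x. f x + g x) \<in> borel_measurable lborel"
    using assms by (intro borel_measurable_add L2_measurable)
  have le: "(norm (f x + g x))\<^sup>2 \<le> 2 * (norm (f x))\<^sup>2 + 2 * (norm (g x))\<^sup>2" for x
  proof -
    have "(norm (f x + g x))\<^sup>2 \<le> (norm (f x) + norm (g x))\<^sup>2"
      by (intro power_mono norm_triangle_ineq) simp
    also have "\<dots> \<le> 2 * (norm (f x))\<^sup>2 + 2 * (norm (g x))\<^sup>2"
      using sum_squares_bound[of "norm (f x)" "norm (g x)"] by (simp add: power2_sum)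
    finally show ?thesis .
  qed
  have int: "integrable lborel (\<lambda>x. 2 * (norm (f x))\<^sup>2 + 2 * (norm (g x))\<^sup>2)"
    using assms[THEN L2_integrable_norm] by simp
  have m2: "(\<lambda>x. (norm (f x + g x))\<^sup>2) \<in> borel_measurable lborel"
    using m by measurable
  have "integrable lborel (\<lambda>x. (norm (f x + g x))\<^sup>2)"
    by (rule Bochner_Integration.integrable_bound[OF int m2]) (simp add: le)
  then show ?thesis using m by (simp add: L2_def)
qed

lemma L2_diff:
  assumes "f \<in> L2" "g \<in> L2"
  shows "(\<lambda>x. f x - g x) \<in> L2"
  using L2_add[OF assms(1) L2_cmult[OF assms(2), of "-1"]] by simp

lemma L2_zero: "(\<lambda>x. 0) \<in> L2"
  by (simp add: L2_def)

lemma l2norm_cmult: "l2norm (\<lambda>x. c * f x) = norm c * l2norm f"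
  by (simp add: l2norm_def norm_mult power_mult_distrib real_sqrt_mult)

lemma l2norm_cnj: "l2norm (\<lambda>x. cnj (f x)) = l2norm f"
  by (simp add: l2norm_def)

lemma L2_integrable_mult:
  assumes "f \<in> L2" "g \<in> L2"
  shows "integrable lborel (\<lambda>x. f x * g x)"
proof (rule Bochner_Integration.integrable_bound)
  show "integrable lborel (\<lambda>x. (norm (f x))\<^sup>2 + (norm (g x))\<^sup>2)"
    using assms by (intro Bochner_Integration.integrable_add L2_integrable_norm)
  show "(\<lambda>x. f x * g x) \<in> borel_measurable lborel"
    using assms by (intro borel_measurable_times L2_measurable)
  have "norm (f x) * norm (g x) \<le> (norm (f x))\<^sup>2 + (norm (g x))\<^sup>2" for x
    using sum_squares_bound[of "norm (f x)" "norm (g x)"] mult_nonneg_nonneg[OF norm_ge_zero[of "f x"]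
        norm_ge_zero[of "g x"]]
    by linarith
  then show "AE x in lborel. norm (f x * g x) \<le> norm ((norm (f x))\<^sup>2 + (norm (g x))\<^sup>2)"
    by (simp add: norm_mult)
qed

lemma pairing_add_left:
  "f \<in> L2 \<Longrightarrow> g \<in> L2 \<Longrightarrow> h \<in> L2 \<Longrightarrow> pairing (\<lambda>x. f x + g x) h = pairing f h + pairing g h"
  by (simp add: pairing_def distrib_right L2_integrable_mult)

lemma pairing_diff_left:
  "f \<in> L2 \<Longrightarrow> g \<in> L2 \<Longrightarrow> h \<in> L2 \<Longrightarrow> pairing (\<lambda>x. f x - g x) h = pairing f h - pairing g h"
  by (simp add: pairing_def left_diff_distrib L2_integrable_mult)

lemma pairing_commute: "pairing f g = pairing g f"
  by (simp add: pairing_def mult.commute)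

lemma pairing_add_right:
  "f \<in> L2 \<Longrightarrow> g \<in> L2 \<Longrightarrow> h \<in> L2 \<Longrightarrow> pairing h (\<lambda>x. f x + g x) = pairing h f + pairing h g"
  by (metis pairing_add_left pairing_commute)

lemma pairing_diff_right:
  "f \<in> L2 \<Longrightarrow> g \<in> L2 \<Longrightarrow> h \<in> L2 \<Longrightarrow> pairing h (\<lambda>x. f x - g x) = pairing h f - pairing h g"
  by (metis pairing_diff_left pairing_commute)

lemma pairing_cmult_left: "pairing (\<lambda>x. c * f x) g = c * pairing f g"
  by (simp add: pairing_def mult.assoc)

lemma pairing_cmult_right: "pairing g (\<lambda>x. c * f x) = c * pairing g f"
  by (metis pairing_cmult_left pairing_commute)

lemma pairing_cnj: "pairing (\<lambda>x. cnj (f x)) (\<lambda>x. cnj (g x)) = cnj (pairing f g)"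
  unfolding pairing_def by (simp flip: Bochner_Integration.integral_cnj)

lemma pairing_self_cnj: "pairing f (\<lambda>x. cnj (f x)) = of_real ((l2norm f)\<^sup>2)"
  by (simp add: pairing_def l2norm_square complex_norm_square[symmetric]
      del: of_real_power)

lemma pairing_bound:
  assumes "f \<in> L2" "g \<in> L2"
  shows "norm (pairing f g) \<le> l2norm f * l2norm g"
proof -
  let ?A = "l2norm f" and ?B = "l2norm g"
  \<comment> \<open>Integrated form of 2ab \<le> c a^2 + b^2 / c; the best weight c is the ratio of
    the two norms.\<close>
  have *: "2 * norm (pairing f g) \<le> c * ?A\<^sup>2 + ?B\<^sup>2 / c" if c: "c > 0" for c
  proof -
    have i: "integrable lborel (\<lambda>x. norm (f x * g x))"
      using L2_integrable_mult[OF assms] by simp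
    have "norm (pairing f g) \<le> (LINT x|lborel. norm (f x * g x))"
      unfolding pairing_def by (rule integral_norm_bound)
    also have "2 * \<dots> = (LINT x|lborel. 2 * norm (f x * g x))" by simp
    also have "\<dots> \<le> (LINT x|lborel. c * (norm (f x))\<^sup>2 + (norm (g x))\<^sup>2 / c)"
    proof (rule integral_mono)
      fix x
      have "0 \<le> (c * norm (f x) - norm (g x))\<^sup>2 / c" using c by simp
      then show "2 * norm (f x * g x) \<le> c * (norm (f x))\<^sup>2 + (norm (g x))\<^sup>2 / c"
        using c by (simp add: norm_mult power2_eq_square field_simps)
    qed (use i assms[THEN L2_integrable_norm] in auto)
    also have "\<dots> = c * ?A\<^sup>2 + ?B\<^sup>2 / c"
      using assms[THEN L2_integrable_norm] by (simp add: l2norm_square)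
    finally show ?thesis by simp
  qed
  show ?thesis
  proof (rule field_le_epsilon)
    fix e :: real assume e: "e > 0"
    \<comment> \<open>Adding a small positive number to both norms keeps their ratio meaningful when
      one of them vanishes. The choice makes the resulting error, at most d'(A + B + 1), no larger
      than e.\<close>
    define d where "d = e / (?A + ?B + 1)"
    define d' where "d' = min d 1"
    have AB: "?A + ?B + 1 > 0" using l2norm_nonneg[of f] l2norm_nonneg[of g] by linarith
    have "d' * (?A + ?B + 1) \<le> d * (?A + ?B + 1)"
      using AB by (intro mult_right_mono) (auto simp: d'_def)
    moreover have "d * (?A + ?B + 1) = e" using AB by (simp add: d_def)
    moreover have "d > 0" using e AB by (simp add: d_def)
    ultimately have d: "d' > 0" "d' \<le> 1" "d' * (?A + ?B + 1) \<le> e" by (auto simp: d'_def)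
    have Ap: "?A + d' > 0" "?B + d' > 0" using d l2norm_nonneg[of f] l2norm_nonneg[of g] by linarith+
    have "2 * norm (pairing f g) \<le> (?B + d') / (?A + d') * ?A\<^sup>2 + ?B\<^sup>2 / ((?B + d') / (?A + d'))"
      by (rule *) (use Ap in auto)
    also have "\<dots> \<le> (?B + d') / (?A + d') * (?A + d')\<^sup>2 + (?B + d')\<^sup>2 / ((?B + d') / (?A + d'))"
      using Ap d by (intro add_mono mult_left_mono divide_right_mono power_mono) auto
    also have "\<dots> = 2 * ((?A + d') * (?B + d'))"
    proof -
      have "b / a * a\<^sup>2 + b\<^sup>2 / (b / a) = 2 * (a * b)" if "a > 0" "b > 0" for a b :: real
        using that by (simp add: power2_eq_square field_simps)
      then show ?thesis using Ap .
    qed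
    finally have "norm (pairing f g) \<le> ?A * ?B + d' * (?A + ?B + d')"
      by (simp add: algebra_simps)
    also have "d' * (?A + ?B + d') \<le> d' * (?A + ?B + 1)" using d by (intro mult_left_mono) auto
    finally show "norm (pairing f g) \<le> ?A * ?B + e" using d by linarith
  qed
qed

lemma l2norm_triangle:
  assumes "f \<in> L2" "g \<in> L2"
  shows "l2norm (\<lambda>x. f x + g x) \<le> l2norm f + l2norm g"
proof (rule power2_le_imp_le)
  have "(l2norm (\<lambda>x. f x + g x))\<^sup>2 = norm (complex_of_real ((l2norm (\<lambda>x. f x + g x))\<^sup>2))"
    by (simp del: of_real_power)
  also have "complex_of_real ((l2norm (\<lambda>x. f x + g x))\<^sup>2)
      = pairing (\<lambda>x. f x + g x) (\<lambda>x. cnj (f x) + cnj (g x))"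
    by (subst pairing_self_cnj[symmetric]) simp
  also have "\<dots> = pairing f (\<lambda>x. cnj (f x)) + pairing g (\<lambda>x. cnj (g x)) + pairing f (\<lambda>x. cnj (g x))
      + pairing g (\<lambda>x. cnj (f x))"
    using assms by (simp add: pairing_add_left pairing_add_right L2_add L2_cnj)
  also have "norm \<dots> \<le> (l2norm f)\<^sup>2 + (l2norm g)\<^sup>2 + l2norm f * l2norm g + l2norm g * l2norm f"
    unfolding pairing_self_cnj
    using pairing_bound[OF assms(1) L2_cnj[OF assms(2)]] pairing_bound[OF assms(2) L2_cnj[OF assms(1)]]
    by (intro norm_triangle_mono) (simp_all add: l2norm_cnj norm_power)
  finally show "(l2norm (\<lambda>x. f x + g x))\<^sup>2 \<le> (l2norm f + l2norm g)\<^sup>2"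
    by (simp add: power2_eq_square algebra_simps)
qed simp

lemma l2norm_triangle_diff:
  assumes "f \<in> L2" "g \<in> L2"
  shows "l2norm (\<lambda>x. f x - g x) \<le> l2norm f + l2norm g"
  using l2norm_triangle[OF assms(1) L2_cmult[OF assms(2), of "-1"]] l2norm_cmult[of "-1" g] by simp

lemma l2norm_diff_abs:
  assumes "f \<in> L2" "g \<in> L2"
  shows "\<bar>l2norm f - l2norm g\<bar> \<le> l2norm (\<lambda>x. f x - g x)"
proof -
  have "l2norm f \<le> l2norm (\<lambda>x. f x - g x) + l2norm g"
    using l2norm_triangle[OF L2_diff[OF assms] assms(2)] by simp
  moreover have "l2norm g \<le> l2norm (\<lambda>x. f x - g x) + l2norm f"
    using l2norm_triangle_diff[OF assms(1) L2_diff[OF assms]] by simp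
  ultimately show ?thesis by linarith
qed

lemma L2_tendsto_dominated:
  assumes f: "\<And>n. f n \<in> borel_measurable lborel" and g: "g \<in> borel_measurable lborel" and h: "h \<in> L2"
    and lim: "AE x in lborel. (\<lambda>n. f n x) \<longlonglongrightarrow> g x"
    and bound: "\<And>n x. norm (f n x - g x) \<le> norm (h x)"
  shows "(\<lambda>n. l2norm (\<lambda>x. f n x - g x)) \<longlonglongrightarrow> 0"
proof -
  have "(\<lambda>n. LINT x|lborel. (norm (f n x - g x))\<^sup>2) \<longlonglongrightarrow> integral\<^sup>L lborel (\<lambda>x::real. 0::real)"
  proof (rule Bochner_Integration.integral_dominated_convergence[where w = "\<lambda>x. (norm (h x))\<^sup>2"])
    show "integrable lborel (\<lambda>x. (norm (h x))\<^sup>2)" using h by (rule L2_integrable_norm)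
    show "(\<lambda>x. (norm (f n x - g x))\<^sup>2) \<in> borel_measurable lborel" for n
      using f[of n] g by measurable
    show "AE x in lborel. (\<lambda>n. (norm (f n x - g x))\<^sup>2) \<longlonglongrightarrow> 0"
    proof (use lim in eventually_elim)
      fix x assume "(\<lambda>n. f n x) \<longlonglongrightarrow> g x"
      from tendsto_power[OF tendsto_norm[OF tendsto_diff[OF this tendsto_const[of "g x"]]], of 2]
      show "(\<lambda>n. (norm (f n x - g x))\<^sup>2) \<longlonglongrightarrow> 0" by simp
    qed
    show "AE x in lborel. norm ((norm (f n x - g x))\<^sup>2) \<le> (norm (h x))\<^sup>2" for n
      using bound by (auto intro!: power_mono)
  qed simp
  from tendsto_real_sqrt[OF this] show ?thesis by (simp add: l2norm_def)
qed

section \<open>Functionals on L2 functions supported in a window\<close>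

definition L2_supp :: "real \<Rightarrow> (real \<Rightarrow> complex) set"
  where "L2_supp R = {k \<in> L2. \<forall>x. x \<notin> {-R..R} \<longrightarrow> k x = 0}"

lemma L2_indicator:
  assumes "A \<in> sets lborel" "A \<subseteq> {a..b}"
  shows "(indicator A :: real \<Rightarrow> complex) \<in> L2"
proof -
  have "emeasure lborel A \<le> emeasure lborel {a..b}" using assms by (intro emeasure_mono) auto
  also have "\<dots> < \<infinity>" by (simp add: emeasure_lborel_Icc_eq)
  finally have "integrable lborel (indicator A :: real \<Rightarrow> real)" using assms by simp
  moreover have "(\<lambda>x. (norm (indicator A x :: complex))\<^sup>2) = (indicator A :: real \<Rightarrow> real)"
    by (auto simp: fun_eq_iff indicator_def)
  ultimately show ?thesis using assms by (simp add: L2_def)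
qed

lemma L2_supp_indicator:
  "A \<in> sets lborel \<Longrightarrow> indicator (A \<inter> {-R..R}) \<in> L2_supp R"
  using L2_indicator[of "A \<inter> {-R..R}" "-R" R] by (auto simp: L2_supp_def)

lemma L2_supp_dominated:
  assumes "f \<in> borel_measurable lborel" "g \<in> L2_supp R" "\<And>x. norm (f x) \<le> norm (g x)"
  shows "f \<in> L2_supp R"
  using L2_dominated(1)[OF assms(1), of g 1] assms(2,3)
  by (simp add: L2_supp_def) (metis norm_le_zero_iff norm_zero)

lemma L2_supp_diff: "f \<in> L2_supp R \<Longrightarrow> g \<in> L2_supp R \<Longrightarrow> (\<lambda>x. f x - g x) \<in> L2_supp R"
  by (auto simp: L2_supp_def L2_diff)

lemma L2_supp_cmult: "f \<in> L2_supp R \<Longrightarrow> (\<lambda>x. c * f x) \<in> L2_supp R"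
  by (auto simp: L2_supp_def L2_cmult)

text \<open>Density of the step functions in \<open>L\<^sup>2[-R,R]\<close>, in dual form.\<close>

lemma L2_functional_eq_0:
  fixes \<Lambda> :: "(real \<Rightarrow> complex) \<Rightarrow> complex"
  assumes add: "\<And>f g. f \<in> L2_supp R \<Longrightarrow> g \<in> L2_supp R \<Longrightarrow> \<Lambda> (\<lambda>x. f x + g x) = \<Lambda> f + \<Lambda> g"
    and scale: "\<And>c f. f \<in> L2_supp R \<Longrightarrow> \<Lambda> (\<lambda>x. c * f x) = c * \<Lambda> f"
    and bound: "\<And>f. f \<in> L2_supp R \<Longrightarrow> norm (\<Lambda> f) \<le> C * l2norm f"
    and interval: "\<And>a b. -R \<le> a \<Longrightarrow> a \<le> b \<Longrightarrow> b \<le> R \<Longrightarrow> \<Lambda> (indicator {a..b}) = 0"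
    and f: "f \<in> L2_supp R"
  shows "\<Lambda> f = 0"
proof -
  let ?I = "{-R..R}"
  have ind_empty: "(indicator {} :: real \<Rightarrow> complex) = (\<lambda>x. 0)" by (simp add: fun_eq_iff)
  have zero: "\<Lambda> (\<lambda>x. 0) = 0"
    using scale[of "\<lambda>x. 0" 0] by (simp add: L2_supp_def L2_zero)
  have diff: "\<Lambda> (\<lambda>x. f x - g x) = \<Lambda> f - \<Lambda> g" if "f \<in> L2_supp R" "g \<in> L2_supp R" for f g
    using add[OF that(1) L2_supp_cmult[OF that(2), of "-1"]] scale[OF that(2), of "-1"] by simp
  \<comment> \<open>The zero set of \<Lambda> is closed under dominated pointwise convergence. This
    is the only use of boundedness, and it drives both the countable unions and the monotone limits
    below.\<close>
  have limit: "\<Lambda> g = 0"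
    if F: "\<And>n. F n \<in> borel_measurable lborel" and g: "g \<in> L2_supp R"
      and le: "\<And>n x. norm (F n x) \<le> norm (g x)" and lim: "\<And>x. (\<lambda>n. F n x) \<longlonglongrightarrow> g x"
      and 0: "\<And>n. F n \<in> L2_supp R \<Longrightarrow> \<Lambda> (F n) = 0" for F g
  proof -
    have FX: "F n \<in> L2_supp R" for n by (rule L2_supp_dominated[OF F g le])
    have "(\<lambda>n. l2norm (\<lambda>x. F n x - g x)) \<longlonglongrightarrow> 0"
    proof (rule L2_tendsto_dominated)
      show "(\<lambda>x. 2 * g x) \<in> L2" using g by (auto simp: L2_supp_def intro: L2_cmult)
      show "norm (F n x - g x) \<le> norm (2 * g x)" for n x
        using norm_triangle_ineq4[of "F n x" "g x"] le[of n x] by (simp add: norm_mult)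
    qed (use F g lim in \<open>auto simp: L2_supp_def dest: L2_measurable\<close>)
    then have "(\<lambda>n. C * l2norm (\<lambda>x. F n x - g x)) \<longlonglongrightarrow> C * 0" by (intro tendsto_intros)
    moreover have "norm (\<Lambda> g) \<le> C * l2norm (\<lambda>x. F n x - g x)" for n
      using bound[OF L2_supp_diff[OF FX g], of n] diff[OF FX g, of n] 0[OF FX, of n] by simp
    ultimately have "norm (\<Lambda> g) \<le> C * 0" using LIMSEQ_le_const by blast
    then show ?thesis by simp
  qed
  \<comment> \<open>Dynkin argument with the closed intervals as intersection-stable generator;
    intersecting with the window keeps all indicators square integrable.\<close>
  have ind: "\<Lambda> (indicator (A \<inter> ?I)) = 0" if "A \<in> sets lborel" for A
  proof -
    let ?G = "range (\<lambda>(a, b). {a..b}) :: real set set"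
    have G: "sets lborel = sigma_sets UNIV ?G"
      unfolding sets_lborel by (subst borel_eq_atLeastAtMost) simp
    have "Int_stable ?G" by (auto simp: Int_stable_def)
    moreover have "?G \<subseteq> Pow UNIV" by simp
    moreover have "A \<in> sigma_sets UNIV ?G" using that G by simp
    ultimately show ?thesis
    proof (induction rule: sigma_sets_induct_disjoint)
      fix B assume "B \<in> ?G"
      then obtain a b where B: "B = {a..b}" by auto
      show "\<Lambda> (indicator (B \<inter> ?I)) = 0"
      proof (cases "max a (-R) \<le> min b R")
        case True then show ?thesis using interval[of "max a (-R)" "min b R"] B by simp
      next
        case False
        then have "B \<inter> ?I = {}" using B by auto
        then show ?thesis using zero ind_empty by simp
      qed
    next
      show "\<Lambda> (indicator ({} \<inter> ?I)) = 0" using zero ind_empty by simp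
    next
      fix B assume B: "B \<in> sigma_sets UNIV ?G" "\<Lambda> (indicator (B \<inter> ?I)) = 0"
      then have "B \<in> sets lborel" using G by simp
      moreover have "(\<lambda>x. indicator (UNIV \<inter> ?I) x - indicator (B \<inter> ?I) x)
          = (indicator ((UNIV - B) \<inter> ?I) :: real \<Rightarrow> complex)"
        by (auto simp: fun_eq_iff indicator_def)
      \<comment> \<open>Complements are taken inside the window, so the window itself must be
        annihilated; for negative R it is empty.\<close>
      moreover have "\<Lambda> (indicator (UNIV \<inter> ?I)) = 0"
        using interval[of "-R" R] zero ind_empty by (cases "R \<ge> 0") auto
      ultimately show "\<Lambda> (indicator ((UNIV - B) \<inter> ?I)) = 0"
        using diff[OF L2_supp_indicator L2_supp_indicator, of UNIV B] B by simp
    next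
      fix B :: "nat \<Rightarrow> real set"
      assume B: "disjoint_family B" "range B \<subseteq> sigma_sets UNIV ?G" "\<And>i. \<Lambda> (indicator (B i \<inter> ?I)) = 0"
      have m: "B i \<in> sets lborel" for i
        using B(2) G by blast
      have fin: "\<Lambda> (indicator ((\<Union>i<n. B i) \<inter> ?I)) = 0" for n
      proof (induction n)
        case 0 show ?case using zero ind_empty by simp
      next
        case (Suc n)
        have "B n \<inter> B i = {}" if "i < n" for i
          using B(1) that by (simp add: disjoint_family_on_def)
        then have "B n \<inter> (\<Union>i<n. B i) = {}" by blast
        then have "(\<lambda>x. indicator (B n \<inter> ?I) x + indicator ((\<Union>i<n. B i) \<inter> ?I) x)
            = (indicator ((\<Union>i<Suc n. B i) \<inter> ?I) :: real \<Rightarrow> complex)"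
          by (auto simp: fun_eq_iff indicator_def lessThan_Suc)
        then show ?case
          using add[OF L2_supp_indicator L2_supp_indicator, of "B n" "\<Union>i<n. B i"] Suc B(3) m by auto
      qed
      show "\<Lambda> (indicator ((\<Union>i. B i) \<inter> ?I)) = 0"
      proof (rule limit)
        show "(indicator ((\<Union>i<n. B i) \<inter> ?I) :: real \<Rightarrow> complex) \<in> borel_measurable lborel" for n
          using m by (intro borel_measurable_indicator) auto
        show "(indicator ((\<Union>i. B i) \<inter> ?I) :: real \<Rightarrow> complex) \<in> L2_supp R"
          using m by (intro L2_supp_indicator) auto
        show "norm (indicator ((\<Union>i<n. B i) \<inter> ?I) x :: complex)
            \<le> norm (indicator ((\<Union>i. B i) \<inter> ?I) x :: complex)" for n x
          by (auto simp: indicator_def)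
        show "(\<lambda>n. indicator ((\<Union>i<n. B i) \<inter> ?I) x :: complex) \<longlonglongrightarrow> indicator ((\<Union>i. B i) \<inter> ?I) x" for x
        proof (cases "x \<in> (\<Union>i. B i) \<inter> ?I")
          case True
          then obtain i where i: "x \<in> B i" "x \<in> ?I" by auto
          have "\<forall>\<^sub>F n in sequentially. (indicator ((\<Union>i. B i) \<inter> ?I) x :: complex)
              = indicator ((\<Union>i<n. B i) \<inter> ?I) x"
            using eventually_gt_at_top[of i] by eventually_elim (use i in \<open>auto simp: indicator_def\<close>)
          then show ?thesis by (rule Lim_transform_eventually[OF tendsto_const])
        next
          case False
          then have "x \<notin> (\<Union>i<n. B i) \<inter> ?I" for n by auto
          with False show ?thesis by simp
        qed
      qed (use fin in auto)
    qed
  qed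
  \<comment> \<open>Monotone approximation. The induction must return membership in
    \<open>L2_supp R\<close> to the parts of a function: summands are dominated by the sum, and a
    factor c \<noteq> 0 is divided out.\<close>
  have pos: "\<Lambda> (\<lambda>x. of_real (u x)) = 0"
    if "u \<in> borel_measurable lborel" "\<And>x. 0 \<le> u x" "(\<lambda>x. of_real (u x)) \<in> L2_supp R" for u
    using that
  proof (induction rule: borel_measurable_induct_real)
    case (set A)
    have "A \<subseteq> ?I"
    proof
      fix x assume "x \<in> A" then show "x \<in> ?I" using set(2) by (force simp: L2_supp_def)
    qed
    then have "(\<lambda>x. of_real (indicator A x)) = (indicator (A \<inter> ?I) :: real \<Rightarrow> complex)"
      by (auto simp: fun_eq_iff indicator_def)
    then show ?case using ind[OF set(1)] by simp
  next
    case (mult u c)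
    show ?case
    proof (cases "c = 0")
      case True then show ?thesis using zero by simp
    next
      case False
      have eq: "(\<lambda>x. of_real (u x) :: complex) = (\<lambda>x. of_real (inverse c) * of_real (c * u x))"
        using False by (simp add: fun_eq_iff)
      then have "(\<lambda>x. of_real (u x)) \<in> L2_supp R"
        using L2_supp_cmult[OF mult.prems, of "of_real (inverse c)"] by simp
      then show ?thesis using mult.IH scale[of "\<lambda>x. of_real (u x)" "of_real c"] by simp
    qed
  next
    case (add u v)
    have m: "(\<lambda>x. complex_of_real (u x)) \<in> borel_measurable lborel"
        "(\<lambda>x. complex_of_real (v x)) \<in> borel_measurable lborel"
      using add.hyps by auto
    have "(\<lambda>x. of_real (u x)) \<in> L2_supp R" "(\<lambda>x. of_real (v x)) \<in> L2_supp R"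
      using add.hyps by (auto intro!: L2_supp_dominated[OF _ add.prems] m simp flip: of_real_add)
    then show ?case using assms(1) add.IH by simp
  next
    case (seq U)
    have le: "U i x \<le> u x" for i x
    proof (rule incseq_le)
      show "incseq (\<lambda>i. U i x)" using \<open>incseq U\<close> by (simp add: incseq_def le_fun_def)
      show "(\<lambda>i. U i x) \<longlonglongrightarrow> u x" using seq.hyps by simp
    qed
    show ?case
    proof (rule limit)
      show "(\<lambda>x. complex_of_real (U n x)) \<in> borel_measurable lborel" for n
        using seq.hyps by auto
      show "norm (complex_of_real (U n x)) \<le> norm (complex_of_real (u x))" for n x
        using seq.hyps le[of n x] by simp
      show "(\<lambda>n. complex_of_real (U n x)) \<longlonglongrightarrow> of_real (u x)" for x
        using seq.hyps by (intro tendsto_of_real) simp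
      show "\<Lambda> (\<lambda>x. complex_of_real (U n x)) = 0" if "(\<lambda>x. complex_of_real (U n x)) \<in> L2_supp R" for n
        using seq.IH that by blast
    qed (use seq.prems in auto)
  qed
  have real: "\<Lambda> (\<lambda>x. of_real (u x)) = 0"
    if m [measurable]: "u \<in> borel_measurable lborel" and X: "(\<lambda>x. of_real (u x)) \<in> L2_supp R" for u
  proof -
    have 1: "(\<lambda>x. complex_of_real (max 0 (u x))) \<in> L2_supp R"
        "(\<lambda>x. complex_of_real (max 0 (- u x))) \<in> L2_supp R"
      by (rule L2_supp_dominated[OF _ X]; auto)+
    have "(\<lambda>x. complex_of_real (u x)) = (\<lambda>x. of_real (max 0 (u x)) - of_real (max 0 (- u x)))"
      by (auto simp: fun_eq_iff max_def simp flip: of_real_diff)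
    then show ?thesis using diff[OF 1] pos[OF _ _ 1(1)] pos[OF _ _ 1(2)] by simp
  qed
  have m [measurable]: "f \<in> borel_measurable lborel" using f by (auto simp: L2_supp_def L2_def)
  have X: "(\<lambda>x. complex_of_real (Re (f x))) \<in> L2_supp R" "(\<lambda>x. complex_of_real (Im (f x))) \<in> L2_supp R"
    by (rule L2_supp_dominated[OF _ f]; auto simp: abs_Re_le_cmod abs_Im_le_cmod)+
  have "f = (\<lambda>x. of_real (Re (f x)) + \<i> * of_real (Im (f x)))"
    by (auto simp: fun_eq_iff complex_eq mult.commute)
  then have "\<Lambda> f = \<Lambda> (\<lambda>x. of_real (Re (f x))) + \<i> * \<Lambda> (\<lambda>x. of_real (Im (f x)))"
    using add[OF X(1) L2_supp_cmult[OF X(2), of \<i>]] scale[OF X(2), of \<i>] by simp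
  also have "\<dots> = 0"
    using real[OF _ X(1)] real[OF _ X(2)] by simp
  finally show ?thesis .
qed

subsection \<open>Absolutely continuous functions\<close>

lemma set_integral_combine:
  fixes g :: "real \<Rightarrow> complex"
  assumes "set_integrable lborel {a..b} g" "a \<le> c" "c \<le> b"
  shows "(LINT y:{a..b}|lborel. g y) = (LINT y:{a..c}|lborel. g y) + (LINT y:{c..b}|lborel. g y)"
proof -
  have 1: "set_integrable lborel {a..c} g" "set_integrable lborel {c..b} g"
    by (rule set_integrable_subset[OF assms(1)]; use assms in auto)+
  show ?thesis
    using Henstock_Kurzweil_Integration.integral_combine[OF assms(2,3)
        set_borel_integral_eq_integral(1)[OF assms(1)]]
    by (simp add: set_borel_integral_eq_integral(2)[OF 1(1)] set_borel_integral_eq_integral(2)[OF 1(2)]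
        set_borel_integral_eq_integral(2)[OF assms(1)])
qed

lemma set_integrable_continuous_mult:
  fixes f g :: "real \<Rightarrow> complex"
  assumes f: "continuous_on {a..b} f" and g: "set_integrable lborel {a..b} g"
  shows "set_integrable lborel {a..b} (\<lambda>x. f x * g x)"
proof -
  obtain B where B: "\<forall>x\<in>{a..b}. norm (f x) \<le> B"
    using compact_imp_bounded[OF compact_continuous_image[OF f compact_Icc]] by (auto simp: bounded_iff)
  have m1: "(\<lambda>x. indicator {a..b} x *\<^sub>R f x) \<in> borel_measurable lborel"
    using borel_measurable_continuous_on_indicator[OF _ f] by simp
  have m2: "(\<lambda>x. indicator {a..b} x *\<^sub>R g x) \<in> borel_measurable lborel"
    using g unfolding set_integrable_def by (rule borel_measurable_integrable)
  have eq: "(\<lambda>x. indicator {a..b} x *\<^sub>R (f x * g x))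
      = (\<lambda>x. (indicator {a..b} x *\<^sub>R f x) * (indicator {a..b} x *\<^sub>R g x))"
    by (auto simp: fun_eq_iff indicator_def)
  have "integrable lborel (\<lambda>x. indicator {a..b} x *\<^sub>R (f x * g x))"
  proof (rule Bochner_Integration.integrable_bound)
    show "integrable lborel (\<lambda>x. B *\<^sub>R (indicator {a..b} x *\<^sub>R g x))"
      using g unfolding set_integrable_def by (rule integrable_scaleR_right)
    show "(\<lambda>x. indicator {a..b} x *\<^sub>R (f x * g x)) \<in> borel_measurable lborel"
      unfolding eq by (rule borel_measurable_times[OF m1 m2])
    show "AE x in lborel. norm (indicator {a..b} x *\<^sub>R (f x * g x))
        \<le> norm (B *\<^sub>R (indicator {a..b} x *\<^sub>R g x))"
    proof (rule AE_I2)
      fix x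
      show "norm (indicator {a..b} x *\<^sub>R (f x * g x)) \<le> norm (B *\<^sub>R (indicator {a..b} x *\<^sub>R g x))"
        using B by (cases "x \<in> {a..b}") (auto simp: norm_mult intro!: mult_right_mono
            order_trans[OF _ abs_ge_self])
    qed
  qed
  then show ?thesis by (simp add: set_integrable_def)
qed

text \<open>The density is carried as data because it is determined only up to null sets. Calculus
  on such pairs uses identities between integrals and never differentiation almost
  everywhere.\<close>

definition ac_on :: "real \<Rightarrow> real \<Rightarrow> (real \<Rightarrow> complex) \<Rightarrow> (real \<Rightarrow> complex) \<Rightarrow> bool"
  where "ac_on a b f g \<longleftrightarrow> set_integrable lborel {a..b} g \<and>
    (\<forall>x\<in>{a..b}. f x = f a + (LINT y:{a..x}|lborel. g y))"

lemma ac_on_integrable: "ac_on a b f g \<Longrightarrow> set_integrable lborel {a..b} g"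
  unfolding ac_on_def by blast

lemma ac_on_eq: "ac_on a b f g \<Longrightarrow> x \<in> {a..b} \<Longrightarrow> f x = f a + (LINT y:{a..x}|lborel. g y)"
  unfolding ac_on_def by blast

lemma ac_onI:
  "set_integrable lborel {a..b} g \<Longrightarrow> (\<And>x. x \<in> {a..b} \<Longrightarrow> f x = f a + (LINT y:{a..x}|lborel. g y)) \<Longrightarrow>
      ac_on a b f g"
  unfolding ac_on_def by blast

lemma ac_on_diff:
  assumes "ac_on a b f g" "a \<le> x" "x \<le> y" "y \<le> b"
  shows "f y - f x = (LINT z:{x..y}|lborel. g z)"
proof -
  have "set_integrable lborel {a..y} g"
    by (rule set_integrable_subset[OF ac_on_integrable[OF assms(1)]]) (use assms(2-) in auto)
  from set_integral_combine[OF this assms(2,3)]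
  show ?thesis unfolding ac_on_eq[OF assms(1), of y, unfolded atLeastAtMost_iff, OF
      conjI[OF order_trans[OF assms(2,3)] assms(4)]]
      ac_on_eq[OF assms(1), of x, unfolded atLeastAtMost_iff, OF
          conjI[OF assms(2) order_trans[OF assms(3,4)]]]
    by simp
qed

lemma ac_on_continuous:
  assumes "ac_on a b f g"
  shows "continuous_on {a..b} f"
proof -
  note i = ac_on_integrable[OF assms]
  have "continuous_on {a..b} (\<lambda>x. f a + integral {a..x} g)"
    by (intro continuous_on_add continuous_on_const indefinite_integral_continuous_1
        set_borel_integral_eq_integral(1)[OF i])
  moreover have "f a + integral {a..x} g = f x" if "x \<in> {a..b}" for x
  proof -
    have "set_integrable lborel {a..x} g" by (rule set_integrable_subset[OF i]) (use that in auto)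
    from set_borel_integral_eq_integral(2)[OF this] ac_on_eq[OF assms that] show ?thesis by metis
  qed
  ultimately show ?thesis by (rule continuous_on_eq)
qed

text \<open>Fubini for the product of two densities, with the plane split along the diagonal. This
  is integration by parts for indefinite integrals in its rawest form.\<close>

lemma integral_prod_triangle:
  fixes u v :: "real \<Rightarrow> complex"
  assumes u: "integrable lborel u" and v: "integrable lborel v"
  shows "(LINT x|lborel. u x) * (LINT y|lborel. v y) =
    (LINT x|lborel. u x * (LINT y:{..x}|lborel. v y)) + (LINT y|lborel. v y * (LINT x:{..y}|lborel. u x))"
proof -
  have [measurable]: "u \<in> borel_measurable borel" "v \<in> borel_measurable borel" using u v by auto
  let ?P = "lborel \<Otimes>\<^sub>M lborel :: (real \<times> real) measure"
  define w where "w = (\<lambda>p. u (fst p) * v (snd p))"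
  define w1 where "w1 = (\<lambda>p. if snd p \<le> fst p then w p else 0)"
  define w2 where "w2 = (\<lambda>x y. if x < y then w (x, y) else 0)"
  have mw [measurable]: "w \<in> borel_measurable ?P" unfolding w_def by measurable
  have iw: "integrable ?P w"
  proof (rule lborel_pair.Fubini_integrable[OF mw])
    show "integrable lborel (\<lambda>x. LINT y|lborel. norm (w (x, y)))"
      using u v by (simp add: w_def norm_mult)
    show "AE x in lborel. integrable lborel (\<lambda>y. w (x, y))"
      using v by (simp add: w_def)
  qed
  have iw1: "integrable ?P w1"
    by (rule Bochner_Integration.integrable_bound[OF iw]) (simp_all add: w1_def)
  have mw2 [measurable]: "case_prod w2 \<in> borel_measurable ?P"
    unfolding w2_def split_beta' by measurable
  have iw2: "integrable ?P (case_prod w2)"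
    by (rule Bochner_Integration.integrable_bound[OF iw mw2]) (simp add: w2_def split_beta')
  have "(LINT x|lborel. u x) * (LINT y|lborel. v y) = (LINT x|lborel. LINT y|lborel. w (x, y))"
    by (simp add: w_def)
  also have "\<dots> = integral\<^sup>L ?P w" by (rule lborel_pair.integral_fst'[OF iw])
  also have "\<dots> = integral\<^sup>L ?P (\<lambda>p. w1 p + case_prod w2 p)"
    by (rule Bochner_Integration.integral_cong) (auto simp: w1_def w2_def)
  also have "\<dots> = integral\<^sup>L ?P w1 + integral\<^sup>L ?P (case_prod w2)"
    by (rule Bochner_Integration.integral_add[OF iw1 iw2])
  also have "integral\<^sup>L ?P w1 = (LINT x|lborel. LINT y|lborel. w1 (x, y))"
    by (rule lborel_pair.integral_fst'[OF iw1, symmetric])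
  also have "integral\<^sup>L ?P (case_prod w2) = (LINT y|lborel. LINT x|lborel. w2 x y)"
    by (rule lborel_pair.integral_snd[OF iw2, symmetric])
  also have "(\<lambda>x. LINT y|lborel. w1 (x, y)) = (\<lambda>x. u x * (LINT y:{..x}|lborel. v y))"
  proof
    fix x
    have "(LINT y|lborel. w1 (x, y)) = (LINT y|lborel. u x * (indicator {..x} y *\<^sub>R v y))"
      by (rule Bochner_Integration.integral_cong) (auto simp: w1_def w_def indicator_def)
    then show "(LINT y|lborel. w1 (x, y)) = u x * (LINT y:{..x}|lborel. v y)"
      by (simp only: set_lebesgue_integral_def Bochner_Integration.integral_mult_right_zero)
  qed
  also have "(\<lambda>y. LINT x|lborel. w2 x y) = (\<lambda>y. v y * (LINT x:{..y}|lborel. u x))"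
  proof
    fix y
    \<comment> \<open>The upper triangle is open, whereas \<open>{..y}\<close> contains its end
      point; the two integrands may differ at x = y only.\<close>
    have "(LINT x|lborel. w2 x y) = (LINT x|lborel. v y * (indicator {..y} x *\<^sub>R u x))"
    proof (rule integral_cong_AE)
      show "AE x in lborel. w2 x y = v y * (indicator {..y} x *\<^sub>R u x)"
        using AE_lborel_singleton[of y] by eventually_elim (auto simp: w2_def w_def indicator_def)
      show "(\<lambda>x. w2 x y) \<in> borel_measurable lborel" unfolding w2_def w_def fst_conv snd_conv
        by (intro measurable_If) measurable
    qed measurable
    then show "(LINT x|lborel. w2 x y) = v y * (LINT x:{..y}|lborel. u x)"
      by (simp only: set_lebesgue_integral_def Bochner_Integration.integral_mult_right_zero)
  qed
  finally show ?thesis .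
qed

text \<open>The triangle formula is applied to the densities cut off to [a,x]: their partial
  integrals are the increments of \<open>f\<close> and \<open>f'\<close> from a, and the product of
  the total increments expands into the boundary terms.\<close>

lemma ac_on_mult:
  assumes f: "ac_on a b f g" and f': "ac_on a b f' g'"
  shows "ac_on a b (\<lambda>x. f x * f' x) (\<lambda>x. g x * f' x + f x * g' x)"
proof -
  note c = ac_on_continuous[OF f] ac_on_continuous[OF f']
  have i: "set_integrable lborel {a..b} g" "set_integrable lborel {a..b} g'"
    using f f' by (simp_all add: ac_on_integrable)
  have i1: "set_integrable lborel {a..b} (\<lambda>x. g x * f' x)"
    using set_integrable_continuous_mult[OF c(2) i(1)] by (simp add: mult.commute)
  have i2: "set_integrable lborel {a..b} (\<lambda>x. f x * g' x)"
    by (rule set_integrable_continuous_mult[OF c(1) i(2)])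
  have "f x * f' x = f a * f' a + (LINT y:{a..x}|lborel. g y * f' y + f y * g' y)" if x: "x \<in> {a..b}" for x
  proof -
    define u where "u = (\<lambda>y. indicator {a..x} y *\<^sub>R g y)"
    define v where "v = (\<lambda>y. indicator {a..x} y *\<^sub>R g' y)"
    have sub: "{a..x} \<subseteq> {a..b}" using x by auto
    have j: "set_integrable lborel {a..x} g" "set_integrable lborel {a..x} g'"
        "set_integrable lborel {a..x} (\<lambda>x. g x * f' x)" "set_integrable lborel {a..x} (\<lambda>x. f x * g' x)"
      by (rule set_integrable_subset[OF _ _ sub], simp_all add: i i1 i2)+
    have iu: "integrable lborel u" and iv: "integrable lborel v"
      using j by (simp_all add: u_def v_def set_integrable_def)
    have U: "(LINT z:{..y}|lborel. u z) = f y - f a" and V: "(LINT z:{..y}|lborel. v z) = f' y - f' a"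
      if y: "y \<in> {a..x}" for y
    proof -
      have "(LINT z:{..y}|lborel. u z) = (LINT z:{a..y}|lborel. g z)"
        unfolding set_lebesgue_integral_def u_def
        by (rule Bochner_Integration.integral_cong) (use y in \<open>auto simp: indicator_def\<close>)
      then show "(LINT z:{..y}|lborel. u z) = f y - f a"
        using ac_on_diff[OF f, of a y] x y by simp
      have "(LINT z:{..y}|lborel. v z) = (LINT z:{a..y}|lborel. g' z)"
        unfolding set_lebesgue_integral_def v_def
        by (rule Bochner_Integration.integral_cong) (use y in \<open>auto simp: indicator_def\<close>)
      then show "(LINT z:{..y}|lborel. v z) = f' y - f' a"
        using ac_on_diff[OF f', of a y] x y by simp
    qed
    have Iu: "(LINT z|lborel. u z) = f x - f a" and Iv: "(LINT z|lborel. v z) = f' x - f' a"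
      using ac_on_diff[OF f, of a x] ac_on_diff[OF f', of a x] x
        by (auto simp: set_lebesgue_integral_def u_def v_def)
    have "(LINT y|lborel. u y * (LINT z:{..y}|lborel. v z))
        = (LINT y|lborel. indicator {a..x} y *\<^sub>R (g y * f' y) - f' a * u y)"
    proof (rule Bochner_Integration.integral_cong)
      fix y
      show "u y * (LINT z:{..y}|lborel. v z) = indicator {a..x} y *\<^sub>R (g y * f' y) - f' a * u y"
      proof (cases "y \<in> {a..x}")
        case True
        then show ?thesis unfolding V[OF True] by (simp add: u_def algebra_simps)
      qed (simp add: u_def)
    qed simp
    also have "\<dots> = (LINT y:{a..x}|lborel. g y * f' y) - f' a * (f x - f a)"
      using j iu by (simp add: Iu set_integrable_def set_lebesgue_integral_def)
    finally have 1: "(LINT y|lborel. u y * (LINT z:{..y}|lborel. v z)) = \<dots>" .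
    have "(LINT y|lborel. v y * (LINT z:{..y}|lborel. u z))
        = (LINT y|lborel. indicator {a..x} y *\<^sub>R (f y * g' y) - f a * v y)"
    proof (rule Bochner_Integration.integral_cong)
      fix y
      show "v y * (LINT z:{..y}|lborel. u z) = indicator {a..x} y *\<^sub>R (f y * g' y) - f a * v y"
      proof (cases "y \<in> {a..x}")
        case True
        then show ?thesis unfolding U[OF True] by (simp add: v_def algebra_simps)
      qed (simp add: v_def)
    qed simp
    also have "\<dots> = (LINT y:{a..x}|lborel. f y * g' y) - f a * (f' x - f' a)"
      using j iv by (simp add: Iv set_integrable_def set_lebesgue_integral_def)
    finally have 2: "(LINT y|lborel. v y * (LINT z:{..y}|lborel. u z)) = \<dots>" .
    have "(LINT y:{a..x}|lborel. g y * f' y + f y * g' y)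
        = (LINT y:{a..x}|lborel. g y * f' y) + (LINT y:{a..x}|lborel. f y * g' y)"
      using j by simp
    then show ?thesis
      using integral_prod_triangle[OF iu iv] unfolding 1 2 Iu Iv by (simp add: algebra_simps)
  qed
  then show ?thesis by (intro ac_onI set_integral_add(1) i1 i2)
qed

lemma set_integrable_cnj:
  "set_integrable lborel A g \<Longrightarrow> set_integrable lborel A (\<lambda>x. cnj (g x))"
  unfolding set_integrable_def by (simp flip: complex_cnj_scaleR)

lemma set_integral_cnj:
  "(LINT x:A|lborel. cnj (g x)) = cnj (LINT x:A|lborel. g x)"
  unfolding set_lebesgue_integral_def
  by (simp flip: Bochner_Integration.integral_cnj complex_cnj_scaleR)

lemma ac_on_cnj:
  assumes "ac_on a b f g"
  shows "ac_on a b (\<lambda>x. cnj (f x)) (\<lambda>x. cnj (g x))"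
proof (rule ac_onI)
  show "set_integrable lborel {a..b} (\<lambda>x. cnj (g x))"
    by (intro set_integrable_cnj ac_on_integrable[OF assms])
  show "cnj (f x) = cnj (f a) + (LINT y:{a..x}|lborel. cnj (g y))" if "x \<in> {a..b}" for x
    using ac_on_eq[OF assms that] by (metis complex_cnj_add set_integral_cnj)
qed

lemma ac_on_C1:
  assumes "\<And>x. x \<in> {a..b} \<Longrightarrow> (f has_vector_derivative g x) (at x within {a..b})" "continuous_on {a..b} g"
  shows "ac_on a b f g"
proof -
  have "set_integrable lborel {a..b} g" using assms(2) by (rule borel_integrable_atLeastAtMost')
  moreover have "f x = f a + (LINT y:{a..x}|lborel. g y)" if x: "x \<in> {a..b}" for x
  proof -
    have "(LINT y:{a..x}|lborel. g y) = f x - f a"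
      unfolding set_lebesgue_integral_def
    proof (rule integral_FTC_atLeastAtMost)
      show "(f has_vector_derivative g y) (at y within {a..x})" if "a \<le> y" "y \<le> x" for y
        using x that by (intro has_vector_derivative_within_subset[OF assms(1)]) auto
      show "continuous_on {a..x} g" using x by (intro continuous_on_subset[OF assms(2)]) auto
    qed (use x in auto)
    then show ?thesis by simp
  qed
  ultimately show ?thesis by (intro ac_onI)
qed

lemma L2_set_integrable: "g \<in> L2 \<Longrightarrow> set_integrable lborel {a..b} g"
  and L2_set_integral: "(LINT x:{a..b}|lborel. g x) = pairing (indicator {a..b}) g"
proof -
  have eq: "(\<lambda>x. indicator {a..b} x *\<^sub>R g x) = (\<lambda>x. indicator {a..b} x * g x)"
    by (auto simp: fun_eq_iff indicator_def)
  show "set_integrable lborel {a..b} g" if "g \<in> L2"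
    unfolding set_integrable_def eq using L2_integrable_mult[OF L2_indicator that, of "{a..b}" a b] by simp
  show "(LINT x:{a..b}|lborel. g x) = pairing (indicator {a..b}) g"
    unfolding set_lebesgue_integral_def eq pairing_def ..
qed

lemma l2norm_indicator: "a \<le> b \<Longrightarrow> l2norm (indicator {a..b}) = sqrt (b - a)"
proof -
  assume "a \<le> b"
  have "(\<lambda>x. (norm (indicator {a..b} x :: complex))\<^sup>2) = (indicator {a..b} :: real \<Rightarrow> real)"
    by (auto simp: fun_eq_iff indicator_def)
  with \<open>a \<le> b\<close> show ?thesis by (simp add: l2norm_def)
qed

lemma L2_set_integral_bound:
  assumes "g \<in> L2" "a \<le> b"
  shows "norm (LINT x:{a..b}|lborel. g x) \<le> sqrt (b - a) * l2norm g"
  using pairing_bound[OF L2_indicator[of "{a..b}" a b] assms(1)] assms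
  by (simp add: L2_set_integral l2norm_indicator)

text \<open>Pairing with d is a bounded functional that vanishes on intervals, hence on every
  windowed L2 function. The windowed conjugate of d is one of these and returns the squared norm of
  d on the window.\<close>

lemma L2_eq_0_AE:
  assumes d: "d \<in> L2" and 0: "\<And>a b. a \<le> b \<Longrightarrow> (LINT x:{a..b}|lborel. d x) = 0"
  shows "AE x in lborel. d x = 0"
proof -
  have "AE x in lborel. x \<in> {-real n..real n} \<longrightarrow> d x = 0" for n :: nat
  proof -
    let ?I = "{-real n..real n}"
    define k where "k = (\<lambda>x. indicator ?I x * cnj (d x))"
    have "k \<in> L2"
      unfolding k_def by (rule L2_mult_bounded(1)[OF _ L2_cnj[OF d], where C = 1]) (auto simp: indicator_def)
    then have k: "k \<in> L2_supp (real n)" by (auto simp: L2_supp_def k_def indicator_def)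
    have "pairing d k = 0"
    proof (rule L2_functional_eq_0[OF _ _ _ _ k])
      show "pairing d (\<lambda>x. f x + g x) = pairing d f + pairing d g"
        if "f \<in> L2_supp (real n)" "g \<in> L2_supp (real n)" for f g
        using that d by (simp add: L2_supp_def pairing_add_right)
      show "norm (pairing d f) \<le> l2norm d * l2norm f" if "f \<in> L2_supp (real n)" for f
        using that d by (simp add: L2_supp_def pairing_bound)
      show "pairing d (indicator {a..b}) = 0" if "a \<le> b" for a b
        using 0[OF that] by (simp add: L2_set_integral pairing_commute)
    qed (simp add: pairing_cmult_right)
    moreover have kk: "d x * k x = of_real ((norm (k x))\<^sup>2)" for x
      by (auto simp: k_def indicator_def complex_norm_square[symmetric] simp del: of_real_power)
    ultimately have "complex_of_real (LINT x|lborel. (norm (k x))\<^sup>2) = 0"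
      by (simp add: pairing_def del: of_real_power)
    then have "AE x in lborel. (norm (k x))\<^sup>2 = 0"
      using integral_nonneg_eq_0_iff_AE[OF L2_integrable_norm[OF \<open>k \<in> L2\<close>]] by (simp del: of_real_power)
    then show ?thesis by eventually_elim (auto simp: k_def indicator_def)
  qed
  then have "AE x in lborel. \<forall>n::nat. x \<in> {-real n..real n} \<longrightarrow> d x = 0"
    by (subst AE_all_countable) blast
  then show ?thesis
  proof eventually_elim
    fix x assume *: "\<forall>n::nat. x \<in> {-real n..real n} \<longrightarrow> d x = 0"
    obtain n :: nat where "\<bar>x\<bar> \<le> real n" using real_arch_simple by blast
    then show "d x = 0" using * by (auto simp: abs_le_iff)
  qed
qed

text \<open>An H1 function in the form of a primitive of an explicit L2 function. The identity holds
  for all end points, which pins down the continuous representative and makes point values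
  legitimate; naming the derivative keeps linear operations free of choice.\<close>

definition h1_pair :: "(real \<Rightarrow> complex) \<Rightarrow> (real \<Rightarrow> complex) \<Rightarrow> bool"
  where "h1_pair f g \<longleftrightarrow> f \<in> L2 \<and> g \<in> L2 \<and>
    (\<forall>a b. a \<le> b \<longrightarrow> f b - f a = (LINT x:{a..b}|lborel. g x))"

lemma h1_pair_L2: "h1_pair f g \<Longrightarrow> f \<in> L2" "h1_pair f g \<Longrightarrow> g \<in> L2"
  by (auto simp: h1_pair_def)

lemma h1_pair_ac_on: "h1_pair f g \<Longrightarrow> ac_on a b f g"
  by (rule ac_onI) (auto simp: h1_pair_def L2_set_integrable diff_eq_eq add.commute)

lemma h1_pair_add: "h1_pair f g \<Longrightarrow> h1_pair f' g' \<Longrightarrow> h1_pair (\<lambda>x. f x + f' x) (\<lambda>x. g x + g' x)"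
  unfolding h1_pair_def by (auto simp: L2_add L2_set_integrable) (metis add_diff_add)

lemma h1_pair_cmult: "h1_pair f g \<Longrightarrow> h1_pair (\<lambda>x. c * f x) (\<lambda>x. c * g x)"
  unfolding h1_pair_def by (auto simp: L2_cmult simp flip: right_diff_distrib)

lemma h1_pair_diff: "h1_pair f g \<Longrightarrow> h1_pair f' g' \<Longrightarrow> h1_pair (\<lambda>x. f x - f' x) (\<lambda>x. g x - g' x)"
  using h1_pair_add[OF _ h1_pair_cmult[of f' g' "-1"]] by simp

lemma h1_pair_cnj: "h1_pair f g \<Longrightarrow> h1_pair (\<lambda>x. cnj (f x)) (\<lambda>x. cnj (g x))"
  unfolding h1_pair_def by (auto simp: L2_cnj set_integral_cnj simp flip: complex_cnj_diff)

lemma h1_pair_hoelder: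
  assumes "h1_pair f g"
  shows "norm (f y - f x) \<le> sqrt \<bar>y - x\<bar> * l2norm g"
proof -
  have *: "norm (f y - f x) \<le> sqrt \<bar>y - x\<bar> * l2norm g" if "x \<le> y" for x y
    using assms that L2_set_integral_bound[of g x y] by (simp add: h1_pair_def)
  show ?thesis using *[of x y] *[of y x] by (cases "x \<le> y") (auto simp: norm_minus_commute abs_minus_commute)
qed

text \<open>The product |f|^2 is a primitive of g cnj f + f cnj g, which Cauchy-Schwarz bounds.
  Square integrability already provides a point y to the left of x where |f(y)|^2 is at most e, so
  no limit of f at infinity has to be established.\<close>

lemma h1_pair_sobolev:
  assumes fg: "h1_pair f g"
  shows "(norm (f x))\<^sup>2 \<le> 2 * l2norm f * l2norm g"
proof (rule field_le_epsilon)
  fix e :: real assume e: "e > 0"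
  note f = h1_pair_L2(1)[OF fg] and g = h1_pair_L2(2)[OF fg]
  have "\<exists>y\<le>x. (norm (f y))\<^sup>2 \<le> e"
  proof (rule ccontr)
    assume "\<not> ?thesis"
    then have gt: "(norm (f y))\<^sup>2 \<ge> e" if "y \<le> x" for y using that by (meson linear)
    \<comment> \<open>A lower bound e on the whole half-line would make the integral over [x - n, x]
      grow without bound in n.\<close>
    have "e * real n \<le> (l2norm f)\<^sup>2" for n :: nat
    proof -
      have "e * real n = (LINT y|lborel. e * indicator {x - real n..x} y)" by simp
      also have "\<dots> \<le> (LINT y|lborel. (norm (f y))\<^sup>2)"
      proof (rule integral_mono[OF _ L2_integrable_norm[OF f]])
        have "integrable lborel (indicator {x - real n..x} :: real \<Rightarrow> real)"
          by (rule integrable_real_indicator) (simp_all add: emeasure_lborel_Icc_eq)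
        then show "integrable lborel (\<lambda>y. e * indicator {x - real n..x} y)" by simp
      qed (use gt e in \<open>auto simp: indicator_def\<close>)
      finally show ?thesis by (simp add: l2norm_square)
    qed
    moreover obtain n :: nat where "(l2norm f)\<^sup>2 < real n * e" using reals_Archimedean3[OF e] by blast
    ultimately show False by (metis linorder_not_le mult.commute)
  qed
  then obtain y where y: "y \<le> x" "(norm (f y))\<^sup>2 \<le> e" by blast
  have ac: "ac_on y x (\<lambda>z. f z * cnj (f z)) (\<lambda>z. g z * cnj (f z) + f z * cnj (g z))"
    by (intro ac_on_mult ac_on_cnj h1_pair_ac_on fg)
  let ?J = "indicator {y..x} :: real \<Rightarrow> complex"
  have J: "(\<lambda>z. ?J z * g z) \<in> L2" "l2norm (\<lambda>z. ?J z * g z) \<le> 1 * l2norm g"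
    using L2_mult_bounded[OF _ g, of ?J 1] by (simp_all add: indicator_def)
  have K: "(\<lambda>z. ?J z * f z) \<in> L2" "l2norm (\<lambda>z. ?J z * f z) \<le> 1 * l2norm f"
    using L2_mult_bounded[OF _ f, of ?J 1] by (simp_all add: indicator_def)
  have "(LINT z:{y..x}|lborel. g z * cnj (f z) + f z * cnj (g z))
      = (LINT z|lborel. (?J z * g z) * cnj (f z) + (?J z * f z) * cnj (g z))"
    unfolding set_lebesgue_integral_def
    by (rule Bochner_Integration.integral_cong) (auto simp: indicator_def)
  also have "\<dots> = pairing (\<lambda>z. ?J z * g z) (\<lambda>z. cnj (f z)) + pairing (\<lambda>z. ?J z * f z) (\<lambda>z. cnj (g z))"
    unfolding pairing_def using J K f g
    by (intro Bochner_Integration.integral_add L2_integrable_mult L2_cnj)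
  also have "norm \<dots> \<le> l2norm g * l2norm f + l2norm f * l2norm g"
  proof (intro norm_triangle_mono)
    show "norm (pairing (\<lambda>z. ?J z * g z) (\<lambda>z. cnj (f z))) \<le> l2norm g * l2norm f"
      using pairing_bound[OF J(1) L2_cnj[OF f]] mult_right_mono[OF J(2) l2norm_nonneg[of f]]
        by (simp add: l2norm_cnj)
    show "norm (pairing (\<lambda>z. ?J z * f z) (\<lambda>z. cnj (g z))) \<le> l2norm f * l2norm g"
      using pairing_bound[OF K(1) L2_cnj[OF g]] mult_right_mono[OF K(2) l2norm_nonneg[of g]]
        by (simp add: l2norm_cnj)
  qed
  finally have "norm (f x * cnj (f x) - f y * cnj (f y)) \<le> 2 * l2norm f * l2norm g"
    using ac_on_diff[OF ac order_refl y(1) order_refl] by (simp add: mult_ac)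
  moreover have "norm (f x * cnj (f x)) \<le> norm (f x * cnj (f x) - f y * cnj (f y)) + norm (f y * cnj (f y))"
    using norm_triangle_ineq[of "f x * cnj (f x) - f y * cnj (f y)" "f y * cnj (f y)"] by simp
  ultimately show "(norm (f x))\<^sup>2 \<le> 2 * l2norm f * l2norm g + e"
    using y(2) by (simp add: norm_mult power2_eq_square)
qed

lemma h1_pair_mult_C1:
  assumes fg: "h1_pair f g"
    and \<theta>: "\<And>x. (\<theta> has_real_derivative \<theta>' x) (at x)" "continuous_on UNIV \<theta>'"
    and b: "\<And>x. \<bar>\<theta> x\<bar> \<le> C" "\<And>x. \<bar>\<theta>' x\<bar> \<le> C'"
  shows "h1_pair (\<lambda>x. of_real (\<theta> x) * f x) (\<lambda>x. of_real (\<theta>' x) * f x + of_real (\<theta> x) * g x)"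
proof -
  have "continuous_on UNIV \<theta>"
    using \<theta>(1) by (meson DERIV_isCont continuous_at_imp_continuous_on)
  then have m: "\<theta> \<in> borel_measurable lborel" "\<theta>' \<in> borel_measurable lborel"
    using \<theta>(2) by (auto intro: borel_measurable_continuous_onI)
  have L: "(\<lambda>x. of_real (\<theta> x) * f x) \<in> L2" "(\<lambda>x. of_real (\<theta>' x) * f x) \<in> L2" "(\<lambda>x. of_real (\<theta> x) * g x) \<in> L2"
    using m b h1_pair_L2[OF fg]
    by (auto intro: L2_mult_bounded(1)[of _ f C] L2_mult_bounded(1)[of _ f C'] L2_mult_bounded(1)[of _ g C])
  have "of_real (\<theta> y) * f y - of_real (\<theta> x) * f x =
      (LINT z:{x..y}|lborel. of_real (\<theta>' z) * f z + of_real (\<theta> z) * g z)" if "x \<le> y" for x y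
  proof -
    have "ac_on x y (\<lambda>x. complex_of_real (\<theta> x)) (\<lambda>x. of_real (\<theta>' x))"
      by (intro ac_on_C1 has_vector_derivative_of_real continuous_on_of_real continuous_on_subset[OF \<theta>(2)])
        (use \<theta>(1) in \<open>auto intro: has_field_derivative_at_within\<close>)
    from ac_on_diff[OF ac_on_mult[OF this h1_pair_ac_on[OF fg]] order_refl that order_refl]
    show ?thesis by simp
  qed
  then show ?thesis using L by (simp add: h1_pair_def L2_add)
qed

subsection \<open>Weak derivatives\<close>

lemma integrable_continuous_support:
  fixes h :: "'a::euclidean_space \<Rightarrow> complex"
  assumes "continuous_on UNIV h" "\<And>x. x \<notin> K \<Longrightarrow> h x = 0" "compact K"
  shows "integrable lborel h"
proof -
  have "(\<lambda>x. indicator K x *\<^sub>R h x) = h" using assms(2) by (auto simp: fun_eq_iff indicator_def)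
  then show ?thesis
    using borel_integrable_compact[OF assms(3) continuous_on_subset[OF assms(1)]] by simp
qed

lemma L2_continuous_support:
  assumes "continuous_on UNIV h" "\<And>x. x \<notin> K \<Longrightarrow> h x = 0" "compact K"
  shows "h \<in> L2"
proof -
  have "integrable lborel (\<lambda>x. complex_of_real ((norm (h x))\<^sup>2))"
    using assms by (intro integrable_continuous_support[of _ K] continuous_intros) auto
  then have "integrable lborel (\<lambda>x. (norm (h x))\<^sup>2)"
    using integrable_Re by fastforce
  then show ?thesis using assms(1) by (auto simp: L2_def intro: borel_measurable_continuous_onI)
qed

lemma test_fun_L2:
  fixes \<eta> :: "real \<Rightarrow> complex"
  assumes "test_fun \<eta>" shows "\<eta> \<in> L2"
proof -
  obtain R where "\<And>x. \<bar>x\<bar> \<ge> R \<Longrightarrow> \<eta> x = 0" using test_fun_eq_0[OF assms] by metis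
  then show ?thesis
    by (intro L2_continuous_support[of _ "{-R..R}"] continuous_test_fun[OF assms] compact_Icc) (auto
        simp: abs_le_iff)
qed

text \<open>A smoothed indicator of [a,b]: each jump becomes a layer of half-width 1/n, displaced by
  -r/n from a and by -s/n from b.\<close>

definition smooth_box :: "real \<Rightarrow> real \<Rightarrow> real \<Rightarrow> real \<Rightarrow> real \<Rightarrow> real \<Rightarrow> complex"
  where "smooth_box n a r b s x = of_real (smooth_step (n * (x - a) + r) - smooth_step (n * (x - b) + s))"

lemma smooth_box_deriv:
  "(smooth_box n a r b s has_vector_derivative of_real (n * bump (n * (x - a) + r)
      - n * bump (n * (x - b) + s))) (at x)"
  unfolding smooth_box_def[abs_def]
proof (rule has_vector_derivative_of_real)
  have *: "((\<lambda>x. smooth_step (n * (x - a) + r)) has_real_derivative bump (n * (x - a) + r) * n) (at x)"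
      for a r
    by (rule DERIV_chain2[OF smooth_step_deriv]) (auto intro!: derivative_eq_intros)
  show "((\<lambda>x. smooth_step (n * (x - a) + r) - smooth_step (n * (x - b) + s)) has_real_derivative
      n * bump (n * (x - a) + r) - n * bump (n * (x - b) + s)) (at x)"
    using DERIV_diff[OF *[of a r] *[of b s]] by (simp add: mult.commute)
qed

lemma smooth_box_eq_0:
  assumes "n > 0" "x \<notin> {min (a - (1 + r) / n) (b - (1 + s) / n)..max (a + (1 - r) / n) (b + (1 - s) / n)}"
  shows "smooth_box n a r b s x = 0"
proof -
  consider "x < a - (1 + r) / n" "x < b - (1 + s) / n" | "x > a + (1 - r) / n" "x > b + (1 - s) / n"
    using assms(2) by fastforce
  then show ?thesis
  proof cases
    case 1
    then have "n * (x - a) + r \<le> -1" "n * (x - b) + s \<le> -1" using assms(1) by (auto simp: field_simps)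
    then show ?thesis by (simp add: smooth_box_def smooth_step_eq_0)
  next
    case 2
    then have "n * (x - a) + r \<ge> 1" "n * (x - b) + s \<ge> 1" using assms(1) by (auto simp: field_simps)
    then show ?thesis by (simp add: smooth_box_def smooth_step_eq_1)
  qed
qed

lemma test_fun_smooth_box:
  assumes "n > 0" shows "test_fun (smooth_box n a r b s)"
proof (rule test_funI)
  show "Ck k (smooth_box n a r b s)" for k
  proof -
    have *: "Ck k (\<lambda>x. complex_of_real (smooth_step (n * x + c)))" for c
      by (intro Ck_bounded_linear[OF bounded_linear_of_real]
          Ck_compose_affine[OF bounded_linear_mult_right] Ck_smooth_step)
    have "Ck k (\<lambda>x. complex_of_real (smooth_step (n * x + (r - n * a)))
        + (-1) * complex_of_real (smooth_step (n * x + (s - n * b))))"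
      by (intro Ck_add Ck_bounded_linear[OF bounded_linear_mult_right] *)
    then show ?thesis by (simp add: smooth_box_def[abs_def] algebra_simps)
  qed
  show "smooth_box n a r b s x = 0"
    if "x \<notin> {min (a - (1 + r) / n) (b - (1 + s) / n)..max (a + (1 - r) / n) (b + (1 - s) / n)}" for x
    using smooth_box_eq_0[OF assms that] .
qed (rule compact_Icc)

lemma norm_smooth_box: "norm (smooth_box n a r b s x) \<le> 1"
  unfolding smooth_box_def norm_of_real
  using smooth_step_bounds[of "n * (x - a) + r"] smooth_step_bounds[of "n * (x - b) + s"] by linarith

lemma smooth_step_tendsto:
  assumes "x \<noteq> a"
  shows "(\<lambda>n. smooth_step (real (Suc n) * (x - a) + r)) \<longlonglongrightarrow> (if x < a then 0 else 1)"
proof -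
  obtain N :: nat where N: "1 + \<bar>r\<bar> < real N * \<bar>x - a\<bar>"
    using reals_Archimedean3[of "\<bar>x - a\<bar>"] assms by auto
  have "\<forall>\<^sub>F n in sequentially. (if x < a then 0 else 1) = smooth_step (real (Suc n) * (x - a) + r)"
    using eventually_ge_at_top[of N]
  proof eventually_elim
    fix n assume "N \<le> n"
    then have "real N * \<bar>x - a\<bar> \<le> real (Suc n) * \<bar>x - a\<bar>" by (intro mult_right_mono) auto
    with N have *: "1 + \<bar>r\<bar> < real (Suc n) * \<bar>x - a\<bar>" by linarith
    show "(if x < a then 0 else 1) = smooth_step (real (Suc n) * (x - a) + r)"
    proof (cases "x < a")
      case True
      then have "real (Suc n) * (x - a) = - (real (Suc n) * \<bar>x - a\<bar>)" by (simp add: algebra_simps)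
      then have "smooth_step (real (Suc n) * (x - a) + r) = 0" using * by (intro smooth_step_eq_0) linarith
      then show ?thesis using True by simp
    next
      case False
      then have "real (Suc n) * (x - a) = real (Suc n) * \<bar>x - a\<bar>" by simp
      then have "smooth_step (real (Suc n) * (x - a) + r) = 1" using * by (intro smooth_step_eq_1) linarith
      then show ?thesis using False by simp
    qed
  qed
  then show ?thesis by (rule Lim_transform_eventually[OF tendsto_const])
qed

lemma smooth_box_tendsto:
  assumes "x \<noteq> a" "x \<noteq> b" "a \<le> b"
  shows "(\<lambda>n. smooth_box (real (Suc n)) a r b s x) \<longlonglongrightarrow> indicator {a..b} x"
  using tendsto_of_real[OF tendsto_diff[OF smooth_step_tendsto[OF assms(1), of r]
      smooth_step_tendsto[OF assms(2), of s]]] assms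
  by (auto simp: smooth_box_def indicator_def split: if_splits)

lemma mollifier_tendsto:
  fixes f :: "real \<Rightarrow> complex"
  assumes f: "continuous_on UNIV f"
  shows "(\<lambda>n. LINT x|lborel. f x * of_real (real (Suc n) * bump (real (Suc n) * (x - a)))) \<longlonglongrightarrow> f a"
proof (rule LIMSEQ_I)
  fix e :: real assume e: "e > 0"
  obtain d where d: "d > 0" "\<And>x. dist x a < d \<Longrightarrow> dist (f x) (f a) < e / 2"
    using f e unfolding continuous_on_iff by (metis UNIV_I half_gt_zero)
  obtain N :: nat where N: "1 < real N * d" using reals_Archimedean3[OF d(1)] by blast
  show "\<exists>no. \<forall>n\<ge>no. norm ((LINT x|lborel. f x * of_real (real (Suc n) * bump (real (Suc n) * (x - a))))
      - f a) < e"
  proof (intro exI allI impI)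
    fix n assume "N \<le> n"
    define m where "m = real (Suc n)"
    define K where "K = (\<lambda>x. m * bump (m * (x - a)))"
    have m: "m > 0" by (simp add: m_def)
    have "real N * d \<le> m * d" using \<open>N \<le> n\<close> d(1) by (intro mult_right_mono) (auto simp: m_def)
    with N have md: "1 < m * d" by linarith
    have Kc: "continuous_on S K" for S
      unfolding K_def by (intro continuous_intros continuous_on_compose2[OF continuous_bump[of UNIV]]) auto
    have K0: "K x = 0" if "x \<notin> {a - d..a + d}" for x
    proof -
      have "\<bar>x - a\<bar> \<ge> d" using that by auto
      with m have "m * d \<le> m * \<bar>x - a\<bar>" by (intro mult_left_mono) auto
      with md m have "\<bar>m * (x - a)\<bar> \<ge> 1" unfolding abs_mult by linarith
      then show ?thesis by (simp add: K_def bump_eq_0)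
    qed
    have Kn: "K x \<ge> 0" for x using m bump_nonneg by (simp add: K_def)
    have FI: "integrable lborel (\<lambda>x. g x * complex_of_real (K x))" if "continuous_on UNIV g" for g
      by (rule integrable_continuous_support[where K = "{a - d..a + d}"])
        (use K0 in \<open>auto intro!: continuous_intros that Kc\<close>)
    \<comment> \<open>The kernel has mass one because its primitive is a rescaled
      \<open>smooth_step\<close>, which has already reached 0 and 1 at a - d and a + d thanks to m d
      > 1.\<close>
    have "(LINT x|lborel. indicator {a - d..a + d} x *\<^sub>R K x) = smooth_step (m * d) - smooth_step (- m * d)"
    proof -
      have "((\<lambda>x. smooth_step (m * (x - a))) has_real_derivative K x) (at x)" for x
        unfolding K_def by (rule DERIV_chain2[OF smooth_step_deriv, THEN DERIV_cong])
            (auto intro!: derivative_eq_intros)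
      then have "(LINT x|lborel. indicator {a - d..a + d} x *\<^sub>R K x)
          = smooth_step (m * ((a + d) - a)) - smooth_step (m * ((a - d) - a))"
        by (intro integral_FTC_atLeastAtMost Kc)
          (use d in \<open>auto simp: has_real_derivative_iff_has_vector_derivative[symmetric] intro:
              has_field_derivative_at_within\<close>)
      then show ?thesis by simp
    qed
    moreover have "smooth_step (m * d) = 1" "smooth_step (- m * d) = 0"
      using md by (auto intro: smooth_step_eq_1 smooth_step_eq_0)
    moreover have "(\<lambda>x. indicator {a - d..a + d} x *\<^sub>R K x) = K" using K0
      by (auto simp: fun_eq_iff indicator_def)
    ultimately have I1: "(LINT x|lborel. K x) = 1" by simp
    have IK: "integrable lborel K" using integrable_Re[OF FI[of "\<lambda>x. 1"]] by simp
    have "(LINT x|lborel. f x * of_real (K x)) - f a = (LINT x|lborel. (f x - f a) * of_real (K x))"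
      using FI[OF f] FI[of "\<lambda>x. f a"] I1 by (simp add: left_diff_distrib Bochner_Integration.integral_diff)
    also have "norm \<dots> \<le> (LINT x|lborel. norm ((f x - f a) * of_real (K x)))"
      by (rule integral_norm_bound)
    also have "\<dots> \<le> (LINT x|lborel. (e / 2) * K x)"
    proof (rule integral_mono)
      show "integrable lborel (\<lambda>x. norm ((f x - f a) * complex_of_real (K x)))"
        by (intro integrable_norm FI continuous_intros f)
      show "integrable lborel (\<lambda>x. (e / 2) * K x)" using IK by simp
      show "norm ((f x - f a) * complex_of_real (K x)) \<le> (e / 2) * K x" for x
      proof (cases "dist x a < d")
        case True
        then have "norm (f x - f a) * K x \<le> (e / 2) * K x"
          using d(2)[OF True] Kn[of x] by (intro mult_right_mono) (auto simp: dist_norm)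
        then show ?thesis using Kn[of x] by (simp only: norm_mult norm_of_real abs_of_nonneg)
      next
        case False
        then have "\<bar>x - a\<bar> \<ge> d" by (simp add: dist_real_def)
        with m have "m * d \<le> m * \<bar>x - a\<bar>" by (intro mult_left_mono) auto
        with md m have "\<bar>m * (x - a)\<bar> \<ge> 1" unfolding abs_mult by linarith
        then show ?thesis by (simp add: K_def bump_eq_0)
      qed
    qed
    also have "\<dots> = e / 2" using I1 by simp
    finally show "norm ((LINT x|lborel. f x * of_real (real (Suc n) * bump (real (Suc n) * (x - a))))
        - f a) < e"
      using e by (simp add: K_def m_def)
  qed
qed

lemma integrable_mollifier:
  fixes f :: "real \<Rightarrow> complex"
  assumes f: "continuous_on UNIV f"
  shows "integrable lborel (\<lambda>x. f x * of_real (real (Suc n) * bump (real (Suc n) * (x - a))))"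
proof (rule integrable_continuous_support[where K = "{a - 1..a + 1}"])
  show "continuous_on UNIV (\<lambda>x. f x * complex_of_real (real (Suc n) * bump (real (Suc n) * (x - a))))"
    by (intro continuous_intros f continuous_on_compose2[OF continuous_bump[of UNIV]]) auto
  fix x assume "x \<notin> {a - 1..a + 1}"
  then have "1 \<le> \<bar>x - a\<bar>" by auto
  also have "\<dots> \<le> real (Suc n) * \<bar>x - a\<bar>" by (simp add: distrib_right)
  finally have "\<bar>real (Suc n) * (x - a)\<bar> \<ge> 1" by (simp add: abs_mult)
  then show "f x * complex_of_real (real (Suc n) * bump (real (Suc n) * (x - a))) = 0"
    using bump_eq_0 by simp
qed (rule compact_Icc)

text \<open>Tested with a smoothed indicator of [a,b], the weak derivative sees the difference of
  two mollifiers, centred at a and at b; by continuity of f these converge to point values. Local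
  integrability of g is the natural requirement, since the lemma serves both derivatives in x, which
  are in L2, and derivatives in t, which are continuous.\<close>

lemma weak_deriv_integral:
  assumes f: "continuous_on UNIV f" and w: "weak_deriv f g"
    and g: "\<And>R. set_integrable lborel {-R..R} g" and ab: "a \<le> b"
  shows "f b - f a = (LINT x:{a..b}|lborel. g x)"
proof -
  define \<eta> where "\<eta> n = smooth_box (real (Suc n)) a 0 b 0" for n
  define R where "R = \<bar>a\<bar> + \<bar>b\<bar> + 1"
  have t: "test_fun (\<eta> n)" for n by (simp add: \<eta>_def test_fun_smooth_box)
  have "(LINT x|lborel. f x * dir_deriv 1 (\<eta> n) x) = - (LINT x|lborel. g x * \<eta> n x)" for n
    using w t unfolding weak_deriv_def by blast
  moreover have "(LINT x|lborel. f x * dir_deriv 1 (\<eta> n) x)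
      = (LINT x|lborel. f x * of_real (real (Suc n) * bump (real (Suc n) * (x - a))))
      - (LINT x|lborel. f x * of_real (real (Suc n) * bump (real (Suc n) * (x - b))))" for n
  proof -
    have "dir_deriv 1 (\<eta> n) x = of_real (real (Suc n) * bump (real (Suc n) * (x - a)))
        - of_real (real (Suc n) * bump (real (Suc n) * (x - b)))" for x
      unfolding \<eta>_def by (subst dir_deriv_vector_derivative[OF smooth_box_deriv]) simp
    then have "(LINT x|lborel. f x * dir_deriv 1 (\<eta> n) x)
      = (LINT x|lborel. f x * of_real (real (Suc n) * bump (real (Suc n) * (x - a)))
        - f x * of_real (real (Suc n) * bump (real (Suc n) * (x - b))))"
      by (simp add: right_diff_distrib)
    also have "\<dots> = (LINT x|lborel. f x * of_real (real (Suc n) * bump (real (Suc n) * (x - a))))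
      - (LINT x|lborel. f x * of_real (real (Suc n) * bump (real (Suc n) * (x - b))))"
      by (rule Bochner_Integration.integral_diff[OF integrable_mollifier[OF f] integrable_mollifier[OF f]])
    finally show ?thesis .
  qed
  ultimately have "(\<lambda>n. - (LINT x|lborel. g x * \<eta> n x)) \<longlonglongrightarrow> f a - f b"
    using tendsto_diff[OF mollifier_tendsto[OF f, of a] mollifier_tendsto[OF f, of b]] by simp
  moreover have "(\<lambda>n. LINT x|lborel. g x * \<eta> n x) \<longlonglongrightarrow> (LINT x|lborel. indicator {a..b} x *\<^sub>R g x)"
  proof -
    define G where "G = (\<lambda>x. indicator {-R..R} x *\<^sub>R g x)"
    have G: "integrable lborel G" using g[of R] by (simp add: G_def set_integrable_def)
    have \<eta>0: "\<eta> n x = 0" if "x \<notin> {-R..R}" for n x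
    proof -
      have "inverse (real (Suc n)) \<le> 1" by (simp add: field_simps)
      then show ?thesis
        unfolding \<eta>_def by (intro smooth_box_eq_0)
            (use that in \<open>auto simp: R_def min_def max_def divide_inverse\<close>)
    qed
    have eq: "(\<lambda>x. g x * \<eta> n x) = (\<lambda>x. G x * \<eta> n x)" for n
      using \<eta>0 by (auto simp: fun_eq_iff G_def indicator_def)
    have eq2: "(\<lambda>x. indicator {a..b} x *\<^sub>R g x) = (\<lambda>x. G x * indicator {a..b} x)"
      by (auto simp: fun_eq_iff G_def indicator_def R_def)
    have mG: "G \<in> borel_measurable lborel" using G by (rule borel_measurable_integrable)
    have m\<eta>: "\<eta> n \<in> borel_measurable lborel" for n
      using borel_measurable_continuous_onI[OF continuous_test_fun[OF t]] by simp
    show ?thesis unfolding eq eq2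
    proof (rule Bochner_Integration.integral_dominated_convergence[where w = "\<lambda>x. norm (G x)"])
      show "(\<lambda>x. G x * indicator {a..b} x) \<in> borel_measurable lborel"
        by (rule borel_measurable_times[OF mG]) simp
      show "(\<lambda>x. G x * \<eta> n x) \<in> borel_measurable lborel" for n
        by (rule borel_measurable_times[OF mG m\<eta>])
      show "integrable lborel (\<lambda>x. norm (G x))" using G by (rule integrable_norm)
      show "AE x in lborel. (\<lambda>n. G x * \<eta> n x) \<longlonglongrightarrow> G x * indicator {a..b} x"
        using AE_lborel_singleton[of a] AE_lborel_singleton[of b]
      proof eventually_elim
        fix x assume "x \<noteq> a" "x \<noteq> b"
        then show "(\<lambda>n. G x * \<eta> n x) \<longlonglongrightarrow> G x * indicator {a..b} x"
          unfolding \<eta>_def by (intro tendsto_mult tendsto_const smooth_box_tendsto ab)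
      qed
      show "AE x in lborel. norm (G x * \<eta> n x) \<le> norm (G x)" for n
        using norm_smooth_box by (auto simp: norm_mult \<eta>_def intro!: mult_left_le)
    qed
  qed
  ultimately have "f a - f b = - (LINT x|lborel. indicator {a..b} x *\<^sub>R g x)"
    using LIMSEQ_unique tendsto_minus by blast
  then show ?thesis by (simp add: set_lebesgue_integral_def algebra_simps)
qed

section \<open>The H1 norm and the chosen weak derivative\<close>

definition h1_deriv :: "(real \<Rightarrow> complex) \<Rightarrow> real \<Rightarrow> complex"
  where "h1_deriv f = (SOME g. g \<in> L2 \<and> weak_deriv f g)"

lemma h1_deriv:
  assumes "f \<in> H1"
  shows "h1_deriv f \<in> L2" "weak_deriv f (h1_deriv f)"
proof -
  have "\<exists>g. g \<in> L2 \<and> weak_deriv f g" using assms by (auto simp: H1_def)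
  from someI_ex[OF this] show "h1_deriv f \<in> L2" "weak_deriv f (h1_deriv f)"
    unfolding h1_deriv_def by auto
qed

lemma H1_norm_eq: "H1_norm f = sqrt ((l2norm f)\<^sup>2 + (l2norm (h1_deriv f))\<^sup>2)"
  by (simp add: H1_norm_def h1_deriv_def l2norm_square)

lemma h1_pair_weak_deriv:
  assumes "f \<in> L2" "g \<in> L2" "weak_deriv f g" "continuous_on UNIV f"
  shows "h1_pair f g"
  using assms weak_deriv_integral[OF assms(4,3) L2_set_integrable[OF assms(2)]] by (simp add: h1_pair_def)

lemma h1_pair_unique:
  assumes "h1_pair f g" "h1_pair f g'"
  shows "AE x in lborel. g x - g' x = 0"
proof (rule L2_eq_0_AE)
  have g: "g \<in> L2" "g' \<in> L2" using assms by (simp_all add: h1_pair_L2)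
  then show "(\<lambda>x. g x - g' x) \<in> L2" by (rule L2_diff)
  show "(LINT x:{a..b}|lborel. g x - g' x) = 0" if "a \<le> b" for a b
    using that assms g by (simp add: L2_set_integrable) (metis h1_pair_def right_minus_eq)
qed

lemma weak_deriv_diff:
  assumes "f \<in> L2" "g \<in> L2" "weak_deriv f g" "f' \<in> L2" "g' \<in> L2" "weak_deriv f' g'"
  shows "weak_deriv (\<lambda>x. f x - f' x) (\<lambda>x. g x - g' x)"
  unfolding weak_deriv_def
proof (intro allI impI)
  fix \<eta> :: "real \<Rightarrow> complex" assume t: "test_fun \<eta>"
  note L = test_fun_L2[OF t] test_fun_L2[OF test_fun_dir_deriv[OF t, of 1]]
  have "(LINT x|lborel. f x * dir_deriv 1 \<eta> x) = - (LINT x|lborel. g x * \<eta> x)"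
    "(LINT x|lborel. f' x * dir_deriv 1 \<eta> x) = - (LINT x|lborel. g' x * \<eta> x)"
    using assms t by (auto simp: weak_deriv_def)
  then show "(LINT x|lborel. (f x - f' x) * dir_deriv 1 \<eta> x) = - (LINT x|lborel. (g x - g' x) * \<eta> x)"
    using assms L by (simp add: left_diff_distrib L2_integrable_mult)
qed

text \<open>The norm is built on a derivative picked by \<open>SOME\<close>; derivatives of the same
  function agree almost everywhere, so any known one computes it.\<close>

lemma H1_norm_h1_pair:
  assumes "f \<in> L2" "g \<in> L2" "weak_deriv f g" "continuous_on UNIV f"
  shows "H1_norm f = sqrt ((l2norm f)\<^sup>2 + (l2norm g)\<^sup>2)"
proof -
  have H: "f \<in> H1" using assms by (auto simp: H1_def)
  have "h1_pair f (h1_deriv f)" by (intro h1_pair_weak_deriv h1_deriv H assms)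
  from h1_pair_unique[OF this h1_pair_weak_deriv[OF assms]]
  have "AE x in lborel. (norm (h1_deriv f x))\<^sup>2 = (norm (g x))\<^sup>2" by eventually_elim simp
  then have "l2norm (h1_deriv f) = l2norm g"
    unfolding l2norm_def using h1_deriv(1)[OF H] assms(2)
    by (intro arg_cong[where f = sqrt] integral_cong_AE) (auto dest: L2_integrable_norm)
  then show ?thesis by (simp add: H1_norm_eq)
qed

lemma C_H1_l2norm:
  assumes "C_H1 \<psi>"
  defines "p \<equiv> \<lambda>t x. \<psi> x t"
  shows "h1_pair (p t) (h1_deriv (p t))" "weak_deriv (p t) (h1_deriv (p t))"
    and "((\<lambda>s. l2norm (\<lambda>x. p s x - p t x)) \<longlongrightarrow> 0) (at t)"
    and "((\<lambda>s. l2norm (\<lambda>x. h1_deriv (p s) x - h1_deriv (p t) x)) \<longlongrightarrow> 0) (at t)"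
proof -
  have H: "p t \<in> H1" and c: "continuous_on UNIV (p t)" for t
    using assms by (auto simp: C_H1_def p_def)
  have L: "p t \<in> L2" for t using H by (auto simp: H1_def)
  note D = h1_deriv[OF H]
  show "h1_pair (p t) (h1_deriv (p t))" "weak_deriv (p t) (h1_deriv (p t))"
    by (intro h1_pair_weak_deriv L D c)+
  \<comment> \<open>The norm of the difference involves a derivative picked for the difference
    itself. It is replaced here by the difference of the derivatives picked at times s and
    t.\<close>
  have N: "H1_norm (\<lambda>x. p s x - p t x) =
      sqrt ((l2norm (\<lambda>x. p s x - p t x))\<^sup>2 + (l2norm (\<lambda>x. h1_deriv (p s) x - h1_deriv (p t) x))\<^sup>2)" for s
    by (intro H1_norm_h1_pair L2_diff L D weak_deriv_diff continuous_on_diff c)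
  have lim: "((\<lambda>s. H1_norm (\<lambda>x. p s x - p t x)) \<longlongrightarrow> 0) (at t)"
    using assms by (simp add: C_H1_def p_def)
  show "((\<lambda>s. l2norm (\<lambda>x. p s x - p t x)) \<longlongrightarrow> 0) (at t)"
    by (rule tendsto_sandwich[OF _ _ tendsto_const lim])
      (auto simp: N intro!: always_eventually real_le_rsqrt)
  show "((\<lambda>s. l2norm (\<lambda>x. h1_deriv (p s) x - h1_deriv (p t) x)) \<longlongrightarrow> 0) (at t)"
    by (rule tendsto_sandwich[OF _ _ tendsto_const lim])
      (auto simp: N intro!: always_eventually real_le_rsqrt)
qed

subsection \<open>Curves in H1 and the weak form of the equation\<close>

text \<open>The spatial derivative is a curve of its own, so that shifts, differences, conjugates
  and images under \<open>comm_op\<close> can name theirs explicitly.\<close>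

definition h1_curve :: "(real \<Rightarrow> real \<Rightarrow> complex) \<Rightarrow> (real \<Rightarrow> real \<Rightarrow> complex) \<Rightarrow> bool"
  where "h1_curve p G \<longleftrightarrow> (\<forall>t. h1_pair (p t) (G t)) \<and>
    (\<forall>t. ((\<lambda>s. l2norm (\<lambda>x. p s x - p t x)) \<longlongrightarrow> 0) (at t)) \<and>
    (\<forall>t. ((\<lambda>s. l2norm (\<lambda>x. G s x - G t x)) \<longlongrightarrow> 0) (at t))"

lemma h1_curveD:
  assumes "h1_curve p G"
  shows "h1_pair (p t) (G t)" "p t \<in> L2" "G t \<in> L2"
    "((\<lambda>s. l2norm (\<lambda>x. p s x - p t x)) \<longlongrightarrow> 0) (at t)"
    "((\<lambda>s. l2norm (\<lambda>x. G s x - G t x)) \<longlongrightarrow> 0) (at t)"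
  using assms h1_pair_L2 unfolding h1_curve_def by blast+

lemma continuous_on_l2curve:
  fixes v :: "real \<Rightarrow> real \<Rightarrow> complex"
  assumes L: "\<And>t. v t \<in> L2" and c: "\<And>t. ((\<lambda>s. l2norm (\<lambda>x. v s x - v t x)) \<longlongrightarrow> 0) (at t)"
  shows "\<zeta> \<in> L2 \<Longrightarrow> continuous_on S (\<lambda>t. pairing (v t) \<zeta>)"
    and "continuous_on S (\<lambda>t. l2norm (v t))"
proof -
  have "((\<lambda>s. pairing (v s) \<zeta>) \<longlongrightarrow> pairing (v t) \<zeta>) (at t)" if "\<zeta> \<in> L2" for t
  proof (rule Lim_null[THEN iffD2], rule Lim_null_comparison)
    show "\<forall>\<^sub>F s in at t. norm (pairing (v s) \<zeta> - pairing (v t) \<zeta>) \<le> l2norm (\<lambda>x. v s x - v t x) * l2norm \<zeta>"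
      using pairing_bound[OF L2_diff[OF L L] that] that L by (simp add: pairing_diff_left)
    show "((\<lambda>s. l2norm (\<lambda>x. v s x - v t x) * l2norm \<zeta>) \<longlongrightarrow> 0) (at t)"
      using tendsto_mult_right[OF c] by fastforce
  qed
  note pairing_lim = this
  show "continuous_on S (\<lambda>t. pairing (v t) \<zeta>)" if "\<zeta> \<in> L2"
    by (intro continuous_at_imp_continuous_on ballI) (simp add: isCont_def that pairing_lim)
  have "((\<lambda>s. l2norm (v s)) \<longlongrightarrow> l2norm (v t)) (at t)" for t
  proof (rule Lim_null[THEN iffD2], rule Lim_null_comparison[OF _ c])
    show "\<forall>\<^sub>F s in at t. norm (l2norm (v s) - l2norm (v t)) \<le> l2norm (\<lambda>x. v s x - v t x)"
      using l2norm_diff_abs[OF L L] by simp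
  qed
  note l2norm_lim = this
  show "continuous_on S (\<lambda>t. l2norm (v t))"
    by (intro continuous_at_imp_continuous_on ballI) (simp add: isCont_def l2norm_lim)
qed

lemma h1_curve_sup:
  assumes "h1_curve p G"
  shows "norm (p s x - p t x) \<le> sqrt (2 * l2norm (\<lambda>x. p s x - p t x) * l2norm (\<lambda>x. G s x - G t x))"
  using h1_pair_sobolev[OF h1_pair_diff[OF h1_curveD(1)[OF assms] h1_curveD(1)[OF assms]]]
  by (intro real_le_rsqrt)

lemma h1_curve_sup_tendsto:
  assumes "h1_curve p G"
  shows "((\<lambda>s. sqrt (2 * l2norm (\<lambda>x. p s x - p t x) * l2norm (\<lambda>x. G s x - G t x))) \<longlongrightarrow> 0) (at t)"
  using tendsto_real_sqrt[OF tendsto_mult[OF tendsto_mult[OF tendsto_const[of 2] h1_curveD(4)[OF assms]]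
      h1_curveD(5)[OF assms]]]
  by fastforce

lemma h1_curve_continuous_at_point:
  assumes "h1_curve p G"
  shows "continuous_on S (\<lambda>t. p t x)"
proof -
  have "((\<lambda>s. p s x) \<longlongrightarrow> p t x) (at t)" for t
    by (rule Lim_null[THEN iffD2], rule Lim_null_comparison[OF _ h1_curve_sup_tendsto[OF assms]])
      (simp add: h1_curve_sup[OF assms])
  note lim = this
  show ?thesis by (intro continuous_at_imp_continuous_on ballI) (simp add: isCont_def lim)
qed

text \<open>Convergence in time is uniform in x by the Sobolev bound, and each time slice is Hoelder
  continuous in x. Joint continuity makes products with test functions integrable on the plane,
  which Fubini requires.\<close>

lemma h1_curve_jointly_continuous:
  assumes c: "h1_curve p G"
  shows "continuous_on S (\<lambda>z. p (snd z) (fst z))"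
proof (rule continuous_at_imp_continuous_on, rule ballI)
  fix z0 :: "real \<times> real"
  obtain x0 t0 where z0: "z0 = (x0, t0)" by (cases z0)
  define m where "m s = sqrt (2 * l2norm (\<lambda>x. p s x - p t0 x) * l2norm (\<lambda>x. G s x - G t0 x))" for s
  have "l2norm (\<lambda>x. 0) = 0" by (simp add: l2norm_def)
  then have m0: "m t0 = 0" by (simp add: m_def)
  \<comment> \<open>Points near z0 may have second coordinate exactly t0, so the limit along
    \<open>at t0\<close> has to be completed by the value of m there.\<close>
  have "isCont m t0" using h1_curve_sup_tendsto[OF c, of t0] m0 by (simp add: isCont_def m_def[abs_def])
  then have m: "((\<lambda>z. m (snd z)) \<longlongrightarrow> 0) (at z0)"
    using isCont_o2[of z0 snd m] m0 z0 isCont_snd[OF continuous_ident, of z0] by (simp add: isCont_def)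
  have f: "((\<lambda>z. fst z) \<longlongrightarrow> x0) (at z0)" using tendsto_fst[OF tendsto_ident_at, of z0] z0 by simp
  have "((\<lambda>z. m (snd z) + sqrt \<bar>fst z - x0\<bar> * l2norm (G t0)) \<longlongrightarrow> 0 + sqrt \<bar>x0 - x0\<bar> * l2norm (G t0)) (at z0)"
    by (intro tendsto_intros m f)
  then have lim: "((\<lambda>z. m (snd z) + sqrt \<bar>fst z - x0\<bar> * l2norm (G t0)) \<longlongrightarrow> 0) (at z0)" by simp
  have bd: "norm (p (snd z) (fst z) - p t0 x0) \<le> m (snd z) + sqrt \<bar>fst z - x0\<bar> * l2norm (G t0)" for z
  proof -
    have "norm (p (snd z) (fst z) - p t0 x0)
        \<le> norm (p (snd z) (fst z) - p t0 (fst z)) + norm (p t0 (fst z) - p t0 x0)"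
      using norm_triangle_ineq[of "p (snd z) (fst z) - p t0 (fst z)" "p t0 (fst z) - p t0 x0"] by simp
    then show ?thesis
      using h1_curve_sup[OF c, of "snd z" "fst z" t0] h1_pair_hoelder[OF h1_curveD(1)[OF c], of t0 "fst z" x0]
      unfolding m_def by linarith
  qed
  have "((\<lambda>z. p (snd z) (fst z)) \<longlongrightarrow> p t0 x0) (at z0)"
    by (rule Lim_null[THEN iffD2], rule Lim_null_comparison[OF _ lim]) (simp add: bd)
  then show "isCont (\<lambda>z. p (snd z) (fst z)) z0" by (simp add: isCont_def z0)
qed

section \<open>From distributions on the plane to an identity integrated in time\<close>

lemma C_H1_h1_curve:
  "C_H1 \<psi> \<Longrightarrow> h1_curve (\<lambda>t x. \<psi> x t) (\<lambda>t. h1_deriv (\<lambda>x. \<psi> x t))"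
  unfolding h1_curve_def using C_H1_l2norm by blast

text \<open>With test functions \<xi>(x) \<theta>(t) the equation says that the pairing of the
  solution with \<xi> has a continuous weak derivative in t, so it can be integrated over [s,t]. One
  of the two derivatives on \<xi> is then moved back to the solution, which leaves an expression
  that makes sense for \<xi> in H1.\<close>

lemma schroedinger_test:
  assumes C: "C_H1 \<psi>" and eq: "schroedinger_delta F \<psi>" and F: "continuous_on UNIV F"
    and \<xi>: "test_fun \<xi>" and st: "s \<le> t"
  shows "\<i> * pairing (\<lambda>x. \<psi> x t - \<psi> x s) \<xi> =
    integral {s..t} (\<lambda>r. pairing (h1_deriv (\<lambda>x. \<psi> x r)) (dir_deriv 1 \<xi>) - F (\<psi> 0 r) * \<xi> 0)"
proof -
  define p where "p t x = \<psi> x t" for t x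
  note curve = C_H1_h1_curve[OF C, folded p_def]
  note L = h1_curveD(2)[OF curve]
  note DL = h1_curveD(3)[OF curve]
  define \<xi>1 where "\<xi>1 = dir_deriv 1 \<xi>"
  define \<xi>2 where "\<xi>2 = dir_deriv 1 \<xi>1"
  have t1: "test_fun \<xi>1" and t2: "test_fun \<xi>2"
    by (simp_all add: \<xi>1_def \<xi>2_def test_fun_dir_deriv \<xi>)
  note \<xi>L = test_fun_L2[OF \<xi>] test_fun_L2[OF t1] test_fun_L2[OF t2]
  define A where "A t = pairing (p t) \<xi>" for t
  define B where "B t = pairing (p t) \<xi>2" for t
  define f where "f t = F (p t 0)" for t
  \<comment> \<open>The candidate for the derivative of A: the equation reads \<i> A' = - (B +
    \<xi>(0) f), solved here for A'.\<close>
  define g where "g t = \<i> * (B t + \<xi> 0 * f t)" for t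
  have cA: "continuous_on S A" and cB: "continuous_on S B" for S
    using continuous_on_l2curve(1)[OF L h1_curveD(4)[OF curve]] \<xi>L
      by (auto simp: A_def[abs_def] B_def[abs_def])
  have cf: "continuous_on S f" for S
    unfolding f_def using continuous_on_compose2[OF F h1_curve_continuous_at_point[OF curve]] by auto
  have cg: "continuous_on S g" for S
    unfolding g_def by (intro continuous_intros cB cf)
  have prod_int: "(LINT z|lborel. p (snd z) (fst z) * (\<alpha> (fst z) * \<beta> (snd z)))
      = (LINT t|lborel. pairing (p t) \<alpha> * \<beta> t)"
    if \<alpha>: "test_fun \<alpha>" and \<beta>: "test_fun \<beta>" for \<alpha> \<beta>
  proof -
    let ?h = "\<lambda>z. p (snd z) (fst z) * (\<alpha> (fst z) * \<beta> (snd z))"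
    obtain R where R: "\<And>x. \<bar>x\<bar> \<ge> R \<Longrightarrow> \<alpha> x = 0" using test_fun_eq_0[OF \<alpha>] by metis
    obtain T where T: "\<And>x. \<bar>x\<bar> \<ge> T \<Longrightarrow> \<beta> x = 0" using test_fun_eq_0[OF \<beta>] by metis
    have "integrable lborel ?h"
    proof (rule integrable_continuous_support)
      show "continuous_on UNIV ?h"
        by (intro continuous_intros h1_curve_jointly_continuous[OF curve]
            continuous_on_compose2[OF continuous_test_fun[OF \<alpha>, of UNIV]]
                continuous_on_compose2[OF continuous_test_fun[OF \<beta>, of UNIV]]) auto
      show "compact ({-R..R} \<times> {-T..T})" by (intro compact_Times compact_Icc)
      show "?h z = 0" if "z \<notin> {-R..R} \<times> {-T..T}" for z
      proof -
        have "\<bar>fst z\<bar> \<ge> R \<or> \<bar>snd z\<bar> \<ge> T" using that by (cases z) auto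
        then show ?thesis using R T by auto
      qed
    qed
    then have i: "integrable (lborel \<Otimes>\<^sub>M lborel) (\<lambda>(x, t). p t x * (\<alpha> x * \<beta> t))"
      by (simp add: lborel_prod split_beta')
    have "(LINT z|lborel. ?h z) = integral\<^sup>L (lborel \<Otimes>\<^sub>M lborel) (\<lambda>(x, t). p t x * (\<alpha> x * \<beta> t))"
      by (simp add: lborel_prod split_beta')
    also have "\<dots> = (LINT t|lborel. LINT x|lborel. p t x * (\<alpha> x * \<beta> t))"
      by (rule lborel_pair.integral_snd[OF i, symmetric])
    also have "\<dots> = (LINT t|lborel. pairing (p t) \<alpha> * \<beta> t)"
      by (simp add: pairing_def flip: mult.assoc)
    finally show ?thesis .
  qed
  have "weak_deriv A g"
    unfolding weak_deriv_def
  proof (intro allI impI)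
    fix \<theta> :: "real \<Rightarrow> complex" assume \<theta>: "test_fun \<theta>"
    define \<theta>1 where "\<theta>1 = dir_deriv 1 \<theta>"
    have \<theta>t: "test_fun \<theta>1" by (simp add: \<theta>1_def test_fun_dir_deriv \<theta>)
    let ?\<eta> = "\<lambda>z. \<xi> (fst z) * \<theta> (snd z)"
    have e1: "dir_deriv (0, 1) ?\<eta> = (\<lambda>z. \<xi> (fst z) * \<theta>1 (snd z))"
      using test_fun_prod_dir_deriv[OF \<xi> \<theta>, of 0 1] by (simp add: \<theta>1_def)
    have "dir_deriv (1, 0) ?\<eta> = (\<lambda>z. \<xi>1 (fst z) * \<theta> (snd z))"
      using test_fun_prod_dir_deriv[OF \<xi> \<theta>, of 1 0] by (simp add: \<xi>1_def)
    then have e2: "dir_deriv (1, 0) (dir_deriv (1, 0) ?\<eta>) = (\<lambda>z. \<xi>2 (fst z) * \<theta> (snd z))"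
      using test_fun_prod_dir_deriv[OF t1 \<theta>, of 1 0] by (simp add: \<xi>2_def)
    have "- (LINT z|lborel. \<i> * p (snd z) (fst z) * (\<xi> (fst z) * \<theta>1 (snd z)))
        = - (LINT z|lborel. p (snd z) (fst z) * (\<xi>2 (fst z) * \<theta> (snd z))) -
            (LINT t|lborel. f t * (\<xi> 0 * \<theta> t))"
      using eq[unfolded schroedinger_delta_def, rule_format, OF test_fun_prod[OF \<xi> \<theta>]]
      unfolding e1 e2 by (simp add: p_def f_def)
    then have "\<i> * (LINT t|lborel. A t * \<theta>1 t)
        = (LINT t|lborel. B t * \<theta> t) + (LINT t|lborel. f t * (\<xi> 0 * \<theta> t))"
      using prod_int[OF \<xi> \<theta>t] prod_int[OF t2 \<theta>] by (simp add: A_def B_def mult.assoc algebra_simps)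
    also have "\<dots> = (LINT t|lborel. B t * \<theta> t + f t * (\<xi> 0 * \<theta> t))"
    proof -
      obtain T where T: "\<And>x. \<bar>x\<bar> \<ge> T \<Longrightarrow> \<theta> x = 0" using test_fun_eq_0[OF \<theta>] by metis
      have "integrable lborel (\<lambda>t. B t * \<theta> t)" "integrable lborel (\<lambda>t. f t * (\<xi> 0 * \<theta> t))"
        by (rule integrable_continuous_support[of _ "{-T..T}"];
            use T in \<open>auto intro!: continuous_intros cB cf continuous_test_fun[OF \<theta>] simp: abs_le_iff\<close>)+
      then show ?thesis by simp
    qed
    also have "\<dots> = (LINT t|lborel. (- \<i>) * (g t * \<theta> t))"
      by (rule Bochner_Integration.integral_cong) (auto simp: g_def algebra_simps)
    also have "\<dots> = (- \<i>) * (LINT t|lborel. g t * \<theta> t)" by simp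
    finally have "\<i> * (LINT t|lborel. A t * \<theta>1 t) = \<i> * (- (LINT t|lborel. g t * \<theta> t))" by simp
    then show "(LINT t|lborel. A t * dir_deriv 1 \<theta> t) = - (LINT t|lborel. g t * \<theta> t)"
      unfolding mult_cancel_left by (simp add: \<theta>1_def)
  qed
  then have "A t - A s = (LINT r:{s..t}|lborel. g r)"
    by (rule weak_deriv_integral[OF cA _ borel_integrable_atLeastAtMost'[OF cg] st])
  also have "\<dots> = integral {s..t} g"
    by (rule set_borel_integral_eq_integral(2)[OF borel_integrable_atLeastAtMost'[OF cg]])
  finally have "\<i> * (A t - A s) = integral {s..t} (\<lambda>r. \<i> * g r)" by simp
  moreover have "\<i> * g r = pairing (h1_deriv (p r)) \<xi>1 - F (p r 0) * \<xi> 0" for r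
  proof -
    have "weak_deriv (p r) (h1_deriv (p r))" using C_H1_l2norm(2)[OF C, folded p_def] .
    then have "B r = - pairing (h1_deriv (p r)) \<xi>1"
      using t1 by (simp add: weak_deriv_def B_def pairing_def \<xi>2_def)
    then show ?thesis by (simp add: g_def f_def algebra_simps)
  qed
  moreover have "p r = (\<lambda>x. \<psi> x r)" for r by (simp add: p_def fun_eq_iff)
  moreover have "A t - A s = pairing (\<lambda>x. p t x - p s x) \<xi>"
    using L \<xi>L by (simp add: A_def pairing_diff_left)
  ultimately show ?thesis by (simp add: \<xi>1_def)
qed

lemma has_vector_derivative_of_set_integral:
  fixes f g :: "real \<Rightarrow> complex"
  assumes "\<And>a b. a \<le> b \<Longrightarrow> f b - f a = (LINT x:{a..b}|lborel. g x)" and g: "continuous_on UNIV g"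
  shows "(f has_vector_derivative g x) (at x)"
proof -
  have c: "continuous_on S g" for S using g continuous_on_subset by blast
  have "((\<lambda>y. integral {x - 1..y} g) has_vector_derivative g x) (at x within {x - 1..x + 1})"
    by (rule integral_has_vector_derivative[OF c]) simp
  then have "((\<lambda>y. f (x - 1) + integral {x - 1..y} g) has_vector_derivative g x) (at x within {x - 1..x + 1})"
    by (auto intro!: derivative_eq_intros)
  then have "((\<lambda>y. f (x - 1) + integral {x - 1..y} g) has_vector_derivative g x) (at x)"
    using at_within_Icc_at[of "x - 1" x "x + 1"] by simp
  then show ?thesis
  proof (rule has_vector_derivative_transform_within_open[where S = "{x - 1<..}"])
    fix y assume "y \<in> {x - 1<..}"
    then have "f y - f (x - 1) = (LINT x:{x - 1..y}|lborel. g x)" by (intro assms) auto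
    also have "\<dots> = integral {x - 1..y} g"
      by (rule set_borel_integral_eq_integral(2)[OF borel_integrable_atLeastAtMost'[OF c]])
    finally show "f (x - 1) + integral {x - 1..y} g = f y" by (simp add: algebra_simps)
  qed auto
qed

section \<open>Extension of the tested equation to H1\<close>

lemma bump_bounded: obtains B where "B \<ge> 0" "\<And>x. \<bar>bump x\<bar> \<le> B"
proof -
  obtain B where B: "\<forall>x\<in>{-1..1}. norm (bump x) \<le> B"
    using compact_imp_bounded[OF compact_continuous_image[OF continuous_bump compact_Icc[of "-1" 1]]]
      by (auto simp: bounded_iff)
  have "\<bar>bump x\<bar> \<le> \<bar>B\<bar>" for x
  proof (cases "\<bar>x\<bar> \<le> 1")
    case True then show ?thesis using B[rule_format, of x] by (auto simp: abs_le_iff)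
  next
    case False then show ?thesis using bump_eq_0[of x] by simp
  qed
  then show ?thesis using that[of "\<bar>B\<bar>"] by auto
qed

text \<open>A primitive of a function supported in \<open>[-S,S]\<close>, brought back to zero to the right of \<open>S\<close>
  by a fixed smooth correction.\<close>

definition cut_primitive :: "real \<Rightarrow> (real \<Rightarrow> complex) \<Rightarrow> real \<Rightarrow> complex"
  where "cut_primitive S k x = (LINT y:{-S..x}|lborel. k y)
      - (LINT y:{-S..S}|lborel. k y) * of_real (smooth_step (x - S - 1))"

definition cut_density :: "real \<Rightarrow> (real \<Rightarrow> complex) \<Rightarrow> real \<Rightarrow> complex"
  where "cut_density S k x = k x - (LINT y:{-S..S}|lborel. k y) * of_real (bump (x - S - 1))"

lemma cut_primitive_eq_0:
  assumes k: "k \<in> L2_supp S" and S: "S > 0" and x: "x \<notin> {-S..S + 2}"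
  shows "cut_primitive S k x = 0"
proof -
  consider "x < -S" | "x > S + 2" using x by fastforce
  then show ?thesis
  proof cases
    case 1
    then show ?thesis using S by (simp add: cut_primitive_def set_lebesgue_integral_def smooth_step_eq_0)
  next
    case 2
    have "(LINT y:{-S..x}|lborel. k y) = (LINT y:{-S..S}|lborel. k y)"
      unfolding set_lebesgue_integral_def
      by (rule Bochner_Integration.integral_cong) (use k 2 S in \<open>auto simp: L2_supp_def indicator_def\<close>)
    then show ?thesis using 2 by (simp add: cut_primitive_def smooth_step_eq_1)
  qed
qed

lemma h1_pair_cut:
  assumes k: "k \<in> L2_supp S" and S: "S > 0"
  shows "h1_pair (cut_primitive S k) (cut_density S k)"
proof -
  have kL: "k \<in> L2" using k by (simp add: L2_supp_def)
  note ki = L2_set_integrable[OF kL]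
  let ?c = "LINT y:{-S..S}|lborel. k y"
  have bc: "continuous_on U (\<lambda>x. complex_of_real (bump (x - S - 1)))" for U
    by (intro continuous_intros continuous_on_compose2[OF continuous_bump[of UNIV]]) auto
  have "(\<lambda>x. complex_of_real (bump (x - S - 1))) \<in> L2"
    by (rule L2_continuous_support[OF bc, of "{S..S + 2}"]) (auto intro!: bump_eq_0)
  then have dL: "cut_density S k \<in> L2"
    unfolding cut_density_def[abs_def] by (intro L2_diff kL L2_cmult)
  have diff: "cut_primitive S k b - cut_primitive S k a = (LINT x:{a..b}|lborel. cut_density S k x)"
      if ab: "a \<le> b" for a b
  proof -
    have *: "(LINT y:{-S..b}|lborel. k y) - (LINT y:{-S..a}|lborel. k y) = (LINT y:{a..b}|lborel. k y)"
    proof -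
      \<comment> \<open>A common lower limit below both a and -S makes additivity of the integral
        applicable wherever a lies; the density vanishes on the added stretch.\<close>
      define m where "m = min a (-S) - 1"
      have ext: "(LINT y:{-S..z}|lborel. k y) = (LINT y:{m..z}|lborel. k y)" for z
        unfolding set_lebesgue_integral_def
        by (rule Bochner_Integration.integral_cong) (use k in \<open>auto simp: L2_supp_def indicator_def m_def\<close>)
      show ?thesis unfolding ext using set_integral_combine[OF ki[of m b], of a] ab by (simp add: m_def)
    qed
    have "((\<lambda>x. smooth_step (x - S - 1)) has_real_derivative bump (x - S - 1)) (at x)" for x
      by (rule DERIV_chain2[OF smooth_step_deriv, THEN DERIV_cong]) (auto intro!: derivative_eq_intros)
    then have "ac_on a b (\<lambda>x. complex_of_real (smooth_step (x - S - 1))) (\<lambda>x. of_real (bump (x - S - 1)))"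
      by (intro ac_on_C1 has_vector_derivative_of_real bc) (auto intro: has_field_derivative_at_within)
    from ac_on_diff[OF this order_refl ab order_refl] ac_on_integrable[OF this]
    show ?thesis using * ki ab
      by (simp add: cut_primitive_def cut_density_def algebra_simps)
  qed
  have "continuous_on UNIV (cut_primitive S k)"
  proof (rule continuous_at_imp_continuous_on, rule ballI)
    fix x :: real
    have "ac_on (x - 1) (x + 1) (cut_primitive S k) (cut_density S k)"
      using diff dL by (intro ac_onI L2_set_integrable) (auto simp: diff_eq_eq add.commute)
    from ac_on_continuous[OF this] show "isCont (cut_primitive S k) x"
      by (rule continuous_on_interior) simp
  qed
  then have "cut_primitive S k \<in> L2"
    using cut_primitive_eq_0[OF k S] by (rule L2_continuous_support[OF _ _ compact_Icc])
  then show ?thesis using dL diff by (simp add: h1_pair_def)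
qed

text \<open>The window has finite length, so the L2 norm of the density alone controls the
  primitive, the corrected density and the value at 0, the three quantities in which the tested
  equation is bounded.\<close>

lemma cut_bounds:
  assumes S: "S > 0"
  obtains C where "\<And>k. k \<in> L2_supp S \<Longrightarrow>
    l2norm (cut_primitive S k) \<le> C * l2norm k \<and> l2norm (cut_density S k) \<le> C * l2norm k \<and> norm
        (cut_primitive S k 0) \<le> C * l2norm k"
proof -
  define q where "q = sqrt (2 * S)"
  define b where "b = l2norm (\<lambda>x. complex_of_real (bump (x - S - 1)))"
  \<comment> \<open>The entries belong to the pointwise bound, to the norm of the primitive on its
    support of length 2 S + 2, and to the corrected density.\<close>
  define C where "C = max (2 * q) (max (2 * q * sqrt (2 * S + 2)) (1 + q * b))"
  have q: "q \<ge> 0" using S by (simp add: q_def)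
  have "l2norm (cut_primitive S k) \<le> C * l2norm k \<and> l2norm (cut_density S k) \<le> C * l2norm k \<and>
      norm (cut_primitive S k 0) \<le> C * l2norm k"
    if k: "k \<in> L2_supp S" for k
  proof -
    have kL: "k \<in> L2" using k by (simp add: L2_supp_def)
    have c: "norm (LINT y:{-S..S}|lborel. k y) \<le> q * l2norm k"
      using L2_set_integral_bound[OF kL, of "-S" S] S by (simp add: q_def)
    have 1: "norm (LINT y:{-S..x}|lborel. k y) \<le> q * l2norm k" for x
    proof -
      have "(LINT y:{-S..x}|lborel. k y) = (LINT y:{-S..min x S}|lborel. k y)"
        unfolding set_lebesgue_integral_def
        by (rule Bochner_Integration.integral_cong) (use k in \<open>auto simp: L2_supp_def indicator_def\<close>)
      also have "norm \<dots> \<le> q * l2norm k"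
      proof (cases "-S \<le> min x S")
        case True
        have "sqrt (min x S - (-S)) * l2norm k \<le> q * l2norm k"
          unfolding q_def by (intro mult_right_mono real_sqrt_le_mono) auto
        with L2_set_integral_bound[OF kL True] show ?thesis by linarith
      next
        case False
        then show ?thesis using q by (simp add: set_lebesgue_integral_def)
      qed
      finally show ?thesis .
    qed
    have pt: "norm (cut_primitive S k x) \<le> 2 * q * l2norm k" for x
    proof -
      have "norm ((LINT y:{-S..S}|lborel. k y) * complex_of_real (smooth_step (x - S - 1)))
          \<le> q * l2norm k * 1"
        unfolding norm_mult norm_of_real using smooth_step_bounds[of "x - S - 1"] q
        by (intro mult_mono c) auto
      then show ?thesis
        unfolding cut_primitive_def
        using 1[of x] norm_triangle_ineq4[of "LINT y:{-S..x}|lborel. k y"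
            "(LINT y:{-S..S}|lborel. k y) * complex_of_real (smooth_step (x - S - 1))"]
        by linarith
    qed
    note pair = h1_pair_cut[OF k S]
    let ?I = "indicator {-S..S + 2} :: real \<Rightarrow> complex"
    have IL: "?I \<in> L2" by (rule L2_indicator) auto
    have "norm (cut_primitive S k x) \<le> (2 * q * l2norm k) * norm (?I x)" for x
      using pt[of x] cut_primitive_eq_0[OF k S, of x] by (cases "x \<in> {-S..S+2}") auto
    from L2_dominated(2)[OF L2_measurable[OF h1_pair_L2(1)[OF pair]] IL this]
    have "l2norm (cut_primitive S k) \<le> \<bar>2 * q * l2norm k\<bar> * sqrt (2 * S + 2)"
      using S by (simp add: l2norm_indicator)
    then have a: "l2norm (cut_primitive S k) \<le> (2 * q * sqrt (2 * S + 2)) * l2norm k" using q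
      by (simp add: abs_mult mult_ac)
    have bL: "(\<lambda>x. complex_of_real (bump (x - S - 1))) \<in> L2"
      by (rule L2_continuous_support[of _ "{S..S + 2}"])
        (auto intro!: bump_eq_0 continuous_intros continuous_on_compose2[OF continuous_bump[of UNIV]])
    have "l2norm (cut_density S k) \<le> l2norm k + norm (LINT y:{-S..S}|lborel. k y) * b"
      using l2norm_triangle_diff[OF kL L2_cmult[OF bL, of "LINT y:{-S..S}|lborel. k y"]]
      by (simp add: cut_density_def[abs_def] l2norm_cmult b_def)
    also have "\<dots> \<le> l2norm k + (q * l2norm k) * b" by (intro add_left_mono mult_right_mono c) (simp add: b_def)
    finally have d: "l2norm (cut_density S k) \<le> (1 + q * b) * l2norm k" by (simp add: algebra_simps)
    have "x * l2norm k \<le> C * l2norm k" if "x \<le> C" for x using that by (intro mult_right_mono) auto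
    then have "2 * q * l2norm k \<le> C * l2norm k" "2 * q * sqrt (2 * S + 2) * l2norm k \<le> C * l2norm k"
      "(1 + q * b) * l2norm k \<le> C * l2norm k" by (auto simp: C_def)
    then show ?thesis using a d pt[of 0] by linarith
  qed
  then show ?thesis using that by blast
qed

lemma test_fun_cut_primitive:
  assumes k: "k \<in> L2_supp S" and S: "S > 0" and t: "test_fun k"
  shows "test_fun (cut_primitive S k)" "dir_deriv 1 (cut_primitive S k) = cut_density S k"
proof -
  have "Ck n (\<lambda>x. complex_of_real (bump (x + (- S - 1))))" for n
    by (intro Ck_bounded_linear[OF bounded_linear_of_real] Ck_compose_affine[OF bounded_linear_ident] Ck_bump)
  moreover have "(\<lambda>x. complex_of_real (bump (x - S - 1))) = (\<lambda>x. complex_of_real (bump (x + (- S - 1))))"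
    by (rule ext, rule arg_cong[where f = "\<lambda>y. complex_of_real (bump y)"]) simp
  ultimately have bn: "Ck n (\<lambda>x. complex_of_real (bump (x - S - 1)))" for n by simp
  have "Ck n (\<lambda>x. k x + (- (LINT y:{-S..S}|lborel. k y)) * complex_of_real (bump (x - S - 1)))" for n
    using t by (intro Ck_add Ck_bounded_linear[OF bounded_linear_mult_right] bn) (simp add: test_fun_def)
  then have ck: "Ck n (cut_density S k)" for n by (simp add: cut_density_def[abs_def])
  have d: "(cut_primitive S k has_vector_derivative cut_density S k x) (at x)" for x
    using h1_pair_cut[OF k S] Ck_imp_continuous_on[OF ck[of 0]]
    by (intro has_vector_derivative_of_set_integral) (auto simp: h1_pair_def)
  show "dir_deriv 1 (cut_primitive S k) = cut_density S k"
    using dir_deriv_vector_derivative[OF d] by auto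
  show "test_fun (cut_primitive S k)"
    by (rule test_funI[OF Ck_Suc_imp[OF Ck_SucI_real[OF d ck]] cut_primitive_eq_0[OF k S] compact_Icc])
qed

text \<open>Instead of approximating \<zeta> in H1, compactly supported \<zeta> are parametrised by
  their density k. The defect of the identity becomes a bounded functional of k in L2 of a window,
  to which the vanishing criterion applies. Cut-offs then reach an arbitrary \<zeta>.\<close>

lemma delta_identity_extend:
  fixes p G :: "real \<Rightarrow> real \<Rightarrow> complex" and f :: "real \<Rightarrow> complex"
  assumes curve: "h1_curve p G" and f: "continuous_on UNIV f" and d: "d \<in> L2" and st: "s \<le> t"
    and test: "\<And>\<xi>. test_fun \<xi> \<Longrightarrow>
      \<i> * pairing d \<xi> = integral {s..t} (\<lambda>r. pairing (G r) (dir_deriv 1 \<xi>) - f r * \<xi> 0)"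
    and pair: "h1_pair \<zeta> k"
  shows "\<i> * pairing d \<zeta> = integral {s..t} (\<lambda>r. pairing (G r) k - f r * \<zeta> 0)"
proof -
  define \<Phi> where "\<Phi> \<zeta> k = \<i> * pairing d \<zeta> - integral {s..t} (\<lambda>r. pairing (G r) k - f r * \<zeta> 0)"
    for \<zeta> k :: "real \<Rightarrow> complex"
  note GL = h1_curveD(3)[OF curve]
  have cG: "continuous_on A (\<lambda>r. pairing (G r) k)" if "k \<in> L2" for k A
    by (rule continuous_on_l2curve(1)[OF GL h1_curveD(5)[OF curve] that])
  have cf: "continuous_on A f" for A using f continuous_on_subset by blast
  have int: "(\<lambda>r. pairing (G r) k - f r * c) integrable_on {s..t}" if "k \<in> L2" for k c
    by (intro integrable_continuous_interval continuous_intros cG cf that)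
  have \<Phi>_add: "\<Phi> (\<lambda>x. \<zeta> x + \<zeta>' x) (\<lambda>x. k x + k' x) = \<Phi> \<zeta> k + \<Phi> \<zeta>' k'"
    if "\<zeta> \<in> L2" "k \<in> L2" "\<zeta>' \<in> L2" "k' \<in> L2" for \<zeta> k \<zeta>' k'
  proof -
    have "integral {s..t} (\<lambda>r. pairing (G r) (\<lambda>x. k x + k' x) - f r * (\<zeta> 0 + \<zeta>' 0)) =
        integral {s..t} (\<lambda>r. (pairing (G r) k - f r * \<zeta> 0) + (pairing (G r) k' - f r * \<zeta>' 0))"
      using that GL by (simp add: pairing_add_right algebra_simps)
    also have "\<dots> = integral {s..t} (\<lambda>r. pairing (G r) k - f r * \<zeta> 0)
        + integral {s..t} (\<lambda>r. pairing (G r) k' - f r * \<zeta>' 0)"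
      by (rule Henstock_Kurzweil_Integration.integral_add) (intro int that)+
    finally show ?thesis using that d by (simp add: \<Phi>_def pairing_add_right algebra_simps)
  qed
  have \<Phi>_cmult: "\<Phi> (\<lambda>x. c * \<zeta> x) (\<lambda>x. c * k x) = c * \<Phi> \<zeta> k" for c \<zeta> k
  proof -
    have "integral {s..t} (\<lambda>r. pairing (G r) (\<lambda>x. c * k x) - f r * (c * \<zeta> 0)) =
        integral {s..t} (\<lambda>r. c * (pairing (G r) k - f r * \<zeta> 0))"
      by (simp add: pairing_cmult_right algebra_simps)
    also have "\<dots> = c * integral {s..t} (\<lambda>r. pairing (G r) k - f r * \<zeta> 0)"
      by (rule Henstock_Kurzweil_Integration.integral_mult_right)
    finally show ?thesis by (simp add: \<Phi>_def pairing_cmult_right right_diff_distrib)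
  qed
  obtain C where C: "C \<ge> 0" "\<And>\<zeta> k. \<zeta> \<in> L2 \<Longrightarrow> k \<in> L2 \<Longrightarrow> norm (\<Phi> \<zeta> k) \<le> C * (l2norm \<zeta> + l2norm k + norm (\<zeta> 0))"
  proof -
    have "continuous_on {s..t} (\<lambda>r. l2norm (G r))"
      by (rule continuous_on_l2curve(2)[OF GL h1_curveD(5)[OF curve]])
    from compact_imp_bounded[OF compact_continuous_image[OF this compact_Icc]]
    obtain M1 where M1: "\<And>r. r \<in> {s..t} \<Longrightarrow> l2norm (G r) \<le> M1" by (fastforce simp: bounded_iff)
    from compact_imp_bounded[OF compact_continuous_image[OF cf compact_Icc]]
    obtain M2 where M2: "\<And>r. r \<in> {s..t} \<Longrightarrow> norm (f r) \<le> M2" by (fastforce simp: bounded_iff)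
    have M: "M1 \<ge> 0" "M2 \<ge> 0" 
      using order_trans[OF l2norm_nonneg M1[of s]] order_trans[OF norm_ge_zero M2[of s]] st by auto
    define C where "C = l2norm d + (M1 + M2) * (t - s)"
    have "norm (\<Phi> \<zeta> k) \<le> C * (l2norm \<zeta> + l2norm k + norm (\<zeta> 0))" if z: "\<zeta> \<in> L2" "k \<in> L2" for \<zeta> k
    proof -
      have "norm (integral {s..t} (\<lambda>r. pairing (G r) k - f r * \<zeta> 0))
          \<le> (M1 * l2norm k + M2 * norm (\<zeta> 0)) * (t - s)"
      proof (rule integral_bound[OF st])
        show "continuous_on {s..t} (\<lambda>r. pairing (G r) k - f r * \<zeta> 0)"
          by (intro continuous_intros cG cf z)
        show "norm (pairing (G r) k - f r * \<zeta> 0) \<le> M1 * l2norm k + M2 * norm (\<zeta> 0)" if "r \<in> {s..t}" for r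
        proof -
          have "norm (pairing (G r) k) \<le> M1 * l2norm k"
            using pairing_bound[OF GL z(2), of r] mult_right_mono[OF M1[OF that] l2norm_nonneg[of k]]
              by linarith
          moreover have "norm (f r * \<zeta> 0) \<le> M2 * norm (\<zeta> 0)"
            unfolding norm_mult by (intro mult_right_mono M2 that) simp
          ultimately show ?thesis using norm_triangle_ineq4[of "pairing (G r) k" "f r * \<zeta> 0"] by linarith
        qed
      qed
      moreover have "norm (\<i> * pairing d \<zeta>) \<le> l2norm d * l2norm \<zeta>"
        using pairing_bound[OF d z(1)] by (simp add: norm_mult)
      ultimately have "norm (\<Phi> \<zeta> k) \<le> l2norm d * l2norm \<zeta> + (M1 * l2norm k + M2 * norm (\<zeta> 0)) * (t - s)"
        unfolding \<Phi>_def 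
        using norm_triangle_ineq4[of "\<i> * pairing d \<zeta>"
            "integral {s..t} (\<lambda>r. pairing (G r) k - f r * \<zeta> 0)"] by linarith
      also have "\<dots> \<le> C * (l2norm \<zeta> + l2norm k + norm (\<zeta> 0))"
      proof -
        have "0 \<le> l2norm d * (l2norm k + norm (\<zeta> 0)) + (M1 * (t - s)) * (l2norm \<zeta> + norm (\<zeta> 0))
            + (M2 * (t - s)) * (l2norm \<zeta> + l2norm k)"
          using M st by (intro add_nonneg_nonneg mult_nonneg_nonneg) auto
        then show ?thesis by (simp add: C_def algebra_simps)
      qed
      finally show ?thesis .
    qed
    moreover have "C \<ge> 0" using M st by (simp add: C_def)
    ultimately show ?thesis using that by blast
  qed
  \<comment> \<open>The cut is made at S > R to leave room for the smooth boxes approximating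
    intervals inside [-R,R]: their layers reach at most distance 1 beyond the interval.\<close>
  have supp_zero: "\<Phi> (cut_primitive S k) (cut_density S k) = 0"
      if k: "k \<in> L2_supp R" and R: "R > 0" and S: "S = R + 2" for k R S
  proof -
    have S0: "S > 0" using R S by simp
    have sub: "L2_supp R \<subseteq> L2_supp S" using S by (auto simp: L2_supp_def)
    define \<Lambda> where "\<Lambda> k = \<Phi> (cut_primitive S k) (cut_density S k)" for k
    have add: "\<Lambda> (\<lambda>x. k x + k' x) = \<Lambda> k + \<Lambda> k'" if "k \<in> L2_supp S" "k' \<in> L2_supp S" for k k'
    proof -
      have L: "k \<in> L2" "k' \<in> L2" using that by (simp_all add: L2_supp_def)
      have "cut_primitive S (\<lambda>x. k x + k' x) = (\<lambda>x. cut_primitive S k x + cut_primitive S k' x)"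
        "cut_density S (\<lambda>x. k x + k' x) = (\<lambda>x. cut_density S k x + cut_density S k' x)"
        using L by (auto simp: fun_eq_iff cut_primitive_def cut_density_def L2_set_integrable algebra_simps)
      then show ?thesis
        using h1_pair_L2[OF h1_pair_cut[OF that(1) S0]] h1_pair_L2[OF h1_pair_cut[OF that(2) S0]]
        by (simp add: \<Lambda>_def \<Phi>_add)
    qed
    have cmult: "\<Lambda> (\<lambda>x. c * k x) = c * \<Lambda> k" for c k
    proof -
      have "cut_primitive S (\<lambda>x. c * k x) = (\<lambda>x. c * cut_primitive S k x)"
        "cut_density S (\<lambda>x. c * k x) = (\<lambda>x. c * cut_density S k x)"
        by (auto simp: fun_eq_iff cut_primitive_def cut_density_def algebra_simps)
      then show ?thesis by (simp add: \<Lambda>_def \<Phi>_cmult)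
    qed
    obtain B where B: "\<And>k. k \<in> L2_supp S \<Longrightarrow> l2norm (cut_primitive S k) \<le> B * l2norm k \<and>
        l2norm (cut_density S k) \<le> B * l2norm k \<and> norm (cut_primitive S k 0) \<le> B * l2norm k"
      using cut_bounds[OF S0] by metis
    have bound: "norm (\<Lambda> k) \<le> (3 * C * B) * l2norm k" if "k \<in> L2_supp S" for k
    proof -
      have "norm (\<Lambda> k) \<le> C * (l2norm (cut_primitive S k) + l2norm (cut_density S k)
          + norm (cut_primitive S k 0))"
        unfolding \<Lambda>_def using h1_pair_L2[OF h1_pair_cut[OF that S0]] by (intro C(2))
      also have "\<dots> \<le> C * (B * l2norm k + B * l2norm k + B * l2norm k)"
        using B[OF that] C(1) by (intro mult_left_mono add_mono) auto
      finally show ?thesis by (simp add: algebra_simps)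
    qed
    have diff: "\<Lambda> (\<lambda>x. k x - k' x) = \<Lambda> k - \<Lambda> k'" if "k \<in> L2_supp S" "k' \<in> L2_supp S" for k k'
      using add[OF that(1) L2_supp_cmult[OF that(2), of "-1"]] cmult[of "-1" k'] by simp
    have "\<Lambda> k = 0"
    proof (rule L2_functional_eq_0[OF _ _ _ _ k])
      show "\<Lambda> (indicator {a..b}) = 0" if ab: "-R \<le> a" "a \<le> b" "b \<le> R" for a b
      proof -
        define k where "k n = smooth_box (real (Suc n)) a 0 b 0" for n
        have t: "test_fun (k n)" for n by (simp add: k_def test_fun_smooth_box)
        have "k n x = 0" if "x \<notin> {-S..S}" for n x
        proof -
          have "inverse (real (Suc n)) \<le> 1" by (simp add: field_simps)
          then show ?thesis
            unfolding k_def by (intro smooth_box_eq_0)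
                (use that ab S in \<open>auto simp: min_def max_def divide_inverse\<close>)
        qed
        then have ks: "k n \<in> L2_supp S" for n using test_fun_L2[OF t] by (simp add: L2_supp_def)
        have "\<Lambda> (k n) = 0" for n
          using test[OF test_fun_cut_primitive(1)[OF ks S0 t]] test_fun_cut_primitive(2)[OF ks S0 t]
          by (simp add: \<Lambda>_def \<Phi>_def)
        moreover have I: "(indicator {a..b} :: real \<Rightarrow> complex) \<in> L2_supp S"
          using L2_indicator[of "{a..b}" a b] ab S by (auto simp: L2_supp_def indicator_def)
        ultimately have "norm (\<Lambda> (indicator {a..b}))
            \<le> (3 * C * B) * l2norm (\<lambda>x. k n x - indicator {a..b} x)" for n
          using bound[OF L2_supp_diff[OF ks I], of n] diff[OF ks I, of n] by simp
        moreover have "(\<lambda>n. (3 * C * B) * l2norm (\<lambda>x. k n x - indicator {a..b} x)) \<longlonglongrightarrow> (3 * C * B) * 0"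
        proof (intro tendsto_mult tendsto_const L2_tendsto_dominated)
          show "k n \<in> borel_measurable lborel" for n using test_fun_L2[OF t] by (rule L2_measurable)
          show "(indicator {a..b} :: real \<Rightarrow> complex) \<in> borel_measurable lborel" by simp
          show "(\<lambda>x. 2 * indicator {-S..S} x) \<in> L2" by (intro L2_cmult L2_indicator) auto
          show "AE x in lborel. (\<lambda>n. k n x) \<longlonglongrightarrow> indicator {a..b} x"
            using AE_lborel_singleton[of a] AE_lborel_singleton[of b]
            by eventually_elim (simp only: k_def, rule smooth_box_tendsto[OF _ _ ab(2)])
          fix n x
          show "norm (k n x - indicator {a..b} x) \<le> norm (2 * indicator {-S..S} x :: complex)"
          proof (cases "x \<in> {-S..S}")
            case True
            have "norm (indicator {a..b} x :: complex) \<le> 1" by (simp add: indicator_def)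
            then have "norm (k n x - indicator {a..b} x) \<le> 1 + 1"
              unfolding k_def by (intro norm_triangle_le_diff add_mono norm_smooth_box)
            then show ?thesis using True by simp
          next
            case False
            then show ?thesis using ks[of n] I by (simp add: L2_supp_def)
          qed
        qed
        ultimately have "norm (\<Lambda> (indicator {a..b})) \<le> (3 * C * B) * 0" using LIMSEQ_le_const by blast
        then show ?thesis by simp
      qed
      show "\<Lambda> (\<lambda>x. f x + g x) = \<Lambda> f + \<Lambda> g" if "f \<in> L2_supp R" "g \<in> L2_supp R" for f g
        using add that sub by blast
      show "norm (\<Lambda> f) \<le> (3 * C * B) * l2norm f" if "f \<in> L2_supp R" for f
        using bound that sub by blast
    qed (rule cmult)
    then show ?thesis by (simp add: \<Lambda>_def)
  qed
  \<comment> \<open>For compactly supported \<zeta> the total integral of k is zero; the correction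
    disappears and \<zeta> is its own cut primitive.\<close>
  have compact_zero: "\<Phi> \<zeta> k = 0"
    if pair: "h1_pair \<zeta> k" and R: "R > 0" and z: "\<And>x. \<bar>x\<bar> \<ge> R \<Longrightarrow> \<zeta> x = 0" "\<And>x. \<bar>x\<bar> \<ge> R \<Longrightarrow> k x = 0" for \<zeta> k R
  proof -
    define S where "S = R + 2"
    have kR: "k \<in> L2_supp R" using h1_pair_L2[OF pair] z by (auto simp: L2_supp_def abs_if)
    have I: "(LINT y:{-S..x}|lborel. k y) = \<zeta> x" if "x \<ge> -S" for x
    proof -
      have "\<zeta> x - \<zeta> (-S) = (LINT y:{-S..x}|lborel. k y)" using pair that by (simp add: h1_pair_def)
      then show ?thesis using z(1)[of "-S"] R by (simp add: S_def)
    qed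
    have c: "(LINT y:{-S..S}|lborel. k y) = 0" using I[of S] z(1)[of S] R by (simp add: S_def)
    have "cut_primitive S k x = \<zeta> x" for x
    proof (cases "x \<ge> -S")
      case True then show ?thesis using I c by (simp add: cut_primitive_def)
    next
      case False then show ?thesis using c z(1)[of x] R
        by (simp add: cut_primitive_def S_def set_lebesgue_integral_def)
    qed
    then have "cut_primitive S k = \<zeta>" by auto
    moreover have "cut_density S k = k" using c by (simp add: cut_density_def[abs_def])
    ultimately show ?thesis using supp_zero[OF kR R S_def] by simp
  qed
  obtain B where B: "B \<ge> 0" "\<And>x. \<bar>bump x\<bar> \<le> B" using bump_bounded by metis
  \<comment> \<open>A plateau equal to 1 on [-n,n] and to 0 beyond distance n + 2 from the origin.
    The layers keep a fixed width, so the derivatives are bounded by 2 B uniformly in n.\<close>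
  define \<theta> where "\<theta> n x = smooth_step (x + real (Suc n)) - smooth_step (x - real (Suc n))" for n x
  define \<theta>' where "\<theta>' n x = bump (x + real (Suc n)) - bump (x - real (Suc n))" for n x
  have \<theta>d: "(\<theta> n has_real_derivative \<theta>' n x) (at x)" for n x
    unfolding \<theta>_def[abs_def] \<theta>'_def
    by (rule DERIV_diff; rule DERIV_chain2[OF smooth_step_deriv, THEN DERIV_cong])
        (auto intro!: derivative_eq_intros)
  have \<theta>c: "continuous_on UNIV (\<theta>' n)" for n
    unfolding \<theta>'_def[abs_def] by (intro continuous_intros
        continuous_on_compose2[OF continuous_bump[of UNIV]]) auto
  have \<theta>01: "0 \<le> \<theta> n x" "\<theta> n x \<le> 1" for n x
    using smooth_step_bounds[of "x + real (Suc n)"] smooth_step_bounds[of "x - real (Suc n)"]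
      smooth_step_mono[of "x - real (Suc n)" "x + real (Suc n)"] by (auto simp: \<theta>_def)
  have \<theta>b: "\<bar>\<theta> n x\<bar> \<le> 1" "\<bar>\<theta>' n x\<bar> \<le> 2 * B" for n x
    using \<theta>01[of n x] B(2)[of "x + real (Suc n)"] B(2)[of "x - real (Suc n)"] by (auto simp: \<theta>'_def)
  define \<zeta>n where "\<zeta>n n x = of_real (\<theta> n x) * \<zeta> x" for n x
  define kn where "kn n x = of_real (\<theta>' n x) * \<zeta> x + of_real (\<theta> n x) * k x" for n x
  have pn: "h1_pair (\<zeta>n n) (kn n)" for n
    unfolding \<zeta>n_def[abs_def] kn_def[abs_def] by (rule h1_pair_mult_C1[OF pair \<theta>d \<theta>c \<theta>b])
  have "\<Phi> (\<zeta>n n) (kn n) = 0" for n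
  proof (rule compact_zero[OF pn])
    show "real (Suc n) + 1 > 0" by simp
    fix x :: real assume x: "\<bar>x\<bar> \<ge> real (Suc n) + 1"
    have "\<theta> n x = 0"
    proof (cases "x \<ge> 0")
      case True then show ?thesis using x by (simp add: \<theta>_def smooth_step_eq_1)
    next
      case False then show ?thesis using x by (simp add: \<theta>_def smooth_step_eq_0)
    qed
    moreover have "\<theta>' n x = 0"
      using x bump_eq_0[of "x + real (Suc n)"] bump_eq_0[of "x - real (Suc n)"]
        by (simp add: \<theta>'_def abs_if split: if_splits)
    ultimately show "\<zeta>n n x = 0" "kn n x = 0" by (simp_all add: \<zeta>n_def kn_def)
  qed
  note zeta0 = this
  note L = h1_pair_L2[OF pair] and Ln = h1_pair_L2[OF pn]
  have ev: "\<forall>\<^sub>F n in sequentially. \<theta> n x = 1 \<and> \<theta>' n x = 0" for x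
  proof -
    obtain N :: nat where N: "\<bar>x\<bar> + 1 \<le> real N" using real_arch_simple by blast
    show ?thesis using eventually_ge_at_top[of N]
    proof eventually_elim
      fix n assume "N \<le> n"
      then have "\<bar>x\<bar> + 1 \<le> real (Suc n)" using N by linarith
      then have "x + real (Suc n) \<ge> 1" "x - real (Suc n) \<le> -1" by linarith+
      then show "\<theta> n x = 1 \<and> \<theta>' n x = 0"
        by (simp add: \<theta>_def \<theta>'_def smooth_step_eq_0 smooth_step_eq_1 bump_eq_0)
    qed
  qed
  have l1: "(\<lambda>n. l2norm (\<lambda>x. \<zeta>n n x - \<zeta> x)) \<longlonglongrightarrow> 0"
  proof (rule L2_tendsto_dominated[OF L2_measurable[OF Ln(1)] L2_measurable[OF L(1)] L(1)])
    show "AE x in lborel. (\<lambda>n. \<zeta>n n x) \<longlonglongrightarrow> \<zeta> x"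
    proof (rule AE_I2, rule Lim_transform_eventually[OF tendsto_const])
      fix x show "\<forall>\<^sub>F n in sequentially. \<zeta> x = \<zeta>n n x"
        using ev[of x] by eventually_elim (simp add: \<zeta>n_def)
    qed
    show "norm (\<zeta>n n x - \<zeta> x) \<le> norm (\<zeta> x)" for n x
    proof -
      have "\<zeta>n n x - \<zeta> x = of_real (\<theta> n x - 1) * \<zeta> x" by (simp add: \<zeta>n_def algebra_simps)
      then show ?thesis using \<theta>01[of n x]
        by (simp only: norm_mult norm_of_real) (auto intro!: mult_left_le_one_le)
    qed
  qed
  \<comment> \<open>Majorant of \<open>kn n x - k x\<close>: differentiating the cut-off costs at
    most 2 B |\<zeta>|, and cutting k costs at most |k|.\<close>
  define h where "h x = complex_of_real (2 * B * norm (\<zeta> x)) + of_real (norm (k x))" for x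
  have nL: "(\<lambda>x. complex_of_real (norm (g x))) \<in> L2" if "g \<in> L2" for g
    by (rule L2_dominated(1)[OF _ that, of _ 1]) (use L2_measurable[OF that] in auto)
  have hL: "h \<in> L2"
    unfolding h_def of_real_mult by (intro L2_add L2_cmult nL L)
  have l2: "(\<lambda>n. l2norm (\<lambda>x. kn n x - k x)) \<longlonglongrightarrow> 0"
  proof (rule L2_tendsto_dominated[OF L2_measurable[OF Ln(2)] L2_measurable[OF L(2)] hL])
    show "AE x in lborel. (\<lambda>n. kn n x) \<longlonglongrightarrow> k x"
    proof (rule AE_I2, rule Lim_transform_eventually[OF tendsto_const])
      fix x show "\<forall>\<^sub>F n in sequentially. k x = kn n x"
        using ev[of x] by eventually_elim (simp add: kn_def)
    qed
    show "norm (kn n x - k x) \<le> norm (h x)" for n x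
    proof -
      have "kn n x - k x = of_real (\<theta>' n x) * \<zeta> x + of_real (\<theta> n x - 1) * k x"
        by (simp add: kn_def algebra_simps)
      also have "norm \<dots> \<le> 2 * B * norm (\<zeta> x) + 1 * norm (k x)"
        by (intro norm_triangle_mono; simp only: norm_mult norm_of_real; intro mult_right_mono)
          (use \<theta>b[of n x] \<theta>01[of n x] in auto)
      also have "\<dots> = norm (h x)" using B(1) unfolding h_def of_real_add[symmetric] norm_of_real by simp
      finally show ?thesis .
    qed
  qed
  have l3: "(\<lambda>n. norm (\<zeta>n n 0 - \<zeta> 0)) \<longlonglongrightarrow> 0"
    by (rule Lim_transform_eventually[OF tendsto_const]) (use ev[of 0] in \<open>eventually_elim, simp add: \<zeta>n_def\<close>)
  have "norm (\<Phi> \<zeta> k) \<le> C * (l2norm (\<lambda>x. \<zeta>n n x - \<zeta> x) + l2norm (\<lambda>x. kn n x - k x)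
      + norm (\<zeta>n n 0 - \<zeta> 0))" for n
  proof -
    have "\<Phi> (\<lambda>x. \<zeta>n n x + (-1) * \<zeta> x) (\<lambda>x. kn n x + (-1) * k x) = - \<Phi> \<zeta> k"
      using \<Phi>_add[OF Ln(1) Ln(2) L2_cmult[OF L(1), of "-1"] L2_cmult[OF L(2), of "-1"], of n n]
          \<Phi>_cmult[of "-1" \<zeta> k] zeta0[of n]
      by simp
    then have "norm (\<Phi> \<zeta> k) = norm (\<Phi> (\<lambda>x. \<zeta>n n x - \<zeta> x) (\<lambda>x. kn n x - k x))" by simp
    also have "\<dots> \<le> C * (l2norm (\<lambda>x. \<zeta>n n x - \<zeta> x) + l2norm (\<lambda>x. kn n x - k x) + norm (\<zeta>n n 0 - \<zeta> 0))"
      by (intro C(2) L2_diff L Ln)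
    finally show ?thesis .
  qed
  moreover have "(\<lambda>n. C * (l2norm (\<lambda>x. \<zeta>n n x - \<zeta> x) + l2norm (\<lambda>x. kn n x - k x) + norm (\<zeta>n n 0 - \<zeta> 0)))
      \<longlonglongrightarrow> C * (0 + 0 + 0)"
    by (intro tendsto_intros l1 l2 l3)
  ultimately have "norm (\<Phi> \<zeta> k) \<le> C * (0 + 0 + 0)" using LIMSEQ_le_const by blast
  then show ?thesis by (simp add: \<Phi>_def)
qed

subsection \<open>Solutions in integrated form and conservation of charge\<close>

text \<open>The source f is independent data rather than F of the trace, which makes the notion
  linear: time shifts and differences of solutions are solutions again. The form integrated in time
  avoids a derivative of \<open>p\<close>, which would exist only in the dual of H1.\<close>

definition delta_solution ::
    "(real \<Rightarrow> real \<Rightarrow> complex) \<Rightarrow> (real \<Rightarrow> real \<Rightarrow> complex) \<Rightarrow> (real \<Rightarrow> complex) \<Rightarrow> bool"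
  where "delta_solution p G f \<longleftrightarrow> h1_curve p G \<and> continuous_on UNIV f \<and>
    (\<forall>\<zeta> k s t. h1_pair \<zeta> k \<longrightarrow> s \<le> t \<longrightarrow>
      \<i> * pairing (\<lambda>x. p t x - p s x) \<zeta> = integral {s..t} (\<lambda>r. pairing (G r) k - f r * \<zeta> 0))"

lemma delta_solutionD:
  assumes "delta_solution p G f"
  shows "h1_curve p G" "continuous_on S f"
    "h1_pair \<zeta> k \<Longrightarrow> s \<le> t \<Longrightarrow>
      \<i> * pairing (\<lambda>x. p t x - p s x) \<zeta> = integral {s..t} (\<lambda>r. pairing (G r) k - f r * \<zeta> 0)"
  using assms continuous_on_subset unfolding delta_solution_def by blast+

lemma schroedinger_delta_solution:
  assumes "C_H1 \<psi>" "schroedinger_delta F \<psi>" "continuous_on UNIV F"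
  shows "delta_solution (\<lambda>t x. \<psi> x t) (\<lambda>t. h1_deriv (\<lambda>x. \<psi> x t)) (\<lambda>t. F (\<psi> 0 t))"
proof -
  note curve = C_H1_h1_curve[OF assms(1)]
  have f: "continuous_on UNIV (\<lambda>t. F (\<psi> 0 t))"
    using continuous_on_compose2[OF assms(3) h1_curve_continuous_at_point[OF curve]] by auto
  show ?thesis
    unfolding delta_solution_def
    using curve f delta_identity_extend[OF curve f
        L2_diff[OF h1_curveD(2)[OF curve] h1_curveD(2)[OF curve]] _ schroedinger_test[OF assms]]
    by blast
qed

lemma h1_curve_shift: "h1_curve p G \<Longrightarrow> h1_curve (\<lambda>t. p (t + h)) (\<lambda>t. G (t + h))"
proof -
  assume c: "h1_curve p G"
  have "((\<lambda>s. q (s + h)) \<longlongrightarrow> 0) (at t)" if "(q \<longlongrightarrow> 0) (at (t + h))" for q :: "real \<Rightarrow> real" and t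
    using LIM_offset[OF that, of h] by (simp add: add.commute)
  note shift = this
  show ?thesis
    unfolding h1_curve_def using h1_curveD[OF c] shift[of "\<lambda>s. l2norm (\<lambda>x. p s x - p _ x)"]
      shift[of "\<lambda>s. l2norm (\<lambda>x. G s x - G _ x)"] by blast
qed

lemma h1_curve_cnj: "h1_curve p G \<Longrightarrow> h1_curve (\<lambda>t x. cnj (p t x)) (\<lambda>t x. cnj (G t x))"
proof -
  assume c: "h1_curve p G"
  have "l2norm (\<lambda>x. cnj (f x) - cnj (g x)) = l2norm (\<lambda>x. f x - g x)" for f g
    by (simp add: l2norm_def flip: complex_cnj_diff)
  then show ?thesis using c by (simp add: h1_curve_def h1_pair_cnj)
qed

lemma l2norm_diff_diff:
  assumes "a \<in> L2" "b \<in> L2" "c \<in> L2" "d \<in> L2"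
  shows "l2norm (\<lambda>x. (a x - b x) - (c x - d x)) \<le> l2norm (\<lambda>x. a x - c x) + l2norm (\<lambda>x. b x - d x)"
proof -
  have "(\<lambda>x. (a x - b x) - (c x - d x)) = (\<lambda>x. (a x - c x) - (b x - d x))" by (simp add: fun_eq_iff)
  then show ?thesis using l2norm_triangle_diff[OF L2_diff[OF assms(1,3)] L2_diff[OF assms(2,4)]] by simp
qed

lemma h1_curve_diff:
  assumes c: "h1_curve p G" and c': "h1_curve p' G'"
  shows "h1_curve (\<lambda>t x. p t x - p' t x) (\<lambda>t x. G t x - G' t x)"
  unfolding h1_curve_def
proof (intro conjI allI)
  fix t
  show "h1_pair (\<lambda>x. p t x - p' t x) (\<lambda>x. G t x - G' t x)"
    by (intro h1_pair_diff h1_curveD c c')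
  show "((\<lambda>s. l2norm (\<lambda>x. p s x - p' s x - (p t x - p' t x))) \<longlongrightarrow> 0) (at t)"
  proof (rule Lim_null_comparison)
    show "((\<lambda>s. l2norm (\<lambda>x. p s x - p t x) + l2norm (\<lambda>x. p' s x - p' t x)) \<longlongrightarrow> 0) (at t)"
      using tendsto_add[OF h1_curveD(4)[OF c] h1_curveD(4)[OF c']] by fastforce
  qed (use l2norm_diff_diff h1_curveD(2)[OF c] h1_curveD(2)[OF c'] in auto)
  show "((\<lambda>s. l2norm (\<lambda>x. G s x - G' s x - (G t x - G' t x))) \<longlongrightarrow> 0) (at t)"
  proof (rule Lim_null_comparison)
    show "((\<lambda>s. l2norm (\<lambda>x. G s x - G t x) + l2norm (\<lambda>x. G' s x - G' t x)) \<longlongrightarrow> 0) (at t)"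
      using tendsto_add[OF h1_curveD(5)[OF c] h1_curveD(5)[OF c']] by fastforce
  qed (use l2norm_diff_diff h1_curveD(3)[OF c] h1_curveD(3)[OF c'] in auto)
qed

lemma continuous_on_h1_pairing:
  assumes "h1_curve p G" "k \<in> L2"
  shows "continuous_on S (\<lambda>t. pairing (G t) k)" "continuous_on S (\<lambda>t. pairing (p t) k)"
  by (rule continuous_on_l2curve(1)[OF h1_curveD(3)[OF assms(1)] h1_curveD(5)[OF assms(1)] assms(2)],
      rule continuous_on_l2curve(1)[OF h1_curveD(2)[OF assms(1)] h1_curveD(4)[OF assms(1)] assms(2)])

lemma continuous_on_h1_l2norm:
  assumes "h1_curve p G"
  shows "continuous_on S (\<lambda>t. l2norm (G t))" "continuous_on S (\<lambda>t. l2norm (p t))"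
  by (rule continuous_on_l2curve(2)[OF h1_curveD(3)[OF assms(1)] h1_curveD(5)[OF assms(1)]],
      rule continuous_on_l2curve(2)[OF h1_curveD(2)[OF assms(1)] h1_curveD(4)[OF assms(1)]])

lemma delta_solution_shift:
  assumes "delta_solution p G f"
  shows "delta_solution (\<lambda>t. p (t + h)) (\<lambda>t. G (t + h)) (\<lambda>t. f (t + h))"
  unfolding delta_solution_def
proof (intro conjI allI impI)
  show "h1_curve (\<lambda>t. p (t + h)) (\<lambda>t. G (t + h))"
    by (rule h1_curve_shift[OF delta_solutionD(1)[OF assms]])
  show "continuous_on UNIV (\<lambda>t. f (t + h))"
    by (rule continuous_on_compose2[OF delta_solutionD(2)[OF assms, of UNIV]]) (auto intro: continuous_intros)
  fix \<zeta> k s t assume "h1_pair \<zeta> k" "s \<le> (t::real)"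
  then have "\<i> * pairing (\<lambda>x. p (t + h) x - p (s + h) x) \<zeta> =
      integral {s + h..t + h} (\<lambda>r. pairing (G r) k - f r * \<zeta> 0)"
    by (intro delta_solutionD(3)[OF assms]) auto
  also have "\<dots> = integral {s..t} (\<lambda>r. pairing (G (r + h)) k - f (r + h) * \<zeta> 0)"
    by (subst integral_shift_Icc_real[symmetric]) (simp add: comp_def add.commute)
  finally show "\<i> * pairing (\<lambda>x. p (t + h) x - p (s + h) x) \<zeta> =
      integral {s..t} (\<lambda>r. pairing (G (r + h)) k - f (r + h) * \<zeta> 0)" .
qed

lemma delta_solution_diff:
  assumes A: "delta_solution p G f" and B: "delta_solution p' G' f'"
  shows "delta_solution (\<lambda>t x. p t x - p' t x) (\<lambda>t x. G t x - G' t x) (\<lambda>t. f t - f' t)"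
  unfolding delta_solution_def
proof (intro conjI allI impI)
  note cA = delta_solutionD(1)[OF A] and cB = delta_solutionD(1)[OF B]
  note fA = delta_solutionD(2)[OF A] and fB = delta_solutionD(2)[OF B]
  show "h1_curve (\<lambda>t x. p t x - p' t x) (\<lambda>t x. G t x - G' t x)"
    by (rule h1_curve_diff[OF cA cB])
  show "continuous_on UNIV (\<lambda>t. f t - f' t)"
    by (intro continuous_on_diff fA fB)
  fix \<zeta> k s t assume pair: "h1_pair \<zeta> k" and st: "s \<le> (t::real)"
  note L = h1_pair_L2[OF pair]
  have "pairing (\<lambda>x. p t x - p' t x - (p s x - p' s x)) \<zeta>
      = pairing (\<lambda>x. p t x - p s x) \<zeta> - pairing (\<lambda>x. p' t x - p' s x) \<zeta>"
    using h1_curveD(2)[OF cA] h1_curveD(2)[OF cB] L by (simp add: pairing_diff_left L2_diff)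
  then have "\<i> * pairing (\<lambda>x. p t x - p' t x - (p s x - p' s x)) \<zeta>
      = integral {s..t} (\<lambda>r. pairing (G r) k - f r * \<zeta> 0) - integral {s..t}
          (\<lambda>r. pairing (G' r) k - f' r * \<zeta> 0)"
    using delta_solutionD(3)[OF A pair st] delta_solutionD(3)[OF B pair st] by (simp add: right_diff_distrib)
  also have "\<dots> = integral {s..t} (\<lambda>r. (pairing (G r) k - f r * \<zeta> 0) - (pairing (G' r) k - f' r * \<zeta> 0))"
    by (rule Henstock_Kurzweil_Integration.integral_diff[symmetric];
        intro integrable_continuous_interval continuous_intros continuous_on_h1_pairing(1)[OF cA]
            continuous_on_h1_pairing(1)[OF cB] L fA fB)
  also have "\<dots> = integral {s..t} (\<lambda>r. pairing (\<lambda>x. G r x - G' r x) k - (f r - f' r) * \<zeta> 0)"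
    using h1_curveD(3)[OF cA] h1_curveD(3)[OF cB] L by (simp add: pairing_diff_left algebra_simps)
  finally show "\<i> * pairing (\<lambda>x. p t x - p' t x - (p s x - p' s x)) \<zeta> =
      integral {s..t} (\<lambda>r. pairing (\<lambda>x. G r x - G' r x) k - (f r - f' r) * \<zeta> 0)" .
qed

section \<open>Time increments and derivatives of pairings\<close>

text \<open>Lipschitz continuity in time with values in the dual of H1. It is the substitute for a
  time derivative in all product rules below.\<close>

lemma delta_solution_increment_bound:
  assumes sol: "delta_solution p G f"
    and M: "\<And>r. r \<in> {a..b} \<Longrightarrow> l2norm (G r) \<le> M1" "\<And>r. r \<in> {a..b} \<Longrightarrow> norm (f r) \<le> M2"
    and st: "s \<in> {a..b}" "t \<in> {a..b}" and pair: "h1_pair \<zeta> k"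
  shows "norm (pairing (\<lambda>x. p t x - p s x) \<zeta>) \<le> \<bar>t - s\<bar> * (M1 * l2norm k + M2 * norm (\<zeta> 0))"
proof -
  note c = delta_solutionD(1)[OF sol] and L = h1_pair_L2[OF pair]
  have *: "norm (pairing (\<lambda>x. p t x - p s x) \<zeta>) \<le> (M1 * l2norm k + M2 * norm (\<zeta> 0)) * (t - s)"
    if "s \<in> {a..b}" "t \<in> {a..b}" "s \<le> t" for s t
  proof -
    have "norm (integral {s..t} (\<lambda>r. pairing (G r) k - f r * \<zeta> 0))
        \<le> (M1 * l2norm k + M2 * norm (\<zeta> 0)) * (t - s)"
    proof (rule integral_bound[OF that(3)])
      show "continuous_on {s..t} (\<lambda>r. pairing (G r) k - f r * \<zeta> 0)"
        by (intro continuous_intros continuous_on_h1_pairing(1)[OF c] L delta_solutionD(2)[OF sol])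
      show "norm (pairing (G r) k - f r * \<zeta> 0) \<le> M1 * l2norm k + M2 * norm (\<zeta> 0)" if r: "r \<in> {s..t}" for r
      proof -
        have r': "r \<in> {a..b}" using r \<open>s \<in> {a..b}\<close> \<open>t \<in> {a..b}\<close> by auto
        have "norm (pairing (G r) k) \<le> M1 * l2norm k"
          using pairing_bound[OF h1_curveD(3)[OF c] L(2), of r]
              mult_right_mono[OF M(1)[OF r'] l2norm_nonneg[of k]] by linarith
        moreover have "norm (f r * \<zeta> 0) \<le> M2 * norm (\<zeta> 0)"
          unfolding norm_mult by (intro mult_right_mono M(2) r') simp
        ultimately show ?thesis using norm_triangle_ineq4[of "pairing (G r) k" "f r * \<zeta> 0"] by linarith
      qed
    qed
    then have "norm (\<i> * pairing (\<lambda>x. p t x - p s x) \<zeta>) \<le> (M1 * l2norm k + M2 * norm (\<zeta> 0)) * (t - s)"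
      using delta_solutionD(3)[OF sol pair that(3)] by simp
    then show ?thesis by (simp add: norm_mult)
  qed
  have "pairing (\<lambda>x. p t x - p s x) \<zeta> = - pairing (\<lambda>x. p s x - p t x) \<zeta>"
    using h1_curveD(2)[OF c] L by (simp add: pairing_diff_left)
  then show ?thesis using *[OF st] *[OF st(2,1)] by (cases "s \<le> t") (auto simp: mult.commute)
qed

lemma delta_solution_l2_increment:
  assumes sol: "delta_solution p G f"
    and M: "\<And>r. r \<in> {a..b} \<Longrightarrow> l2norm (G r) \<le> M1" "\<And>r. r \<in> {a..b} \<Longrightarrow> norm (f r) \<le> M2"
      "\<And>r. r \<in> {a..b} \<Longrightarrow> norm (p r 0) \<le> M3"
    and st: "s \<in> {a..b}" "t \<in> {a..b}"
  shows "(l2norm (\<lambda>x. p t x - p s x))\<^sup>2 \<le> \<bar>t - s\<bar> * (2 * M1\<^sup>2 + 2 * M2 * M3)"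
proof -
  note c = delta_solutionD(1)[OF sol]
  let ?d = "\<lambda>x. p t x - p s x" and ?k = "\<lambda>x. G t x - G s x"
  have M0: "M1 \<ge> 0" "M2 \<ge> 0"
    using order_trans[OF l2norm_nonneg M(1)[OF st(1)]] order_trans[OF norm_ge_zero M(2)[OF st(1)]] by auto
  have "(l2norm ?d)\<^sup>2 = norm (complex_of_real ((l2norm ?d)\<^sup>2))" by (simp del: of_real_power)
  also have "\<dots> = norm (pairing ?d (\<lambda>x. cnj (?d x)))" by (simp only: pairing_self_cnj)
  also have "\<dots> \<le> \<bar>t - s\<bar> * (M1 * l2norm (\<lambda>x. cnj (?k x)) + M2 * norm (cnj (?d 0)))"
    by (intro delta_solution_increment_bound[OF sol M(1,2) st] h1_pair_cnj h1_pair_diff h1_curveD(1)[OF c])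
  also have "\<dots> \<le> \<bar>t - s\<bar> * (M1 * (M1 + M1) + M2 * (M3 + M3))"
  proof (intro mult_left_mono add_mono)
    show "l2norm (\<lambda>x. cnj (?k x)) \<le> M1 + M1"
      unfolding l2norm_cnj using l2norm_triangle_diff[OF h1_curveD(3)[OF c] h1_curveD(3)[OF c], of t s]
          M(1)[OF st(1)] M(1)[OF st(2)] by linarith
    show "norm (cnj (?d 0)) \<le> M3 + M3"
      unfolding complex_mod_cnj using norm_triangle_ineq4[of "p t 0" "p s 0"] M(3)[OF st(1)] M(3)[OF
          st(2)] by linarith
  qed (use M0 in auto)
  finally show ?thesis by (simp add: power2_eq_square algebra_simps)
qed

lemma delta_solution_local_bounds:
  assumes sol: "delta_solution p G f"
  obtains M where "M \<ge> 0" "\<And>r. r \<in> {a..b} \<Longrightarrow> l2norm (G r) \<le> M" "\<And>r. r \<in> {a..b} \<Longrightarrow> norm (f r) \<le> M"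
    "\<And>r. r \<in> {a..b} \<Longrightarrow> norm (p r 0) \<le> M"
proof -
  have *: "\<exists>M\<ge>0. \<forall>r\<in>{a..b}. norm (g r) \<le> M" if g: "continuous_on {a..b} g"
      for g :: "real \<Rightarrow> 'z::real_normed_vector"
  proof -
    obtain M where "\<forall>r\<in>{a..b}. norm (g r) \<le> M"
      using compact_imp_bounded[OF compact_continuous_image[OF g compact_Icc]] by (auto simp: bounded_iff)
    then show ?thesis by (intro exI[of _ "\<bar>M\<bar>"]) fastforce
  qed
  note c = delta_solutionD(1)[OF sol]
  obtain M1 where M1: "M1 \<ge> 0" "\<And>r. r \<in> {a..b} \<Longrightarrow> norm (l2norm (G r)) \<le> M1"
    using *[OF continuous_on_h1_l2norm(1)[OF c]] by blast
  obtain M2 where M2: "M2 \<ge> 0" "\<And>r. r \<in> {a..b} \<Longrightarrow> norm (f r) \<le> M2"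
    using *[OF delta_solutionD(2)[OF sol]] by blast
  obtain M3 where M3: "M3 \<ge> 0" "\<And>r. r \<in> {a..b} \<Longrightarrow> norm (p r 0) \<le> M3"
    using *[OF h1_curve_continuous_at_point[OF c]] by blast
  show ?thesis
  proof (rule that[of "M1 + M2 + M3"])
    fix r assume r: "r \<in> {a..b}"
    show "l2norm (G r) \<le> M1 + M2 + M3" using M1(2)[OF r] M2(1) M3(1) by simp
    show "norm (f r) \<le> M1 + M2 + M3" using M2(2)[OF r] M1(1) M3(1) by simp
    show "norm (p r 0) \<le> M1 + M2 + M3" using M3(2)[OF r] M1(1) M2(1) by simp
  qed (use M1 M2 M3 in auto)
qed

lemma has_vector_derivative_iff_quotient:
  fixes f :: "real \<Rightarrow> complex"
  shows "(f has_vector_derivative D) (at t) \<longleftrightarrow> ((\<lambda>s. (f s - f t) /\<^sub>R (s - t)) \<longlongrightarrow> D) (at t)"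
proof -
  have eq: "norm ((f s - f t - (s - t) *\<^sub>R D) /\<^sub>R norm (s - t)) = norm ((f s - f t) /\<^sub>R (s - t) - D)"
      if "s \<noteq> t" for s
  proof -
    have "(f s - f t) /\<^sub>R (s - t) - D = (f s - f t - (s - t) *\<^sub>R D) /\<^sub>R (s - t)"
      using that by (simp add: scaleR_diff_right)
    then show ?thesis by simp
  qed
  have "(f has_vector_derivative D) (at t) \<longleftrightarrow> ((\<lambda>s. norm ((f s - f t - (s - t) *\<^sub>R D) /\<^sub>R norm (s - t)))
      \<longlongrightarrow> 0) (at t)"
    unfolding has_vector_derivative_def has_derivative_at_within
    by (simp only: bounded_linear_scaleR_left simp_thms tendsto_norm_zero_iff)
  also have "\<dots> \<longleftrightarrow> ((\<lambda>s. norm ((f s - f t) /\<^sub>R (s - t) - D)) \<longlongrightarrow> 0) (at t)"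
    by (rule tendsto_cong) (use eq in \<open>auto simp only: eventually_at_filter intro!: always_eventually\<close>)
  also have "\<dots> \<longleftrightarrow> ((\<lambda>s. (f s - f t) /\<^sub>R (s - t)) \<longlongrightarrow> D) (at t)"
    by (simp only: tendsto_norm_zero_iff Lim_null[symmetric])
  finally show ?thesis .
qed

lemma delta_solution_deriv_fixed:
  assumes sol: "delta_solution p G f" and pair: "h1_pair \<zeta> k"
  shows "((\<lambda>t. pairing (p t) \<zeta>) has_vector_derivative - \<i> * (pairing (G t) k - f t * \<zeta> 0)) (at t)"
proof (rule has_vector_derivative_of_set_integral)
  note c = delta_solutionD(1)[OF sol] and L = h1_pair_L2[OF pair]
  have cg: "continuous_on A (\<lambda>r. - \<i> * (pairing (G r) k - f r * \<zeta> 0))" for A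
    by (intro continuous_intros continuous_on_h1_pairing(1)[OF c] L delta_solutionD(2)[OF sol])
  then show "continuous_on UNIV (\<lambda>r. - \<i> * (pairing (G r) k - f r * \<zeta> 0))" .
  fix a b :: real assume ab: "a \<le> b"
  have "pairing (p b) \<zeta> - pairing (p a) \<zeta> = - \<i> * (\<i> * pairing (\<lambda>x. p b x - p a x) \<zeta>)"
    using h1_curveD(2)[OF c] L by (simp add: pairing_diff_left flip: mult.assoc)
  also have "\<dots> = - \<i> * integral {a..b} (\<lambda>r. pairing (G r) k - f r * \<zeta> 0)"
    by (simp only: delta_solutionD(3)[OF sol pair ab])
  also have "\<dots> = integral {a..b} (\<lambda>r. - \<i> * (pairing (G r) k - f r * \<zeta> 0))"
    by (rule Henstock_Kurzweil_Integration.integral_mult_right[symmetric])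
  also have "\<dots> = (LINT r:{a..b}|lborel. - \<i> * (pairing (G r) k - f r * \<zeta> 0))"
    by (rule set_borel_integral_eq_integral(2)[OF borel_integrable_atLeastAtMost'[OF cg], symmetric])
  finally show "pairing (p b) \<zeta> - pairing (p a) \<zeta>
      = (LINT r:{a..b}|lborel. - \<i> * (pairing (G r) k - f r * \<zeta> 0))" .
qed

text \<open>A product rule with a moving test function. Replacing \<open>Z s\<close> by
  \<open>Z t\<close> costs the pairing of two increments: the one of p is O(|s - t|) in the dual of
  H1, the one of Z tends to 0 in H1, so the error vanishes after division by s - t.\<close>

lemma delta_solution_quotient:
  assumes sol: "delta_solution p G f" and Z: "h1_curve Z K"
  shows "((\<lambda>s. pairing (\<lambda>x. p s x - p t x) (Z s) /\<^sub>R (s - t))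
      \<longlongrightarrow> - \<i> * (pairing (G t) (K t) - f t * Z t 0)) (at t)"
proof -
  note c = delta_solutionD(1)[OF sol]
  note L = h1_curveD(2)[OF c] h1_curveD(2)[OF Z]
  obtain M where M: "M \<ge> 0" "\<And>r. r \<in> {t - 1..t + 1} \<Longrightarrow> l2norm (G r) \<le> M" "\<And>r. r \<in> {t - 1..t + 1} \<Longrightarrow>
      norm (f r) \<le> M"
    using delta_solution_local_bounds[OF sol] by metis
  have 1: "((\<lambda>s. pairing (\<lambda>x. p s x - p t x) (Z t) /\<^sub>R (s - t))
      \<longlongrightarrow> - \<i> * (pairing (G t) (K t) - f t * Z t 0)) (at t)"
    using delta_solution_deriv_fixed[OF sol h1_curveD(1)[OF Z], of t t] L
    by (simp only: has_vector_derivative_iff_quotient pairing_diff_left)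
  have 2: "((\<lambda>s. pairing (\<lambda>x. p s x - p t x) (\<lambda>x. Z s x - Z t x) /\<^sub>R (s - t)) \<longlongrightarrow> 0) (at t)"
  proof (rule Lim_null_comparison)
    have "((\<lambda>s. norm (Z s 0 - Z t 0)) \<longlongrightarrow> 0) (at t)"
      by (rule Lim_null_comparison[OF _ h1_curve_sup_tendsto[OF Z]]) (simp add: h1_curve_sup[OF Z])
    then have "((\<lambda>s. M * l2norm (\<lambda>x. K s x - K t x) + M * norm (Z s 0 - Z t 0)) \<longlongrightarrow> M * 0 + M * 0) (at t)"
      by (intro tendsto_intros h1_curveD(5)[OF Z])
    then show "((\<lambda>s. M * l2norm (\<lambda>x. K s x - K t x) + M * norm (Z s 0 - Z t 0)) \<longlongrightarrow> 0) (at t)" by simp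
    have "\<forall>\<^sub>F s in at t. s \<in> {t - 1<..<t + 1} \<and> s \<noteq> t"
      using eventually_nhds_in_open[of "{t - 1<..<t + 1}" t]
        by (auto simp: eventually_at_filter elim: eventually_mono)
    then show "\<forall>\<^sub>F s in at t. norm (pairing (\<lambda>x. p s x - p t x) (\<lambda>x. Z s x - Z t x) /\<^sub>R (s - t))
        \<le> M * l2norm (\<lambda>x. K s x - K t x) + M * norm (Z s 0 - Z t 0)"
    proof eventually_elim
      fix s assume s: "s \<in> {t - 1<..<t + 1} \<and> s \<noteq> t"
      have "norm (pairing (\<lambda>x. p s x - p t x) (\<lambda>x. Z s x - Z t x))
          \<le> \<bar>s - t\<bar> * (M * l2norm (\<lambda>x. K s x - K t x) + M * norm (Z s 0 - Z t 0))"
        using s by (intro delta_solution_increment_bound[OF sol M(2,3)] h1_pair_diff h1_curveD(1)[OF Z]) auto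
      then show "norm (pairing (\<lambda>x. p s x - p t x) (\<lambda>x. Z s x - Z t x) /\<^sub>R (s - t))
        \<le> M * l2norm (\<lambda>x. K s x - K t x) + M * norm (Z s 0 - Z t 0)"
        using s by (simp add: divide_inverse_commute[symmetric] pos_divide_le_eq mult.commute)
    qed
  qed
  have "pairing (\<lambda>x. p s x - p t x) (Z s)
      = pairing (\<lambda>x. p s x - p t x) (Z t) + pairing (\<lambda>x. p s x - p t x) (\<lambda>x. Z s x - Z t x)" for s
    using L by (simp add: pairing_diff_right L2_diff)
  then show ?thesis using tendsto_add[OF 1 2] by (simp add: scaleR_add_right)
qed

text \<open>The kinetic contributions of the two factors are - \<i> times the pairing of
  \<open>G t\<close> with the conjugate of \<open>H t\<close>, and the negative of the same number.
  Only the values at the origin survive.\<close>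

lemma delta_solution_sesquilinear_deriv:
  assumes P: "delta_solution p G f" and Q: "delta_solution q H g"
  shows "((\<lambda>t. pairing (p t) (\<lambda>x. cnj (q t x))) has_vector_derivative
    \<i> * (f t * cnj (q t 0) - cnj (g t) * p t 0)) (at t)"
  unfolding has_vector_derivative_iff_quotient
proof -
  note cP = delta_solutionD(1)[OF P] and cQ = delta_solutionD(1)[OF Q]
  note L = h1_curveD(2)[OF cP] h1_curveD(2)[OF cQ]
  note 1 = delta_solution_quotient[OF P h1_curve_cnj[OF cQ], of t]
  \<comment> \<open>In the splitting of the increment the first term keeps q at time s, so the
    second one has p frozen at time t; a constant curve is an admissible test function.\<close>
  have const: "h1_curve (\<lambda>s x. cnj (p t x)) (\<lambda>s x. cnj (G t x))"
    using h1_pair_cnj[OF h1_curveD(1)[OF cP]] by (simp add: h1_curve_def l2norm_def)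
  note 2 = tendsto_cnj[OF delta_solution_quotient[OF Q const, of t]]
  have "pairing (p s) (\<lambda>x. cnj (q s x)) - pairing (p t) (\<lambda>x. cnj (q t x))
      = pairing (\<lambda>x. p s x - p t x) (\<lambda>x. cnj (q s x)) + cnj
          (pairing (\<lambda>x. q s x - q t x) (\<lambda>x. cnj (p t x)))" for s
  proof -
    have "cnj (pairing (\<lambda>x. q s x - q t x) (\<lambda>x. cnj (p t x))) = pairing (p t) (\<lambda>x. cnj (q s x) - cnj (q t x))"
      using pairing_cnj[of "\<lambda>x. q s x - q t x" "\<lambda>x. cnj (p t x)"] by (simp add: pairing_commute)
    then show ?thesis using L by (simp add: pairing_diff_left pairing_diff_right L2_cnj)
  qed
  then have "(\<lambda>s. (pairing (p s) (\<lambda>x. cnj (q s x)) - pairing (p t) (\<lambda>x. cnj (q t x))) /\<^sub>R (s - t))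
      = (\<lambda>s. pairing (\<lambda>x. p s x - p t x) (\<lambda>x. cnj (q s x)) /\<^sub>R (s - t) + cnj
          (pairing (\<lambda>x. q s x - q t x) (\<lambda>x. cnj (p t x)) /\<^sub>R (s - t)))"
    by (simp add: fun_eq_iff scaleR_add_right complex_cnj_scaleR)
  moreover have "- \<i> * (pairing (G t) (\<lambda>x. cnj (H t x)) - f t * cnj (q t 0))
      + cnj (- \<i> * (pairing (H t) (\<lambda>x. cnj (G t x)) - g t * cnj (p t 0)))
      = \<i> * (f t * cnj (q t 0) - cnj (g t) * p t 0)"
    using pairing_cnj[of "H t" "\<lambda>x. cnj (G t x)"] by (simp add: pairing_commute algebra_simps)
  ultimately show "((\<lambda>s. (pairing (p s) (\<lambda>x. cnj (q s x)) - pairing (p t) (\<lambda>x. cnj (q t x))) /\<^sub>R (s - t))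
      \<longlongrightarrow> \<i> * (f t * cnj (q t 0) - cnj (g t) * p t 0)) (at t)"
    using tendsto_add[OF 1 2] by simp
qed

lemma delta_solution_charge:
  assumes sol: "delta_solution p G f" and real: "\<And>t. f t * cnj (p t 0) \<in> \<real>"
  shows "l2norm (p t) = l2norm (p s)"
proof -
  have "((\<lambda>t. pairing (p t) (\<lambda>x. cnj (p t x))) has_vector_derivative 0) (at t within UNIV)" for t
  proof -
    have "f t * cnj (p t 0) - cnj (f t) * p t 0 = 0"
      using real[of t] by (simp add: Reals_cnj_iff)
    with delta_solution_sesquilinear_deriv[OF sol sol, of t] show ?thesis by simp
  qed
  then obtain c where "\<And>t. pairing (p t) (\<lambda>x. cnj (p t x)) = c"
    using has_vector_derivative_zero_constant[OF convex_UNIV, of "\<lambda>t. pairing (p t) (\<lambda>x. cnj (p t x))"]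
      by auto
  then have "complex_of_real ((l2norm (p t))\<^sup>2) = of_real ((l2norm (p s))\<^sup>2)"
    by (metis pairing_self_cnj)
  then have "(l2norm (p t))\<^sup>2 = (l2norm (p s))\<^sup>2" by (simp only: of_real_eq_iff)
  then show ?thesis by (simp add: power2_eq_iff_nonneg)
qed

subsection \<open>Local smoothing of the trace at the origin\<close>

definition refl_sum :: "(real \<Rightarrow> complex) \<Rightarrow> real \<Rightarrow> complex"
  where "refl_sum v x = v x + v (- x)"

text \<open>With \<open>m(x) = (1 - |x|)\<^sup>2\<close>, the operator \<open>comm_op\<close> below has on \<open>[-1,1]\<close> the antisymmetric kernel
  \<open>k(x,y) = m(x)\<close> for \<open>|y| < |x|\<close> and \<open>- m(y)\<close> for \<open>|x| < |y|\<close>: a cut-off of \<open>sgn (|x| - |y|)\<close>, a fundamental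
  solution of \<open>\<partial>\<^sub>x\<^sup>2 - \<partial>\<^sub>y\<^sup>2\<close>. \<open>comm_dens\<close> is the derivative of \<open>comm_op\<close>.\<close>

definition half_prim :: "(real \<Rightarrow> complex) \<Rightarrow> real \<Rightarrow> complex"
  where "half_prim v y = (LINT z:{0..y}|lborel. refl_sum v z)"

definition half_dens :: "(real \<Rightarrow> complex) \<Rightarrow> real \<Rightarrow> complex"
  where "half_dens v y = of_real (-2 * (1 - y)) * half_prim v y + of_real (2 * (1 - y)\<^sup>2) * refl_sum v y"

definition comm_dens :: "(real \<Rightarrow> complex) \<Rightarrow> real \<Rightarrow> complex"
  where "comm_dens v x = (if \<bar>x\<bar> \<le> 1 then of_real (sgn x) * half_dens v \<bar>x\<bar> else 0)"

definition comm_op :: "(real \<Rightarrow> complex) \<Rightarrow> real \<Rightarrow> complex"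
  where "comm_op v = cut_primitive 1 (comm_dens v)"

section \<open>Reflection and the properties of the commutator operator\<close>

lemma L2_reflect:
  assumes "v \<in> L2"
  shows "(\<lambda>x. v (- x)) \<in> L2" "l2norm (\<lambda>x. v (- x)) = l2norm v"
proof -
  have "(\<lambda>x. v (- x)) \<in> borel_measurable lborel"
    using measurable_compose[OF _ L2_measurable[OF assms], of uminus lborel] by simp
  moreover have "integrable lborel (\<lambda>x. (norm (v (- x)))\<^sup>2)"
    using lborel_integrable_real_affine_iff[of "-1" "\<lambda>x. (norm (v x))\<^sup>2" 0] L2_integrable_norm[OF assms]
      by simp
  ultimately show "(\<lambda>x. v (- x)) \<in> L2" by (simp add: L2_def)
  show "l2norm (\<lambda>x. v (- x)) = l2norm v"
    unfolding l2norm_def using lborel_integral_real_affine[of "-1" "\<lambda>x. (norm (v x))\<^sup>2" 0] by simp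
qed

lemma set_integral_reflect:
  fixes h :: "real \<Rightarrow> complex"
  shows "(LINT x:{a..b}|lborel. h (- x)) = (LINT x:{-b..-a}|lborel. h x)"
proof -
  have "(LINT x:{-b..-a}|lborel. h x) = (LINT x|lborel. indicator {-b..-a} (- x) *\<^sub>R h (- x))"
    unfolding set_lebesgue_integral_def
    using lborel_integral_real_affine[of "-1" "\<lambda>x. indicator {-b..-a} x *\<^sub>R h x" 0] by simp
  also have "\<dots> = (LINT x:{a..b}|lborel. h (- x))"
    unfolding set_lebesgue_integral_def
    by (rule Bochner_Integration.integral_cong) (auto simp: indicator_def)
  finally show ?thesis by simp
qed

lemma set_integrable_reflect:
  fixes h :: "real \<Rightarrow> complex"
  assumes "set_integrable lborel {-b..-a} h"
  shows "set_integrable lborel {a..b} (\<lambda>x. h (- x))"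
proof -
  have "integrable lborel (\<lambda>x. indicator {-b..-a} (- x) *\<^sub>R h (- x))"
    using lborel_integrable_real_affine_iff[of "-1" "\<lambda>x. indicator {-b..-a} x *\<^sub>R h x" 0] assms
    by (simp add: set_integrable_def)
  moreover have "(\<lambda>x. indicator {-b..-a} (- x) *\<^sub>R h (- x)) = (\<lambda>x. indicator {a..b} x *\<^sub>R h (- x))"
    by (auto simp: fun_eq_iff indicator_def)
  ultimately show ?thesis by (simp add: set_integrable_def)
qed

lemma integral_split_reflect:
  fixes h :: "real \<Rightarrow> complex"
  assumes h: "set_integrable lborel {-1..1} h"
  shows "(LINT x:{-1..1}|lborel. h x) = (LINT x:{0..1}|lborel. h x + h (- x))"
proof -
  have i: "set_integrable lborel {0..1} h" "set_integrable lborel {-1..-0} h"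
    by (rule set_integrable_subset[OF h]; auto)+
  have "(LINT x:{-1..1}|lborel. h x) = (LINT x:{-1..0}|lborel. h x) + (LINT x:{0..1}|lborel. h x)"
    by (rule set_integral_combine[OF h]) auto
  also have "(LINT x:{-1..0}|lborel. h x) = (LINT x:{0..1}|lborel. h (- x))"
    using set_integral_reflect[of 0 1 h] by simp
  finally show ?thesis using i(1) set_integrable_reflect[OF i(2)] by simp
qed

lemma set_integral_Re:
  "set_integrable lborel A f \<Longrightarrow> (LINT x:A|lborel. Re (f x)) = Re (LINT x:A|lborel. f x)"
  unfolding set_integrable_def set_lebesgue_integral_def
  using Bochner_Integration.integral_Re by fastforce

lemma refl_sum_L2: "v \<in> L2 \<Longrightarrow> refl_sum v \<in> L2"
  unfolding refl_sum_def[abs_def] by (intro L2_add L2_reflect)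

lemma refl_sum_bound: "v \<in> L2 \<Longrightarrow> l2norm (refl_sum v) \<le> 2 * l2norm v"
  using l2norm_triangle[OF _ L2_reflect(1), of v v] L2_reflect(2)[of v] by (simp add: refl_sum_def[abs_def])

lemma h1_pair_reflect:
  assumes "h1_pair v g"
  shows "h1_pair (\<lambda>x. v (- x)) (\<lambda>x. - g (- x))"
proof -
  note L = h1_pair_L2[OF assms]
  have "v (- b) - v (- a) = (LINT x:{a..b}|lborel. - g (- x))" if "a \<le> b" for a b
  proof -
    have "v (- a) - v (- b) = (LINT x:{-b..-a}|lborel. g x)" using assms that by (simp add: h1_pair_def)
    also have "\<dots> = (LINT x:{a..b}|lborel. g (- x))" by (rule set_integral_reflect[symmetric])
    finally have "- (v (- a) - v (- b)) = - (LINT x:{a..b}|lborel. g (- x))" by simp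
    then show ?thesis
      unfolding set_integral_uminus[OF L2_set_integrable[OF L2_reflect(1)[OF L(2)]]] by simp
  qed
  then show ?thesis using L2_reflect(1)[OF L(1)] L2_cmult[OF L2_reflect(1)[OF L(2)], of "-1"]
    by (simp add: h1_pair_def)
qed

lemma ac_on_refl_sum:
  "h1_pair v g \<Longrightarrow> ac_on a b (refl_sum v) (\<lambda>x. g x - g (- x))"
  using h1_pair_ac_on[OF h1_pair_add[OF _ h1_pair_reflect], of v g v g a b]
    by (simp add: refl_sum_def[abs_def])

lemma half_prim_0: "half_prim v 0 = 0"
proof -
  have "half_prim v 0 = (LINT z|lborel. indicator {0::real} z *\<^sub>R refl_sum v 0)"
    unfolding half_prim_def set_lebesgue_integral_def
      by (rule Bochner_Integration.integral_cong) (auto simp: indicator_def)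
  then show ?thesis by simp
qed

lemma ac_on_half_prim:
  assumes "v \<in> L2"
  shows "ac_on 0 1 (half_prim v) (refl_sum v)"
  by (rule ac_onI[OF L2_set_integrable[OF refl_sum_L2[OF assms]]], subst half_prim_0, simp add: half_prim_def)

lemma half_prim_bound:
  assumes "v \<in> L2" "0 \<le> y" "y \<le> 1"
  shows "norm (half_prim v y) \<le> l2norm (refl_sum v)"
proof -
  have "norm (half_prim v y) \<le> sqrt (y - 0) * l2norm (refl_sum v)"
    unfolding half_prim_def by (rule L2_set_integral_bound[OF refl_sum_L2[OF assms(1)] assms(2)])
  also have "\<dots> \<le> 1 * l2norm (refl_sum v)" using assms by (intro mult_right_mono) auto
  finally show ?thesis by simp
qed

text \<open>Neither term of \<open>half_dens\<close> involves a derivative of v. The constant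
  collects the bound 2 on both coefficients, the rounding of sqrt 2 to 2 for the primitive spread
  over [-1,1], and the factor 2 for \<open>refl_sum\<close>: (2 * 2 + 2) * 2 = 12.\<close>

lemma comm_dens_L2:
  assumes v: "v \<in> L2"
  shows "comm_dens v \<in> L2" "l2norm (comm_dens v) \<le> 12 * l2norm v"
proof -
  let ?e = "refl_sum v"
  define A where "A x = indicator {-1..1} x *\<^sub>R half_prim v \<bar>x\<bar>" for x :: real
  define c1 where "c1 x = complex_of_real (indicator {-1..1} x * sgn x * (-2 * (1 - \<bar>x\<bar>)))" for x :: real
  define c2 where "c2 x = complex_of_real (indicator {-1..1} x * sgn x * (2 * (1 - \<bar>x\<bar>)\<^sup>2))" for x :: real
  have "continuous_on {-1..1} (\<lambda>x. half_prim v \<bar>x\<bar>)"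
    by (rule continuous_on_compose2[OF ac_on_continuous[OF ac_on_half_prim[OF v]]])
        (auto intro!: continuous_intros)
  from borel_measurable_continuous_on_indicator[OF _ this]
  have mA: "A \<in> borel_measurable lborel" by (simp add: A_def[abs_def])
  have I: "(indicator {-1..1} :: real \<Rightarrow> complex) \<in> L2" by (rule L2_indicator) auto
  have Ab: "norm (A x) \<le> l2norm ?e * norm (indicator {-1..1} x :: complex)" for x
    using half_prim_bound[OF v, of "\<bar>x\<bar>"] by (auto simp: A_def indicator_def)
  note AL = L2_dominated[OF mA I Ab]
  have mc: "c1 \<in> borel_measurable lborel" "c2 \<in> borel_measurable lborel"
    unfolding c1_def[abs_def] c2_def[abs_def] by measurable
  have b1: "norm (c1 x) \<le> 2" for x
    unfolding c1_def norm_of_real by (auto simp: indicator_def abs_mult sgn_if)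
  have b2: "norm (c2 x) \<le> 2" for x
  proof (cases "\<bar>x\<bar> \<le> 1")
    case True
    have "(1 - \<bar>x\<bar>)\<^sup>2 \<le> 1" using True by (simp add: power_le_one)
    then show ?thesis unfolding c2_def norm_of_real by (auto simp: indicator_def abs_mult sgn_if)
  next
    case False
    then show ?thesis by (auto simp: c2_def indicator_def)
  qed
  have eq: "comm_dens v = (\<lambda>x. c1 x * A x + c2 x * ?e x)"
  proof
    fix x
    have "?e \<bar>x\<bar> = ?e x" by (simp add: refl_sum_def abs_if)
    then show "comm_dens v x = c1 x * A x + c2 x * ?e x"
      by (auto simp: comm_dens_def c1_def c2_def A_def half_dens_def indicator_def abs_le_iff algebra_simps)
  qed
  note L1 = L2_mult_bounded[OF mc(1) AL(1) b1] and L2' = L2_mult_bounded[OF mc(2) refl_sum_L2[OF v] b2]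
  show "comm_dens v \<in> L2" unfolding eq by (intro L2_add L1 L2')
  have "l2norm (comm_dens v) \<le> 2 * l2norm A + 2 * l2norm ?e"
    unfolding eq using l2norm_triangle[OF L1(1) L2'(1)] L1(2) L2'(2) by linarith
  also have "l2norm A \<le> l2norm ?e * sqrt 2" using AL(2) l2norm_indicator[of "-1" 1] by simp
  also have "l2norm ?e * sqrt 2 \<le> l2norm ?e * 2"
    by (intro mult_left_mono real_le_lsqrt) (auto simp: sqrt2_less_2 less_imp_le)
  finally show "l2norm (comm_dens v) \<le> 12 * l2norm v" using refl_sum_bound[OF v] by linarith
qed

lemma comm_dens_odd: "comm_dens v (- x) = - comm_dens v x"
  by (simp add: comm_dens_def sgn_minus)

lemma comm_dens_supp: "v \<in> L2 \<Longrightarrow> comm_dens v \<in> L2_supp 1"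
  using comm_dens_L2(1) by (auto simp: L2_supp_def comm_dens_def abs_le_iff)

lemma comm_dens_integral:
  assumes "v \<in> L2" shows "(LINT x:{-1..1}|lborel. comm_dens v x) = 0"
  using integral_split_reflect[OF L2_set_integrable[OF comm_dens_L2(1)[OF assms]]]
    by (simp add: comm_dens_odd)

text \<open>The density is odd, so its total integral vanishes and with it the smooth correction in
  \<open>cut_primitive\<close>.\<close>

lemma comm_op_eq: "v \<in> L2 \<Longrightarrow> comm_op v x = (LINT y:{-1..x}|lborel. comm_dens v y)"
  by (simp add: comm_op_def cut_primitive_def comm_dens_integral)

lemma h1_pair_comm_op: "v \<in> L2 \<Longrightarrow> h1_pair (comm_op v) (comm_dens v)"
  using h1_pair_cut[OF comm_dens_supp, of v] comm_dens_integral[of v]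
  by (simp add: comm_op_def cut_density_def[abs_def])

lemma comm_op_even:
  assumes v: "v \<in> L2" shows "comm_op v (- x) = comm_op v x"
proof -
  note i = L2_set_integrable[OF comm_dens_L2(1)[OF v]]
  have *: "comm_op v (- x) = comm_op v x" if x: "-1 \<le> x" "x \<le> 1" for x
  proof -
    have "comm_op v (- x) = (LINT y:{x..1}|lborel. comm_dens v (- y))"
      unfolding comm_op_eq[OF v] using set_integral_reflect[of x 1] by simp
    also have "\<dots> = - (LINT y:{x..1}|lborel. comm_dens v y)"
      by (simp add: comm_dens_odd set_integral_uminus[OF i])
    also have "\<dots> = comm_op v x"
      unfolding comm_op_eq[OF v] using set_integral_combine[OF i x] comm_dens_integral[OF v]
        by (simp add: neg_eq_iff_add_eq_0 add.commute)
    finally show ?thesis .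
  qed
  have 0: "comm_op v x = 0" if "\<bar>x\<bar> > 1" for x
  proof (cases "x \<ge> 0")
    case True
    have "(LINT y:{-1..x}|lborel. comm_dens v y) = (LINT y:{-1..1}|lborel. comm_dens v y)"
      unfolding set_lebesgue_integral_def
      by (rule Bochner_Integration.integral_cong) (use that True in \<open>auto simp: comm_dens_def indicator_def\<close>)
    then show ?thesis by (simp add: comm_op_eq[OF v] comm_dens_integral[OF v])
  next
    case False
    then show ?thesis using that by (simp add: comm_op_eq[OF v] set_lebesgue_integral_def)
  qed
  show ?thesis
  proof (cases "\<bar>x\<bar> > 1")
    case True then show ?thesis using 0[of x] 0[of "- x"] by simp
  next
    case False then show ?thesis by (intro *) auto
  qed
qed

lemma comm_op_eq_0:
  assumes v: "v \<in> L2" and x: "x \<notin> {-1<..<1}"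
  shows "comm_op v x = 0"
proof -
  have 0: "comm_op v x = 0" if "x \<ge> 1" for x
  proof -
    have "(LINT y:{-1..x}|lborel. comm_dens v y) = (LINT y:{-1..1}|lborel. comm_dens v y)"
      unfolding set_lebesgue_integral_def
      by (rule Bochner_Integration.integral_cong) (use that in \<open>auto simp: comm_dens_def indicator_def\<close>)
    then show ?thesis by (simp add: comm_op_eq[OF v] comm_dens_integral[OF v])
  qed
  show ?thesis
  proof (cases "x \<ge> 1")
    case True then show ?thesis by (rule 0)
  next
    case False
    then have "- x \<ge> 1" using x by auto
    then show ?thesis using 0[of "- x"] comm_op_even[OF v, of x] by simp
  qed
qed

lemma ac_on_comm_op:
  assumes v: "v \<in> L2"
  shows "ac_on 0 1 (comm_op v) (half_dens v)"
proof -
  note i = L2_set_integrable[OF comm_dens_L2(1)[OF v]]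
  have z: "integrable lborel (\<lambda>y. indicator {0::real} y *\<^sub>R half_dens v 0)" by simp
  \<comment> \<open>On [0,1] the two densities differ only at 0, where \<open>sgn\<close> is 0; the
    discrepancy is a multiple of the indicator of a point.\<close>
  have eq: "(\<lambda>y. indicator {0..x} y *\<^sub>R half_dens v y) =
      (\<lambda>y. indicator {0..x} y *\<^sub>R comm_dens v y + indicator {0} y *\<^sub>R half_dens v 0)" if "x \<in> {0..1}" for x
    using that by (auto simp: fun_eq_iff indicator_def comm_dens_def sgn_if)
  have "set_integrable lborel {0..1} (half_dens v)"
    unfolding set_integrable_def eq[of 1, simplified]
    using Bochner_Integration.integrable_add[OF i[of 0 1, unfolded set_integrable_def] z] by simp
  moreover have "comm_op v x = comm_op v 0 + (LINT y:{0..x}|lborel. half_dens v y)" if x: "x \<in> {0..1}" for x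
  proof -
    have "(LINT y:{0..x}|lborel. half_dens v y) = (LINT y:{0..x}|lborel. comm_dens v y)"
      unfolding set_lebesgue_integral_def eq[OF x]
      using Bochner_Integration.integral_add[OF i[of 0 x, unfolded set_integrable_def] z] by simp
    then show ?thesis
      using ac_on_eq[OF h1_pair_ac_on[OF h1_pair_comm_op[OF v], of 0 1] x] by simp
  qed
  ultimately show ?thesis by (rule ac_onI)
qed

lemma pairing_supp:
  assumes "g \<in> L2" "k \<in> L2" "\<And>x. x \<notin> {-1..1} \<Longrightarrow> k x = 0"
  shows "pairing g k = (LINT x:{0..1}|lborel. g x * k x + g (- x) * k (- x))"
proof -
  have "pairing g k = (LINT x:{-1..1}|lborel. g x * k x)"
    unfolding pairing_def set_lebesgue_integral_def
    by (rule Bochner_Integration.integral_cong) (use assms(3) in \<open>auto simp: indicator_def\<close>)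
  also have "\<dots> = (LINT x:{0..1}|lborel. g x * k x + g (- x) * k (- x))"
  proof (rule integral_split_reflect)
    show "set_integrable lborel {-1..1} (\<lambda>x. g x * k x)"
      unfolding set_integrable_def using L2_integrable_mult[OF assms(1,2)]
      by (rule integrable_mult_indicator[rotated]) simp
  qed
  finally show ?thesis .
qed

lemma pairing_comm_op:
  assumes "g \<in> L2" "v \<in> L2"
  shows "pairing g (\<lambda>x. cnj (comm_op v x)) = (LINT x:{0..1}|lborel. refl_sum g x * cnj (comm_op v x))"
proof -
  have "pairing g (\<lambda>x. cnj (comm_op v x))
      = (LINT x:{0..1}|lborel. g x * cnj (comm_op v x) + g (- x) * cnj (comm_op v (- x)))"
    using comm_op_eq_0[OF assms(2)] by (intro pairing_supp assms L2_cnj h1_pair_L2[OF h1_pair_comm_op]) auto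
  then show ?thesis by (simp add: comm_op_even[OF assms(2)] refl_sum_def distrib_right)
qed

text \<open>Oddness of the density selects g(x) - g(-x), which is the derivative of
  \<open>refl_sum v\<close> when g is the derivative of v.\<close>

lemma pairing_comm_dens:
  assumes "g \<in> L2" "v \<in> L2"
  shows "pairing g (\<lambda>x. cnj (comm_dens v x)) = (LINT x:{0..1}|lborel. (g x - g (- x)) * cnj (half_dens v x))"
proof -
  have "pairing g (\<lambda>x. cnj (comm_dens v x))
      = (LINT x:{0..1}|lborel. g x * cnj (comm_dens v x) + g (- x) * cnj (comm_dens v (- x)))"
    by (intro pairing_supp assms L2_cnj comm_dens_L2) (auto simp: comm_dens_def)
  also have "\<dots> = (LINT x:{0..1}|lborel. (g x - g (- x)) * cnj (half_dens v x))"
    unfolding set_lebesgue_integral_def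
  proof (rule Bochner_Integration.integral_cong)
    fix x :: real
    show "indicator {0..1} x *\<^sub>R (g x * cnj (comm_dens v x) + g (- x) * cnj (comm_dens v (- x))) =
        indicator {0..1} x *\<^sub>R ((g x - g (- x)) * cnj (half_dens v x))"
    proof (cases "x = 0")
      case False
      then show ?thesis unfolding comm_dens_odd by (simp add: comm_dens_def indicator_def algebra_simps)
    qed (simp add: comm_dens_def)
  qed simp
  finally show ?thesis .
qed

lemma ac_on_weight:
  "ac_on a b (\<lambda>y. complex_of_real ((1 - y)\<^sup>2)) (\<lambda>y. of_real (-2 * (1 - y)))"
  "ac_on a b (\<lambda>y. complex_of_real (-2 * (1 - y))) (\<lambda>y. of_real 2)"
proof -
  show "ac_on a b (\<lambda>y. complex_of_real ((1 - y)\<^sup>2)) (\<lambda>y. of_real (-2 * (1 - y)))"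
    by (intro ac_on_C1 has_vector_derivative_of_real continuous_intros)
      (auto intro!: derivative_eq_intros)
  show "ac_on a b (\<lambda>y. complex_of_real (-2 * (1 - y))) (\<lambda>y. of_real 2)"
    by (intro ac_on_C1 has_vector_derivative_of_real continuous_intros)
      (auto intro!: derivative_eq_intros)
qed

text \<open>After one integration by parts both pairings are integrals of a half-line primitive N
  against a density m' N + 2 m N'. Their symmetrised sum is twice the total derivative of m
  \<open>half_prim v\<close> cnj (\<open>half_prim w\<close>), whose boundary terms vanish since
  N(0) = 0 and m(1) = 0.\<close>

lemma comm_op_antisymmetric:
  assumes v: "v \<in> L2" and w: "w \<in> L2"
  shows "pairing v (\<lambda>x. cnj (comm_op w x)) = - cnj (pairing w (\<lambda>x. cnj (comm_op v x)))"
proof -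
  let ?m = "\<lambda>y. complex_of_real ((1 - y)\<^sup>2)" and ?m' = "\<lambda>y. complex_of_real (-2 * (1 - y))"
  \<comment> \<open>The primitive of v vanishes at 0 and the image of w vanishes at 1, so this
    integration by parts has no boundary terms.\<close>
  have half: "pairing v (\<lambda>x. cnj (comm_op w x))
      = - (LINT y:{0..1}|lborel. half_prim v y * cnj (half_dens w y))"
    "set_integrable lborel {0..1} (\<lambda>y. half_prim v y * cnj (half_dens w y))"
    if v: "v \<in> L2" and w: "w \<in> L2" for v w
  proof -
    have a: "ac_on 0 1 (\<lambda>y. cnj (comm_op w y)) (\<lambda>y. cnj (half_dens w y))"
      by (rule ac_on_cnj[OF ac_on_comm_op[OF w]])
    note n = ac_on_half_prim[OF v]
    have i1: "set_integrable lborel {0..1} (\<lambda>y. refl_sum v y * cnj (comm_op w y))"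
      using set_integrable_continuous_mult[OF ac_on_continuous[OF a] ac_on_integrable[OF n]]
        by (simp add: mult.commute)
    show i2: "set_integrable lborel {0..1} (\<lambda>y. half_prim v y * cnj (half_dens w y))"
      by (rule set_integrable_continuous_mult[OF ac_on_continuous[OF n] ac_on_integrable[OF a]])
    have "(LINT y:{0..1}|lborel. refl_sum v y * cnj (comm_op w y) + half_prim v y * cnj (half_dens w y)) = 0"
      using ac_on_diff[OF ac_on_mult[OF n a], of 0 1] comm_op_eq_0[OF w, of 1] half_prim_0[of v] by simp
    then show "pairing v (\<lambda>x. cnj (comm_op w x))
        = - (LINT y:{0..1}|lborel. half_prim v y * cnj (half_dens w y))"
      using i1 i2 by (simp add: pairing_comm_op[OF v w] eq_neg_iff_add_eq_0)
  qed
  let ?h = "\<lambda>v w y. half_prim v y * cnj (half_dens w y)"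
  have a: "ac_on 0 1 (\<lambda>y. ?m y * (half_prim v y * cnj (half_prim w y)))
      (\<lambda>y. ?m' y * (half_prim v y * cnj (half_prim w y)) + ?m y *
          (refl_sum v y * cnj (half_prim w y) + half_prim v y * cnj (refl_sum w y)))"
    by (intro ac_on_mult ac_on_weight ac_on_half_prim ac_on_cnj v w)
  have "(LINT y:{0..1}|lborel. ?h v w y + cnj (?h w v y))
      = (LINT y:{0..1}|lborel. 2 * (?m' y * (half_prim v y * cnj (half_prim w y)) +
      ?m y * (refl_sum v y * cnj (half_prim w y) + half_prim v y * cnj (refl_sum w y))))"
    by (rule set_lebesgue_integral_cong) (auto simp: half_dens_def algebra_simps)
  also have "\<dots> = 2 * (LINT y:{0..1}|lborel. ?m' y * (half_prim v y * cnj (half_prim w y)) +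
      ?m y * (refl_sum v y * cnj (half_prim w y) + half_prim v y * cnj (refl_sum w y)))"
    by (rule set_integral_mult_right)
  also have "\<dots> = 0"
    using ac_on_diff[OF a, of 0 1] by (simp add: half_prim_0)
  finally have "(LINT y:{0..1}|lborel. ?h v w y) + cnj (LINT y:{0..1}|lborel. ?h w v y) = 0"
    using half(2)[OF v w] set_integrable_cnj[OF half(2)[OF w v]] by (simp add: set_integral_cnj[symmetric])
  then show ?thesis
    unfolding half(1)[OF v w] half(1)[OF w v] by (simp add: add_eq_0_iff)
qed

text \<open>The commutator of \<open>comm_op\<close> with \<open>\<partial>\<^sub>x\<^sup>2\<close> is a positive multiple of \<open>\<delta>\<otimes>\<delta>\<close> up to a form bounded in \<open>L\<^sup>2\<close>.\<close>

lemma comm_op_commutator: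
  assumes pair: "h1_pair v g"
  shows "4 * (norm (v 0))\<^sup>2 \<le> - Re (pairing g (\<lambda>x. cnj (comm_dens v x))) + 24 * (l2norm v)\<^sup>2"
proof -
  let ?m = "\<lambda>y. complex_of_real ((1 - y)\<^sup>2)" and ?m' = "\<lambda>y. complex_of_real (-2 * (1 - y))"
  let ?e = "refl_sum v" and ?e' = "\<lambda>x. g x - g (- x)" and ?N = "half_prim v"
  note v = h1_pair_L2(1)[OF pair] and g = h1_pair_L2(2)[OF pair]
  note e = ac_on_refl_sum[OF pair, of 0 1] and N = ac_on_half_prim[OF v]
  note eL = refl_sum_L2[OF v]
  \<comment> \<open>f1 is the derivative of m |e|^2 and produces the boundary value at 0; f2 is the
    derivative of m' e cnj N and removes the remaining e'. The double zero of m at 1 is needed here: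
    m(1) = 0 and m'(1) = 0 kill the values of e at 1, which L2 could not control.\<close>
  define f1 where "f1 y = ?m' y * (?e y * cnj (?e y))
      + ?m y * (?e' y * cnj (?e y) + ?e y * cnj (?e' y))" for y
  define f2 where "f2 y = of_real 2 * (?e y * cnj (?N y))
      + ?m' y * (?e' y * cnj (?N y) + ?e y * cnj (?e y))" for y
  \<comment> \<open>What the two total derivatives leave over; it contains e and N but no e', hence
    is bounded by the L2 norm of v.\<close>
  define r where "r y = ?e y * (2 * cnj (?N y) + 2 * ?m' y * cnj (?e y))" for y
  have a1: "ac_on 0 1 (\<lambda>y. ?m y * (?e y * cnj (?e y))) f1"
    unfolding f1_def[abs_def] by (intro ac_on_mult ac_on_weight ac_on_cnj e)
  have a2: "ac_on 0 1 (\<lambda>y. ?m' y * (?e y * cnj (?N y))) f2"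
    unfolding f2_def[abs_def] by (intro ac_on_mult ac_on_weight ac_on_cnj e N)
  have I1: "(LINT y:{0..1}|lborel. f1 y) = - (?e 0 * cnj (?e 0))"
    using ac_on_diff[OF a1, of 0 1] by simp
  have I2: "(LINT y:{0..1}|lborel. f2 y) = 0"
    using ac_on_diff[OF a2, of 0 1] by (simp add: half_prim_0)
  note i1 = ac_on_integrable[OF a1] and i2 = ac_on_integrable[OF a2]
  have cc: "continuous_on {0..1} (\<lambda>y. 2 * cnj (?N y) + 2 * ?m' y * cnj (?e y))"
    by (intro continuous_intros ac_on_continuous[OF e] ac_on_continuous[OF N])
  have ir: "set_integrable lborel {0..1} r"
    using set_integrable_continuous_mult[OF cc L2_set_integrable[OF eL]]
      by (simp add: r_def[abs_def] mult.commute)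
  have hd: "continuous_on {0..1} (\<lambda>y. cnj (half_dens v y))"
    unfolding half_dens_def by (intro continuous_intros ac_on_continuous[OF e] ac_on_continuous[OF N])
  have ih: "set_integrable lborel {0..1} (\<lambda>y. ?e' y * cnj (half_dens v y))"
    using set_integrable_continuous_mult[OF hd ac_on_integrable[OF e]] by (simp add: mult.commute)
  have "Re (pairing g (\<lambda>x. cnj (comm_dens v x))) = Re (LINT y:{0..1}|lborel. ?e' y * cnj (half_dens v y))"
    by (simp add: pairing_comm_dens[OF g v])
  also have "\<dots> = (LINT y:{0..1}|lborel. Re (?e' y * cnj (half_dens v y)))"
    by (rule set_integral_Re[OF ih, symmetric])
  also have "\<dots> = (LINT y:{0..1}|lborel. Re (f1 y + f2 y - r y))"
    by (rule set_lebesgue_integral_cong) (auto simp: f1_def f2_def r_def half_dens_def algebra_simps)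
  also have "\<dots> = Re (LINT y:{0..1}|lborel. f1 y + f2 y - r y)"
    by (intro set_integral_Re set_integral_diff set_integral_add i1 i2 ir)
  also have "(LINT y:{0..1}|lborel. f1 y + f2 y - r y) = - (?e 0 * cnj (?e 0)) - (LINT y:{0..1}|lborel. r y)"
    using i1 i2 ir by (simp add: I1 I2)
  finally have *: "Re (pairing g (\<lambda>x. cnj (comm_dens v x)))
      = Re (- (?e 0 * cnj (?e 0)) - (LINT y:{0..1}|lborel. r y))" .
  have "Re (pairing g (\<lambda>x. cnj (comm_dens v x))) = - 4 * (norm (v 0))\<^sup>2 - Re (LINT y:{0..1}|lborel. r y)"
  proof -
    \<comment> \<open>The reflected sum doubles the value at the origin, hence the factor 4.\<close>
    have "Re (?e 0 * cnj (?e 0)) = 4 * (norm (v 0))\<^sup>2"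
      unfolding cmod_power2 refl_sum_def by (simp add: power2_eq_square algebra_simps)
    then show ?thesis using * by simp
  qed
  moreover have "norm (LINT y:{0..1}|lborel. r y) \<le> 24 * (l2norm v)\<^sup>2"
  proof -
    define k1 where "k1 y = indicator {0..1} y *\<^sub>R (2 * cnj (?N y))" for y
    define k2 where "k2 y = complex_of_real (indicator {0..1} y * (-4 * (1 - y))) * cnj (?e y)" for y
    have m1: "k1 \<in> borel_measurable lborel"
      unfolding k1_def[abs_def] using borel_measurable_continuous_on_indicator[of "{0..1}"
          "\<lambda>y. 2 * cnj (?N y)"]
      by (simp add: continuous_intros ac_on_continuous[OF N])
    have I: "(indicator {0..1} :: real \<Rightarrow> complex) \<in> L2" by (rule L2_indicator) auto
    have "norm (k1 y) \<le> (2 * l2norm ?e) * norm (indicator {0..1} y :: complex)" for y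
      using half_prim_bound[OF v, of y] by (auto simp: k1_def indicator_def norm_mult)
    note k1 = L2_dominated[OF m1 I this]
    have m2: "(\<lambda>y. complex_of_real (indicator {0..1} y * (-4 * (1 - y)))) \<in> borel_measurable lborel"
      by measurable
    have b2: "norm (complex_of_real (indicator {0..1} y * (-4 * (1 - y)))) \<le> 4" for y :: real
      unfolding norm_of_real by (auto simp: indicator_def)
    note k2 = L2_mult_bounded[OF m2 L2_cnj[OF eL] b2, folded k2_def]
    have "(LINT y:{0..1}|lborel. r y) = (LINT y|lborel. ?e y * k1 y + ?e y * k2 y)"
      unfolding set_lebesgue_integral_def
      by (rule Bochner_Integration.integral_cong) (auto simp: r_def k1_def k2_def indicator_def algebra_simps)
    also have "\<dots> = pairing ?e k1 + pairing ?e k2"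
      unfolding pairing_def by (intro Bochner_Integration.integral_add L2_integrable_mult eL k1 k2)
    also have "norm \<dots> \<le> l2norm ?e * l2norm k1 + l2norm ?e * l2norm k2"
      by (intro norm_triangle_mono pairing_bound eL k1 k2)
    \<comment> \<open>The two parts of r contribute 2 + 4 = 6, and \<open>refl_sum\<close> at most
      doubles the norm, which gives 6 * 4 = 24.\<close>
    also have "\<dots> \<le> l2norm ?e * (2 * l2norm ?e) + l2norm ?e * (4 * l2norm ?e)"
      using k1(2) k2(2) l2norm_indicator[of 0 1]
      by (intro add_mono mult_left_mono) (auto simp: l2norm_cnj)
    also have "\<dots> = 6 * (l2norm ?e)\<^sup>2" by (simp add: power2_eq_square)
    also have "\<dots> \<le> 6 * (2 * l2norm v)\<^sup>2" by (intro mult_left_mono power_mono refl_sum_bound v) auto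
    finally show ?thesis by (simp add: power_mult_distrib)
  qed
  ultimately show ?thesis using abs_Re_le_cmod[of "LINT y:{0..1}|lborel. r y"] by linarith
qed

lemma comm_op_bound:
  obtains C where "C \<ge> 0" "\<And>v. v \<in> L2 \<Longrightarrow> l2norm (comm_op v) \<le> C * l2norm v"
    "\<And>v. v \<in> L2 \<Longrightarrow> norm (comm_op v 0) \<le> C * l2norm v"
proof -
  obtain B where B: "\<And>k. k \<in> L2_supp 1 \<Longrightarrow> l2norm (cut_primitive 1 k) \<le> B * l2norm k \<and>
      l2norm (cut_density 1 k) \<le> B * l2norm k \<and> norm (cut_primitive 1 k 0) \<le> B * l2norm k"
    using cut_bounds[of 1] by (metis zero_less_one)
  have "B * l2norm (comm_dens v) \<le> (12 * \<bar>B\<bar>) * l2norm v" if "v \<in> L2" for v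
  proof -
    have "B * l2norm (comm_dens v) \<le> \<bar>B\<bar> * l2norm (comm_dens v)" by (intro mult_right_mono) auto
    also have "\<dots> \<le> \<bar>B\<bar> * (12 * l2norm v)" by (intro mult_left_mono comm_dens_L2 that) auto
    finally show ?thesis by simp
  qed
  note le = this
  show ?thesis
  proof (rule that[of "12 * \<bar>B\<bar>"])
    fix v :: "real \<Rightarrow> complex" assume v: "v \<in> L2"
    show "l2norm (comm_op v) \<le> 12 * \<bar>B\<bar> * l2norm v" "norm (comm_op v 0) \<le> 12 * \<bar>B\<bar> * l2norm v"
      using B[OF comm_dens_supp[OF v]] le[OF v] unfolding comm_op_def by linarith+
  qed simp
qed

lemma comm_diff:
  assumes v: "v \<in> L2" and w: "w \<in> L2"
  shows "comm_dens (\<lambda>x. v x - w x) = (\<lambda>x. comm_dens v x - comm_dens w x)"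
    and "comm_op (\<lambda>x. v x - w x) = (\<lambda>x. comm_op v x - comm_op w x)"
proof -
  have e: "refl_sum (\<lambda>x. v x - w x) = (\<lambda>x. refl_sum v x - refl_sum w x)"
    by (simp add: refl_sum_def fun_eq_iff)
  have N: "half_prim (\<lambda>x. v x - w x) y = half_prim v y - half_prim w y" for y
    unfolding half_prim_def e by (intro set_integral_diff L2_set_integrable refl_sum_L2 v w)
  show d: "comm_dens (\<lambda>x. v x - w x) = (\<lambda>x. comm_dens v x - comm_dens w x)"
    by (simp add: fun_eq_iff comm_dens_def half_dens_def N e algebra_simps)
  show "comm_op (\<lambda>x. v x - w x) = (\<lambda>x. comm_op v x - comm_op w x)"
    unfolding fun_eq_iff comm_op_eq[OF v] comm_op_eq[OF w] comm_op_eq[OF L2_diff[OF v w]] d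
    by (intro allI set_integral_diff L2_set_integrable comm_dens_L2 v w)
qed

section \<open>The commutator quantity along a solution\<close>

text \<open>The operator gains one derivative: continuity of w in L2 is enough for its image to be
  continuous in H1, hence to be an admissible moving test function.\<close>

lemma h1_curve_comm_op:
  assumes c: "h1_curve w H"
  shows "h1_curve (\<lambda>t. comm_op (w t)) (\<lambda>t. comm_dens (w t))"
  unfolding h1_curve_def
proof (intro conjI allI)
  fix t
  note L = h1_curveD(2)[OF c]
  show "h1_pair (comm_op (w t)) (comm_dens (w t))" by (rule h1_pair_comm_op[OF L])
  obtain C where C: "\<And>v. v \<in> L2 \<Longrightarrow> l2norm (comm_op v) \<le> C * l2norm v"
    using comm_op_bound by metis
  have lim: "((\<lambda>s. B * l2norm (\<lambda>x. w s x - w t x)) \<longlongrightarrow> 0) (at t)" for B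
    using tendsto_mult_left[OF h1_curveD(4)[OF c], of B] by simp
  show "((\<lambda>s. l2norm (\<lambda>x. comm_op (w s) x - comm_op (w t) x)) \<longlongrightarrow> 0) (at t)"
    by (rule Lim_null_comparison[OF _ lim[of C]])
        (use C[OF L2_diff[OF L L]] in \<open>simp add: comm_diff(2)[OF L L]\<close>)
  show "((\<lambda>s. l2norm (\<lambda>x. comm_dens (w s) x - comm_dens (w t) x)) \<longlongrightarrow> 0) (at t)"
    by (rule Lim_null_comparison[OF _ lim[of 12]])
        (use comm_dens_L2(2)[OF L2_diff[OF L L]] in \<open>simp add: comm_diff(1)[OF L L]\<close>)
qed

text \<open>By antisymmetry the pairing of w with the conjugate of its image is purely imaginary, so
  taking \<open>Im\<close> loses nothing. The same antisymmetry lets both increments in the product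
  rule fall on w, where the equation can be used.\<close>

lemma comm_op_deriv:
  assumes sol: "delta_solution w H q"
  defines "P \<equiv> \<lambda>t. pairing (H t) (\<lambda>x. cnj (comm_dens (w t) x)) - q t * cnj (comm_op (w t) 0)"
  shows "((\<lambda>t. Im (pairing (w t) (\<lambda>x. cnj (comm_op (w t) x)))) has_vector_derivative - 2 * Re (P t)) (at t)"
proof -
  note c = delta_solutionD(1)[OF sol]
  note L = h1_curveD(2)[OF c]
  note K = h1_curve_comm_op[OF c]
  note KL = h1_curveD(2)[OF K]
  have const: "h1_curve (\<lambda>s. comm_op (w t)) (\<lambda>s. comm_dens (w t))"
    using h1_curveD(1)[OF K] by (simp add: h1_curve_def l2norm_def)
  note 1 = delta_solution_quotient[OF sol h1_curve_cnj[OF K], of t]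
  note 2 = tendsto_cnj[OF delta_solution_quotient[OF sol h1_curve_cnj[OF const], of t]]
  have "pairing (w s) (\<lambda>x. cnj (comm_op (w s) x)) - pairing (w t) (\<lambda>x. cnj (comm_op (w t) x))
      = pairing (\<lambda>x. w s x - w t x) (\<lambda>x. cnj (comm_op (w s) x)) - cnj
          (pairing (\<lambda>x. w s x - w t x) (\<lambda>x. cnj (comm_op (w t) x)))" for s
  proof -
    have "- cnj (pairing (\<lambda>x. w s x - w t x) (\<lambda>x. cnj (comm_op (w t) x)))
        = pairing (w t) (\<lambda>x. cnj (comm_op (w s) x) - cnj (comm_op (w t) x))"
      using comm_op_antisymmetric[OF L[of t] L2_diff[OF L L], of s t] by (simp add: comm_diff(2)[OF L L])
    then show ?thesis using L KL by
        (simp add: pairing_diff_left pairing_diff_right L2_cnj diff_conv_add_uminus[of "pairing (w s) _ - _"])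
  qed
  then have "(\<lambda>s. (pairing (w s) (\<lambda>x. cnj (comm_op (w s) x))
      - pairing (w t) (\<lambda>x. cnj (comm_op (w t) x))) /\<^sub>R (s - t))
      = (\<lambda>s. pairing (\<lambda>x. w s x - w t x) (\<lambda>x. cnj (comm_op (w s) x)) /\<^sub>R (s - t)
          - cnj (pairing (\<lambda>x. w s x - w t x) (\<lambda>x. cnj (comm_op (w t) x)) /\<^sub>R (s - t)))"
    by (simp add: fun_eq_iff scaleR_diff_right complex_cnj_scaleR)
  moreover have "- \<i> * P t - cnj (- \<i> * P t) = \<i> * of_real (- 2 * Re (P t))"
    by (simp add: complex_eq_iff)
  ultimately have "((\<lambda>t. pairing (w t) (\<lambda>x. cnj (comm_op (w t) x)))
      has_vector_derivative \<i> * of_real (- 2 * Re (P t))) (at t)"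
    unfolding has_vector_derivative_iff_quotient using tendsto_diff[OF 1 2] by (simp add: P_def)
  from bounded_linear.has_vector_derivative[OF bounded_linear_Im this] show ?thesis by simp
qed

text \<open>The quantity \<open>M\<close> of size K E is differentiated and integrated over [a,b];
  its derivative contains the squared trace with a positive coefficient. What matters later is that
  the bound is linear in E, with a constant depending on no solution.\<close>

lemma trace_estimate:
  obtains C where "C > 0"
    "\<And>w H q a b E L. delta_solution w H q \<Longrightarrow> a \<le> b \<Longrightarrow> E \<ge> 0 \<Longrightarrow> L \<ge> 0 \<Longrightarrow>
      (\<And>t. t \<in> {a..b} \<Longrightarrow> (l2norm (w t))\<^sup>2 \<le> E) \<Longrightarrow>
      (\<And>t. t \<in> {a..b} \<Longrightarrow> norm (q t) \<le> L * norm (w t 0)) \<Longrightarrow>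
      integral {a..b} (\<lambda>t. (norm (w t 0))\<^sup>2) \<le> C * (1 + (b - a) * (1 + L\<^sup>2)) * E"
proof -
  obtain K where K: "K \<ge> 0" "\<And>v. v \<in> L2 \<Longrightarrow> l2norm (comm_op v) \<le> K * l2norm v"
    "\<And>v. v \<in> L2 \<Longrightarrow> norm (comm_op v 0) \<le> K * l2norm v"
    using comm_op_bound by metis
  define C where "C = 24 + K + K\<^sup>2"
  have "integral {a..b} (\<lambda>t. (norm (w t 0))\<^sup>2) \<le> C * (1 + (b - a) * (1 + L\<^sup>2)) * E"
    if sol: "delta_solution w H q" and ab: "a \<le> b" and E: "E \<ge> 0" and L: "L \<ge> 0"
      and wE: "\<And>t. t \<in> {a..b} \<Longrightarrow> (l2norm (w t))\<^sup>2 \<le> E"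
      and qL: "\<And>t. t \<in> {a..b} \<Longrightarrow> norm (q t) \<le> L * norm (w t 0)" for w H q a b E L
  proof -
    note c = delta_solutionD(1)[OF sol]
    note wL2 = h1_curveD(2)[OF c]
    define P where "P t = pairing (H t) (\<lambda>x. cnj (comm_dens (w t) x)) - q t * cnj (comm_op (w t) 0)" for t
    define M where "M t = Im (pairing (w t) (\<lambda>x. cnj (comm_op (w t) x)))" for t
    have hP: "((\<lambda>t. - 2 * Re (P t)) has_integral M b - M a) {a..b}"
      unfolding M_def P_def
      by (rule fundamental_theorem_of_calculus[OF ab
          has_vector_derivative_at_within[OF comm_op_deriv[OF sol]]])
    have Mb: "\<bar>M t\<bar> \<le> K * E" if "t \<in> {a..b}" for t
    proof -
      have "\<bar>M t\<bar> \<le> l2norm (w t) * l2norm (comm_op (w t))"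
        unfolding M_def
        using pairing_bound[OF wL2 L2_cnj[OF h1_pair_L2(1)[OF h1_pair_comm_op[OF wL2]]], of t t]
          abs_Im_le_cmod[of "pairing (w t) (\<lambda>x. cnj (comm_op (w t) x))"] by (simp add: l2norm_cnj)
      also have "\<dots> \<le> l2norm (w t) * (K * l2norm (w t))" by (intro mult_left_mono K wL2) auto
      also have "\<dots> = K * (l2norm (w t))\<^sup>2" by (simp add: power2_eq_square)
      also have "\<dots> \<le> K * E" by (intro mult_left_mono wE that K)
      finally show ?thesis .
    qed
    \<comment> \<open>The source term is at most L |w(0)| times K \<open>l2norm (w t)\<close>.
      Splitting this product gives up one of the four copies of |w(0)|^2 and leaves an error of size
      K^2 L^2 E.\<close>
    have pt: "3 * (norm (w t 0))\<^sup>2 \<le> (1/2) * (- 2 * Re (P t)) + (24 + K\<^sup>2 * L\<^sup>2) * E" if t: "t \<in> {a..b}" for t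
    proof -
      have 1: "4 * (norm (w t 0))\<^sup>2 \<le> - Re (pairing (H t) (\<lambda>x. cnj (comm_dens (w t) x))) + 24 * E"
        using comm_op_commutator[OF h1_curveD(1)[OF c], of t] wE[OF t] by linarith
      have "norm (q t * cnj (comm_op (w t) 0)) \<le> (L * norm (w t 0)) * (K * l2norm (w t))"
        unfolding norm_mult complex_mod_cnj using K L by (intro mult_mono qL[OF t] K(3) wL2) auto
      also have "\<dots> = norm (w t 0) * (L * K * l2norm (w t))" by simp
      also have "\<dots> \<le> (norm (w t 0))\<^sup>2 + (L * K * l2norm (w t))\<^sup>2"
      proof -
        have "x * y \<le> x\<^sup>2 + y\<^sup>2" if "x \<ge> 0" "y \<ge> 0" for x y :: real
          using sum_squares_bound[of x y] mult_nonneg_nonneg[OF that] by linarith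
        then show ?thesis using L K(1) by simp
      qed
      also have "(L * K * l2norm (w t))\<^sup>2 \<le> K\<^sup>2 * L\<^sup>2 * E"
        using mult_left_mono[OF wE[OF t], of "K\<^sup>2 * L\<^sup>2"] by (simp add: power_mult_distrib mult_ac)
      finally have "- Re (q t * cnj (comm_op (w t) 0)) \<le> (norm (w t 0))\<^sup>2 + K\<^sup>2 * L\<^sup>2 * E"
        using abs_Re_le_cmod[of "q t * cnj (comm_op (w t) 0)"] by linarith
      moreover have "Re (P t) = Re (pairing (H t) (\<lambda>x. cnj (comm_dens (w t) x)))
          - Re (q t * cnj (comm_op (w t) 0))"
        by (simp add: P_def)
      moreover have "(24 + K\<^sup>2 * L\<^sup>2) * E = 24 * E + K\<^sup>2 * L\<^sup>2 * E" by (simp add: distrib_right)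
      ultimately show ?thesis using 1 by linarith
    qed
    have i0: "(\<lambda>t. 3 * (norm (w t 0))\<^sup>2) integrable_on {a..b}"
      by (intro integrable_continuous_interval continuous_intros h1_curve_continuous_at_point[OF c])
    have h: "((\<lambda>t. (1/2) * (- 2 * Re (P t)) + (24 + K\<^sup>2 * L\<^sup>2) * E) has_integral
        (1/2) * (M b - M a) + (b - a) * ((24 + K\<^sup>2 * L\<^sup>2) * E)) {a..b}"
      using has_integral_add[OF has_integral_mult_right[OF hP, of "1/2"] has_integral_const_real[of
          "(24 + K\<^sup>2 * L\<^sup>2) * E" a b]] ab
      by simp
    have "3 * integral {a..b} (\<lambda>t. (norm (w t 0))\<^sup>2) = integral {a..b} (\<lambda>t. 3 * (norm (w t 0))\<^sup>2)"
      by (rule Henstock_Kurzweil_Integration.integral_mult_right[symmetric])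
    also have "\<dots> \<le> (1/2) * (M b - M a) + (b - a) * ((24 + K\<^sup>2 * L\<^sup>2) * E)"
      by (rule has_integral_le[OF integrable_integral[OF i0] h pt])
    also have "\<dots> \<le> K * E + (b - a) * ((24 + K\<^sup>2 * L\<^sup>2) * E)"
      using Mb[of a] Mb[of b] ab by auto
    also have "\<dots> \<le> C * (1 + (b - a) * (1 + L\<^sup>2)) * E"
    proof -
      have "0 \<le> (24 + K\<^sup>2) * E + (b - a) * ((K + K\<^sup>2 + (24 + K) * L\<^sup>2) * E)"
        using ab E K(1) by (intro add_nonneg_nonneg mult_nonneg_nonneg) auto
      then show ?thesis by (simp add: C_def algebra_simps)
    qed
    finally have 3: "3 * integral {a..b} (\<lambda>t. (norm (w t 0))\<^sup>2) \<le> C * (1 + (b - a) * (1 + L\<^sup>2)) * E" .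
    have "0 \<le> integral {a..b} (\<lambda>t. (norm (w t 0))\<^sup>2)"
      by (intro Henstock_Kurzweil_Integration.integral_nonneg integrable_continuous_interval
          continuous_intros h1_curve_continuous_at_point[OF c]) auto
    with 3 show ?thesis by linarith
  qed
  moreover have "C > 0" using K(1) by (simp add: C_def add_pos_nonneg)
  ultimately show ?thesis using that by blast
qed

subsection \<open>Conservation of energy\<close>

text \<open>The trace estimate applied to p(t+h) - p(t): the L2 increment bound supplies E = h D,
  and the local Lipschitz constant of F supplies L. Bounds are taken on [a, b + 1] so that t + h
  stays inside for h \<le> 1.\<close>

lemma increment_trace_bound:
  assumes sol: "delta_solution p G f" and f: "\<And>t. f t = F (p t 0)" and ab: "a \<le> b"
    and lip: "\<And>R. \<exists>L\<ge>0. \<forall>z w. norm z \<le> R \<longrightarrow> norm w \<le> R \<longrightarrow> norm (F z - F w) \<le> L * norm (z - w)"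
  obtains C where "C \<ge> 0"
    "\<And>h. 0 < h \<Longrightarrow> h \<le> 1 \<Longrightarrow> integral {a..b} (\<lambda>t. (norm (p (t + h) 0 - p t 0))\<^sup>2) \<le> C * h"
proof -
  obtain M where M: "M \<ge> 0" "\<And>r. r \<in> {a..b + 1} \<Longrightarrow> l2norm (G r) \<le> M" "\<And>r. r \<in> {a..b + 1} \<Longrightarrow> norm (f r) \<le> M"
    "\<And>r. r \<in> {a..b + 1} \<Longrightarrow> norm (p r 0) \<le> M"
    using delta_solution_local_bounds[OF sol] by metis
  obtain L where L: "L \<ge> 0" "\<And>z w. norm z \<le> M \<Longrightarrow> norm w \<le> M \<Longrightarrow> norm (F z - F w) \<le> L * norm (z - w)"
    using lip by metis
  obtain C where C: "C > 0"
    "\<And>w H q a b E L. delta_solution w H q \<Longrightarrow> a \<le> b \<Longrightarrow> E \<ge> 0 \<Longrightarrow> L \<ge> 0 \<Longrightarrow>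
      (\<And>t. t \<in> {a..b} \<Longrightarrow> (l2norm (w t))\<^sup>2 \<le> E) \<Longrightarrow>
      (\<And>t. t \<in> {a..b} \<Longrightarrow> norm (q t) \<le> L * norm (w t 0)) \<Longrightarrow>
      integral {a..b} (\<lambda>t. (norm (w t 0))\<^sup>2) \<le> C * (1 + (b - a) * (1 + L\<^sup>2)) * E"
    using trace_estimate by blast
  define D where "D = 2 * M\<^sup>2 + 2 * M * M"
  have D: "D \<ge> 0" using M(1) by (simp add: D_def)
  show ?thesis
  proof (rule that[of "C * (1 + (b - a) * (1 + L\<^sup>2)) * D"])
    show "C * (1 + (b - a) * (1 + L\<^sup>2)) * D \<ge> 0"
      using C(1) ab D by (intro mult_nonneg_nonneg add_nonneg_nonneg) auto
    fix h :: real assume h: "0 < h" "h \<le> 1"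
    have "integral {a..b} (\<lambda>t. (norm (p (t + h) 0 - p t 0))\<^sup>2) \<le> C * (1 + (b - a) * (1 + L\<^sup>2)) * (h * D)"
    proof (rule C(2)[OF delta_solution_diff[OF delta_solution_shift[OF sol, of h] sol] ab])
      fix t assume t: "t \<in> {a..b}"
      have t': "t \<in> {a..b + 1}" "t + h \<in> {a..b + 1}" using t h by auto
      show "(l2norm (\<lambda>x. p (t + h) x - p t x))\<^sup>2 \<le> h * D"
        using delta_solution_l2_increment[OF sol M(2,3,4) t'] h by (simp add: D_def)
      show "norm (f (t + h) - f t) \<le> L * norm (p (t + h) 0 - p t 0)"
        unfolding f by (intro L(2) M(4) t')
    qed (use h D L in auto)
    then show "integral {a..b} (\<lambda>t. (norm (p (t + h) 0 - p t 0))\<^sup>2) \<le> C * (1 + (b - a) * (1 + L\<^sup>2)) * D * h"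
      by (simp add: mult_ac)
  qed
qed

text \<open>After shifting the variable, the integrals over the common part cancel and only those
  over [b, b+h] and [a, a+h] remain; \<Theta> itself need not be differentiable.\<close>

lemma shifted_difference_integral_tendsto:
  fixes \<Theta> :: "real \<Rightarrow> real"
  assumes \<Theta>: "continuous_on UNIV \<Theta>" and ab: "a \<le> b"
  shows "((\<lambda>h. integral {a..b} (\<lambda>t. \<Theta> (t + h) - \<Theta> t) / h) \<longlongrightarrow> \<Theta> b - \<Theta> a) (at_right 0)"
proof -
  have c: "continuous_on S \<Theta>" for S using \<Theta> continuous_on_subset by blast
  define I where "I x = integral {a - 1..x} \<Theta>" for x
  have dI: "(I has_real_derivative \<Theta> x) (at x)" if "x > a - 1" for x
  proof -
    have "(I has_real_derivative \<Theta> x) (at x within {a - 1..x + 1})"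
      unfolding I_def by (rule integral_has_real_derivative[OF c]) (use that in auto)
    then show ?thesis using at_within_Icc_at[of "a - 1" x "x + 1"] that by simp
  qed
  have lim: "((\<lambda>h. (I (x + h) - I x) / h) \<longlongrightarrow> \<Theta> x) (at_right 0)" if "x > a - 1" for x
    using DERIV_D[OF dI[OF that]] filterlim_at_split by blast
  have "((\<lambda>h. (I (b + h) - I b) / h - (I (a + h) - I a) / h) \<longlongrightarrow> \<Theta> b - \<Theta> a) (at_right 0)"
    by (intro tendsto_diff lim) (use ab in auto)
  moreover have "\<forall>\<^sub>F h in at_right 0. (I (b + h) - I b) / h - (I (a + h) - I a) / h
      = integral {a..b} (\<lambda>t. \<Theta> (t + h) - \<Theta> t) / h"
    unfolding eventually_at_right_field
  proof (intro exI[of _ 1] conjI allI impI)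
    fix h :: real assume h: "0 < h" "h < 1"
    have J: "I y - I x = integral {x..y} \<Theta>" if "a - 1 \<le> x" "x \<le> y" for x y
      using Henstock_Kurzweil_Integration.integral_combine[OF that integrable_continuous_interval[OF c]]
        by (simp add: I_def)
    have "integral {a..b} (\<lambda>t. \<Theta> (t + h) - \<Theta> t) = integral {a..b} (\<lambda>t. \<Theta> (t + h)) - integral {a..b} \<Theta>"
      by (intro Henstock_Kurzweil_Integration.integral_diff integrable_continuous_interval c
          continuous_on_compose2[OF \<Theta>])
        (auto intro!: continuous_intros)
    also have "integral {a..b} (\<lambda>t. \<Theta> (t + h)) = integral {a + h..b + h} \<Theta>"
      by (subst integral_shift_Icc_real[symmetric]) (simp add: comp_def add.commute)
    also have "\<dots> - integral {a..b} \<Theta> = (I (b + h) - I (a + h)) - (I b - I a)"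
      using J[of "a + h" "b + h"] J[of a b] ab h by simp
    finally show "(I (b + h) - I b) / h - (I (a + h) - I a) / h = integral {a..b} (\<lambda>t. \<Theta> (t + h) - \<Theta> t) / h"
      by (simp add: diff_divide_distrib)
  qed auto
  ultimately show ?thesis by (rule Lim_transform_eventually)
qed

text \<open>Testing the equation at time \<open>t + h\<close> with \<open>\<psi>(t)\<close> and conversely makes the kinetic terms cancel; what is
  left is the point interaction, and the error of the trapezoidal rule for \<open>U\<close> along the trace is
  controlled by the local smoothing estimate.\<close>

lemma delta_solution_energy:
  assumes sol: "delta_solution p G f" and f: "\<And>t. f t = F (p t 0)"
    and U: "continuous_on UNIV (U :: complex \<Rightarrow> real)"
    and lip: "\<And>R. \<exists>L\<ge>0. \<forall>z w. norm z \<le> R \<longrightarrow> norm w \<le> R \<longrightarrow> norm (F z - F w) \<le> L * norm (z - w)"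
    and trap: "\<And>R e. e > 0 \<Longrightarrow> \<exists>d>0. \<forall>z w. norm z \<le> R \<longrightarrow> norm w \<le> R \<longrightarrow> norm (w - z) < d \<longrightarrow>
      \<bar>U w - U z + (1/2) * inner (F z + F w) (w - z)\<bar> \<le> e * (norm (w - z))\<^sup>2"
    and ab: "a \<le> b"
  shows "(l2norm (G b))\<^sup>2 + 2 * U (p b 0) = (l2norm (G a))\<^sup>2 + 2 * U (p a 0)"
proof -
  note c = delta_solutionD(1)[OF sol]
  define g where "g t = p t 0" for t
  have cg: "continuous_on S g" for S unfolding g_def by (rule h1_curve_continuous_at_point[OF c])
  have cf: "continuous_on S f" for S by (rule delta_solutionD(2)[OF sol])
  have cU: "continuous_on S (\<lambda>t. U (g t))" for S
    using continuous_on_compose2[OF U cg] by auto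
  have shift: "continuous_on S (\<lambda>t. k (t + h))" if "continuous_on UNIV k"
      for k :: "real \<Rightarrow> 'z::topological_space" and S h
    by (rule continuous_on_compose2[OF that]) (auto intro!: continuous_intros)
  \<comment> \<open>Chosen so that the derivative of J is an exact difference of \<Theta> up to the
    trapezoidal error r. The terms f(t) . g(t) and f(t+h) . g(t+h) produced by the trapezoidal rule
    are absorbed in it.\<close>
  define \<Theta> where "\<Theta> t = inner (f t) (g t) + 2 * U (g t)" for t
  have c\<Theta>: "continuous_on S \<Theta>" for S unfolding \<Theta>_def by (intro continuous_intros cf cg cU)
  define J where "J h t = Re (\<i> * pairing (p t) (\<lambda>x. cnj (p (t + h) x)))" for h t
  define r where "r h t = U (g (t + h)) - U (g t) + (1/2) * inner (f t + f (t + h)) (g (t + h) - g t)" for h t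
  have cr: "continuous_on S (r h)" for S h
    unfolding r_def by (intro continuous_intros cU cg cf shift[OF cU] shift[OF cg] shift[OF cf])
  have dJ: "(J h has_vector_derivative (\<Theta> (t + h) - \<Theta> t) - 2 * r h t) (at t)" for h t
  proof -
    have "((\<lambda>t. \<i> * pairing (p t) (\<lambda>x. cnj (p (t + h) x))) has_vector_derivative
        \<i> * (\<i> * (f t * cnj (p (t + h) 0) - cnj (f (t + h)) * p t 0))) (at t)"
      by (rule has_vector_derivative_mult_right[OF
          delta_solution_sesquilinear_deriv[OF sol delta_solution_shift[OF sol]]])
    from bounded_linear.has_vector_derivative[OF bounded_linear_Re this]
    have "(J h has_vector_derivative Re (\<i> * (\<i> * (f t * cnj (p (t + h) 0) - cnj (f (t + h)) * p t 0))))
        (at t)"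
      by (simp add: J_def[abs_def])
    moreover have "Re (\<i> * (\<i> * (f t * cnj (p (t + h) 0) - cnj (f (t + h)) * p t 0)))
        = (\<Theta> (t + h) - \<Theta> t) - 2 * r h t"
      by (simp add: \<Theta>_def r_def g_def inner_complex_def algebra_simps)
    ultimately show ?thesis by simp
  qed
  have I: "J h b - J h a = integral {a..b} (\<lambda>t. \<Theta> (t + h) - \<Theta> t) - 2 * integral {a..b} (r h)" for h
  proof -
    have "((\<lambda>t. (\<Theta> (t + h) - \<Theta> t) - 2 * r h t) has_integral (J h b - J h a)) {a..b}"
      by (rule fundamental_theorem_of_calculus[OF ab has_vector_derivative_at_within[OF dJ]])
    then have "J h b - J h a = integral {a..b} (\<lambda>t. (\<Theta> (t + h) - \<Theta> t) - 2 * r h t)"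
      by (rule integral_unique[symmetric])
    also have "\<dots> = integral {a..b} (\<lambda>t. \<Theta> (t + h) - \<Theta> t) - integral {a..b} (\<lambda>t. 2 * r h t)"
      by (intro Henstock_Kurzweil_Integration.integral_diff integrable_continuous_interval
          continuous_intros c\<Theta> cr shift[OF c\<Theta>])
    finally show ?thesis by simp
  qed
  \<comment> \<open>The kinetic energy enters here only: with p(t) frozen as test function and the
    other factor moving, the derivative at h = 0 pairs \<open>G t\<close> with its own conjugate.
    Also J vanishes at h = 0, the charge being real.\<close>
  have Jlim: "((\<lambda>h. J h t / h) \<longlongrightarrow> inner (f t) (g t) - (l2norm (G t))\<^sup>2) (at_right 0)" for t
  proof -
    define \<phi> where "\<phi> s = Re (\<i> * cnj (pairing (p s) (\<lambda>x. cnj (p t x))))" for s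
    have "((\<lambda>s. pairing (p s) (\<lambda>x. cnj (p t x))) has_vector_derivative
        - \<i> * (pairing (G t) (\<lambda>x. cnj (G t x)) - f t * cnj (p t 0))) (at t)"
      by (rule delta_solution_deriv_fixed[OF sol h1_pair_cnj[OF h1_curveD(1)[OF c]]])
    from bounded_linear.has_vector_derivative[OF bounded_linear_Re
        has_vector_derivative_mult_right[OF
            bounded_linear.has_vector_derivative[OF bounded_linear_cnj this], of \<i>]]
    have "(\<phi> has_real_derivative Re
        (\<i> * cnj (- \<i> * (pairing (G t) (\<lambda>x. cnj (G t x)) - f t * cnj (p t 0))))) (at t)"
      by (simp add: \<phi>_def[abs_def] has_real_derivative_iff_has_vector_derivative)
    moreover have "Re (\<i> * cnj (- \<i> * (pairing (G t) (\<lambda>x. cnj (G t x)) - f t * cnj (p t 0))))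
        = inner (f t) (g t) - (l2norm (G t))\<^sup>2"
      unfolding pairing_self_cnj by (simp add: inner_complex_def g_def algebra_simps flip: of_real_power)
    ultimately have "(\<phi> has_real_derivative inner (f t) (g t) - (l2norm (G t))\<^sup>2) (at t)" by simp
    from DERIV_D[OF this] have "((\<lambda>h. (\<phi> (t + h) - \<phi> t) / h)
        \<longlongrightarrow> inner (f t) (g t) - (l2norm (G t))\<^sup>2) (at_right 0)"
      using filterlim_at_split by blast
    moreover have "\<phi> (t + h) = J h t" for h
      using pairing_cnj[of "p (t + h)" "\<lambda>x. cnj (p t x)"] by (simp add: \<phi>_def J_def pairing_commute)
    moreover have "\<phi> t = 0" unfolding \<phi>_def pairing_self_cnj by simp
    ultimately show ?thesis by simp
  qed
  obtain C where C: "C \<ge> 0"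
    "\<And>h. 0 < h \<Longrightarrow> h \<le> 1 \<Longrightarrow> integral {a..b} (\<lambda>t. (norm (g (t + h) - g t))\<^sup>2) \<le> C * h"
    using increment_trace_bound[OF sol f ab lip] unfolding g_def by metis
  obtain R where R: "\<And>t. t \<in> {a..b + 1} \<Longrightarrow> norm (g t) \<le> R"
    using delta_solution_local_bounds[OF sol, of a "b + 1"] unfolding g_def by metis
  have rlim: "((\<lambda>h. integral {a..b} (r h) / h) \<longlongrightarrow> 0) (at_right 0)"
  proof (rule tendstoI)
    fix \<epsilon> :: real assume \<epsilon>: "\<epsilon> > 0"
    \<comment> \<open>The summand 1 keeps the quotient defined and gives e C < \<epsilon> also when
      C = 0.\<close>
    define e where "e = \<epsilon> / (C + 1)"
    have e: "e > 0" "e * C < \<epsilon>" using \<epsilon> C(1) by (auto simp: e_def field_simps)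
    obtain d where d: "d > 0" "\<And>z w. norm z \<le> R \<Longrightarrow> norm w \<le> R \<Longrightarrow> norm (w - z) < d \<Longrightarrow>
      \<bar>U w - U z + (1/2) * inner (F z + F w) (w - z)\<bar> \<le> e * (norm (w - z))\<^sup>2"
      using trap[OF e(1), of R] by blast
    have "uniformly_continuous_on {a..b + 1} g"
      by (rule compact_uniformly_continuous[OF cg compact_Icc])
    then obtain \<delta> where \<delta>: "\<delta> > 0"
      "\<And>s t. s \<in> {a..b + 1} \<Longrightarrow> t \<in> {a..b + 1} \<Longrightarrow> dist s t < \<delta> \<Longrightarrow> dist (g s) (g t) < d"
      unfolding uniformly_continuous_on_def using d(1) by metis
    show "\<forall>\<^sub>F h in at_right 0. dist (integral {a..b} (r h) / h) 0 < \<epsilon>"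
      unfolding eventually_at_right_field
    proof (intro exI[of _ "min \<delta> 1"] conjI allI impI)
      fix h assume "0 < h" "h < min \<delta> 1"
      then have h: "0 < h" "h < \<delta>" "h \<le> 1" by auto
      have "norm (integral {a..b} (r h)) \<le> integral {a..b} (\<lambda>t. e * (norm (g (t + h) - g t))\<^sup>2)"
      proof (rule integral_norm_bound_integral)
        show "r h integrable_on {a..b}" by (intro integrable_continuous_interval cr)
        show "(\<lambda>t. e * (norm (g (t + h) - g t))\<^sup>2) integrable_on {a..b}"
          by (intro integrable_continuous_interval continuous_intros cg shift[OF cg])
        fix t assume t: "t \<in> {a..b}"
        have t': "t \<in> {a..b + 1}" "t + h \<in> {a..b + 1}" using t h by auto
        have "dist (g (t + h)) (g t) < d" by (rule \<delta>(2)[OF t'(2,1)]) (use h in \<open>simp add: dist_real_def\<close>)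
        then show "norm (r h t) \<le> e * (norm (g (t + h) - g t))\<^sup>2"
          using d(2)[OF R[OF t'(1)] R[OF t'(2)]] by (simp add: r_def f g_def dist_norm)
      qed
      also have "\<dots> = e * integral {a..b} (\<lambda>t. (norm (g (t + h) - g t))\<^sup>2)"
        by (rule Henstock_Kurzweil_Integration.integral_mult_right)
      also have "\<dots> \<le> e * (C * h)" using e h by (intro mult_left_mono C(2)) auto
      finally have "norm (integral {a..b} (r h)) / h \<le> e * C"
        using h by (simp add: divide_le_eq mult_ac)
      then show "dist (integral {a..b} (r h) / h) 0 < \<epsilon>" using e(2) h by simp
    qed (use \<delta> in auto)
  qed
  \<comment> \<open>D and \<Theta> share the term f . g; it cancels in the comparison of the limits
    and leaves the kinetic energy against 2 U.\<close>
  define D where "D t = inner (f t) (g t) - (l2norm (G t))\<^sup>2" for t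
  have "((\<lambda>h. J h b / h - J h a / h) \<longlongrightarrow> D b - D a) (at_right 0)"
    unfolding D_def by (intro tendsto_diff Jlim)
  moreover have "((\<lambda>h. integral {a..b} (\<lambda>t. \<Theta> (t + h) - \<Theta> t) / h - 2 * (integral {a..b} (r h) / h))
      \<longlongrightarrow> (\<Theta> b - \<Theta> a) - 2 * 0) (at_right 0)"
    by (intro tendsto_intros shifted_difference_integral_tendsto c\<Theta> ab rlim)
  moreover have "J h b / h - J h a / h
      = integral {a..b} (\<lambda>t. \<Theta> (t + h) - \<Theta> t) / h - 2 * (integral {a..b} (r h) / h)" for h
    using I[of h] by (simp add: diff_divide_distrib[symmetric])
  ultimately have "D b - D a = \<Theta> b - \<Theta> a - 2 * 0"
    using tendsto_unique[OF trivial_limit_at_right_real] by (simp only:) blast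
  then show ?thesis by (simp add: D_def \<Theta>_def g_def)
qed

subsection \<open>The nonlinearity\<close>

lemma has_real_derivative_along_line:
  fixes \<phi> :: "complex \<Rightarrow> real"
  assumes "\<phi> differentiable (at (z + of_real s * d))"
  shows "((\<lambda>s. \<phi> (z + of_real s * d)) has_real_derivative dir_deriv d \<phi> (z + of_real s * d)) (at s)"
proof -
  let ?x = "z + of_real s * d" and ?D = "frechet_derivative \<phi> (at (z + of_real s * d))"
  have 1: "((\<lambda>s. z + of_real s * d) has_derivative (\<lambda>h. of_real h * d)) (at s)"
    by (auto intro!: derivative_eq_intros)
  have 2: "(\<phi> has_derivative ?D) (at ?x)" using assms by (simp add: frechet_derivative_works)
  have "?D (of_real h * d) = h * ?D d" for h
    using linear_scale[OF linear_frechet_derivative[OF assms], of h d] by (simp add: scaleR_conv_of_real)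
  then have eq: "(\<lambda>h. ?D (of_real h * d)) = (*) (?D d)" by (simp add: fun_eq_iff mult.commute)
  show ?thesis
    unfolding has_field_derivative_def dir_deriv_def using has_derivative_compose[OF 1 2] unfolding eq .
qed

lemma dir_deriv_complex_components:
  fixes \<phi> :: "complex \<Rightarrow> real"
  assumes "\<phi> differentiable (at x)"
  shows "dir_deriv d \<phi> x = Re d * dir_deriv 1 \<phi> x + Im d * dir_deriv \<i> \<phi> x"
proof -
  note lin = linear_frechet_derivative[OF assms]
  have "d = Re d *\<^sub>R 1 + Im d *\<^sub>R \<i>" by (simp add: complex_eq_iff)
  then have "frechet_derivative \<phi> (at x) d = frechet_derivative \<phi> (at x) (Re d *\<^sub>R 1 + Im d *\<^sub>R \<i>)" by simp
  then show ?thesis by (simp add: dir_deriv_def linear_add[OF lin] linear_scale[OF lin])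
qed

lemma norm_line_le:
  fixes z w :: complex
  assumes "norm z \<le> R" "norm w \<le> R" "0 \<le> s" "s \<le> 1"
  shows "norm (z + of_real s * (w - z)) \<le> R"
proof -
  have "z + of_real s * (w - z) = of_real (1 - s) * z + of_real s * w" by (simp add: algebra_simps)
  also have "norm \<dots> \<le> (1 - s) * R + s * R"
    using assms by (intro norm_triangle_mono) (simp_all add: norm_mult mult_left_mono del: of_real_diff)
  finally show ?thesis by (simp add: algebra_simps)
qed

section \<open>Consequences of U being C^2 and radial for the force\<close>

context
  fixes U :: "complex \<Rightarrow> real" and F :: "complex \<Rightarrow> complex"
  assumes U: "Ck 2 U" and grad: "\<And>z. GDERIV U z :> - F z"
begin

lemma dir_deriv_potential: "dir_deriv d U z = - inner (F z) d"
  using dir_deriv_eq[of U _ z d] grad[of z] by (simp add: gderiv_def inner_commute)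

lemma Ck_dir_deriv_potential: "Ck (Suc 0) (dir_deriv d U)"
  using U by (simp add: numeral_2_eq_2)

lemma differentiable_dir_deriv_potential: "dir_deriv d U differentiable (at x)"
  using Ck_dir_deriv_potential by simp

lemma continuous_second_deriv: "continuous_on S (dir_deriv v (dir_deriv d U))"
proof -
  have "Ck 0 (dir_deriv v (dir_deriv d U))" using Ck_dir_deriv_potential[of d] by simp
  then show ?thesis by (rule Ck_imp_continuous_on)
qed

lemma force_eq: "F z = - (of_real (dir_deriv 1 U z) + \<i> * of_real (dir_deriv \<i> U z))"
  by (simp add: dir_deriv_potential complex_eq_iff inner_complex_def)

lemma continuous_force: "continuous_on S F"
proof -
  have "continuous_on S (dir_deriv d U)" for d by (rule Ck_imp_continuous_on[OF Ck_dir_deriv_potential])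
  then have "continuous_on S (\<lambda>z. - (of_real (dir_deriv 1 U z) + \<i> * of_real (dir_deriv \<i> U z)))"
    by (intro continuous_intros)
  moreover have "F = (\<lambda>z. - (of_real (dir_deriv 1 U z) + \<i> * of_real (dir_deriv \<i> U z)))"
    by (rule ext, rule force_eq)
  ultimately show ?thesis by simp
qed

text \<open>Mean value theorem on the segment from w to z, which stays in the ball; the second
  derivatives of U along the two real axes are bounded there by compactness.\<close>

lemma force_lipschitz: "\<exists>L\<ge>0. \<forall>z w. norm z \<le> R \<longrightarrow> norm w \<le> R \<longrightarrow> norm (F z - F w) \<le> L * norm (z - w)"
proof -
  have "\<exists>B\<ge>0. \<forall>x\<in>cball 0 R. \<bar>dir_deriv v (dir_deriv d U) x\<bar> \<le> B" for v d
  proof -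
    obtain B where "\<forall>x\<in>cball 0 R. norm (dir_deriv v (dir_deriv d U) x) \<le> B"
      using compact_imp_bounded[OF compact_continuous_image[OF continuous_second_deriv[of "cball 0 R" v
          d] compact_cball]] by (auto simp: bounded_iff)
    then show ?thesis by (intro exI[of _ "\<bar>B\<bar>"]) fastforce
  qed
  then obtain B where B: "\<And>v d. B v d \<ge> 0" "\<And>v d x. x \<in> cball 0 R \<Longrightarrow> \<bar>dir_deriv v (dir_deriv d U) x\<bar> \<le> B v d"
    by metis
  have comp: "\<bar>dir_deriv d U z - dir_deriv d U w\<bar> \<le> (B 1 d + B \<i> d) * norm (z - w)"
      if zw: "norm z \<le> R" "norm w \<le> R" for z w d
  proof -
    let ?\<phi> = "dir_deriv d U" and ?l = "\<lambda>s. w + complex_of_real s * (z - w)"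
    have "\<exists>s>0. s < 1 \<and> ?\<phi> (?l 1) - ?\<phi> (?l 0) = (1 - 0) * dir_deriv (z - w) ?\<phi> (?l s)"
      by (rule MVT2) (auto intro!: has_real_derivative_along_line differentiable_dir_deriv_potential)
    then obtain s where s: "0 < s" "s < 1" "?\<phi> z - ?\<phi> w = dir_deriv (z - w) ?\<phi> (?l s)" by auto
    have l: "?l s \<in> cball 0 R" using norm_line_le[OF zw(2,1)] s by simp
    have "\<bar>dir_deriv (z - w) ?\<phi> (?l s)\<bar>
        \<le> \<bar>Re (z - w)\<bar> * \<bar>dir_deriv 1 ?\<phi> (?l s)\<bar> + \<bar>Im (z - w)\<bar> * \<bar>dir_deriv \<i> ?\<phi> (?l s)\<bar>"
      unfolding dir_deriv_complex_components[OF differentiable_dir_deriv_potential, of "z - w"]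
          abs_mult[symmetric]
      by (rule abs_triangle_ineq)
    also have "\<dots> \<le> norm (z - w) * B 1 d + norm (z - w) * B \<i> d"
      by (intro add_mono mult_mono abs_Re_le_cmod abs_Im_le_cmod B l) auto
    finally show ?thesis using s(3) by (simp add: algebra_simps)
  qed
  have "norm (F z - F w) \<le> (B 1 1 + B \<i> 1 + (B 1 \<i> + B \<i> \<i>)) * norm (z - w)"
      if "norm z \<le> R" "norm w \<le> R" for z w
  proof -
    have "norm (F z - F w) \<le> \<bar>dir_deriv 1 U z - dir_deriv 1 U w\<bar> + \<bar>dir_deriv \<i> U z - dir_deriv \<i> U w\<bar>"
      using cmod_le[of "F z - F w"] by (simp add: force_eq abs_minus_commute)
    also have "\<dots> \<le> (B 1 1 + B \<i> 1) * norm (z - w) + (B 1 \<i> + B \<i> \<i>) * norm (z - w)"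
      by (intro add_mono comp that)
    finally show ?thesis by (simp add: algebra_simps)
  qed
  then show ?thesis
    using B(1) by (intro exI[of _ "B 1 1 + B \<i> 1 + (B 1 \<i> + B \<i> \<i>)"]) (auto intro!: add_nonneg_nonneg)
qed

text \<open>With only two derivatives available the error has no rate beyond the second order. It is
  controlled by the oscillation of the second derivative along the segment, which uniform continuity
  on the ball makes small.\<close>

lemma trapezoid_error:
  assumes e: "e > 0"
  shows "\<exists>d>0. \<forall>z w. norm z \<le> R \<longrightarrow> norm w \<le> R \<longrightarrow> norm (w - z) < d \<longrightarrow>
      \<bar>U w - U z + (1/2) * inner (F z + F w) (w - z)\<bar> \<le> e * (norm (w - z))\<^sup>2"
proof -
  have "\<exists>d>0. \<forall>x\<in>cball 0 R. \<forall>y\<in>cball 0 R. dist x y < d \<longrightarrow>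
      \<bar>dir_deriv v (dir_deriv k U) x - dir_deriv v (dir_deriv k U) y\<bar> < e / 4" for v k
    using compact_uniformly_continuous[OF continuous_second_deriv compact_cball, of 0 R v k] e
    unfolding uniformly_continuous_on_def dist_real_def
      by (metis dist_commute zero_less_divide_iff zero_less_numeral)
  then obtain \<delta> where \<delta>: "\<And>v k. \<delta> v k > 0" "\<And>v k x y. x \<in> cball 0 R \<Longrightarrow> y \<in> cball 0 R \<Longrightarrow> dist x y < \<delta> v k \<Longrightarrow>
      \<bar>dir_deriv v (dir_deriv k U) x - dir_deriv v (dir_deriv k U) y\<bar> < e / 4" by metis
  \<comment> \<open>The second derivative in a direction is a quadratic form with four coefficients
    along 1 and \<i>, each allowed an oscillation e/4; \<delta>0 serves all four.\<close>
  define \<delta>0 where "\<delta>0 = min (min (\<delta> 1 1) (\<delta> \<i> 1)) (min (\<delta> 1 \<i>) (\<delta> \<i> \<i>))"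
  have quad: "dir_deriv d (dir_deriv d U) x
      = Re d * (Re d * dir_deriv 1 (dir_deriv 1 U) x + Im d * dir_deriv \<i> (dir_deriv 1 U) x)
      + Im d * (Re d * dir_deriv 1 (dir_deriv \<i> U) x + Im d * dir_deriv \<i> (dir_deriv \<i> U) x)" for d x
  proof -
    have "dir_deriv d U = (\<lambda>x. Re d * dir_deriv 1 U x + Im d * dir_deriv \<i> U x)"
      by (simp add: fun_eq_iff dir_deriv_potential inner_complex_def)
    moreover have "((\<lambda>x. Re d * dir_deriv 1 U x + Im d * dir_deriv \<i> U x) has_derivative
        (\<lambda>v. Re d * frechet_derivative (dir_deriv 1 U) (at x) v + Im d * frechet_derivative
            (dir_deriv \<i> U) (at x) v)) (at x)"
      using differentiable_dir_deriv_potential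
      by (intro has_derivative_add has_derivative_mult_right)
          (simp_all add: frechet_derivative_works[symmetric])
    ultimately have "dir_deriv d (dir_deriv d U) x
        = Re d * dir_deriv d (dir_deriv 1 U) x + Im d * dir_deriv d (dir_deriv \<i> U) x"
      using dir_deriv_eq[of "dir_deriv d U" _ x d] by (simp add: dir_deriv_def)
    then show ?thesis by (simp only: dir_deriv_complex_components[OF differentiable_dir_deriv_potential,
        of d])
  qed
  have "\<bar>U w - U z + (1/2) * inner (F z + F w) (w - z)\<bar> \<le> e * (norm (w - z))\<^sup>2"
    if zw: "norm z \<le> R" "norm w \<le> R" and near: "norm (w - z) < \<delta>0" for z w
  proof -
    define d where "d = w - z"
    define l where "l s = z + complex_of_real s * d" for s
    define q where "q s = dir_deriv d (dir_deriv d U) (l s)" for s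
    have lR: "l s \<in> cball 0 R" if "0 \<le> s" "s \<le> 1" for s
      using norm_line_le[OF zw that] by (simp add: l_def d_def)
    have dU: "((\<lambda>s. U (l s)) has_real_derivative dir_deriv d U (l s)) (at s)" for s
      unfolding l_def by (rule has_real_derivative_along_line) (use U in \<open>simp add: numeral_2_eq_2\<close>)
    have ddU: "((\<lambda>s. dir_deriv d U (l s)) has_real_derivative q s) (at s)" for s
      unfolding l_def q_def by (rule has_real_derivative_along_line[OF differentiable_dir_deriv_potential])
    have osc: "\<bar>q s - q t\<bar> \<le> e * (norm d)\<^sup>2" if st: "0 \<le> s" "s \<le> 1" "0 \<le> t" "t \<le> 1" for s t
    proof -
      have "dist (l s) (l t) = \<bar>s - t\<bar> * norm d"
        by (simp add: l_def dist_norm norm_mult flip: left_diff_distrib of_real_diff)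
      also have "\<dots> \<le> 1 * norm d" using st by (intro mult_right_mono) auto
      also have "\<dots> < \<delta>0" using near by (simp add: d_def)
      finally have dist: "dist (l s) (l t) < \<delta>0" .
      define a where "a v k = dir_deriv v (dir_deriv k U) (l s) - dir_deriv v (dir_deriv k U) (l t)" for v k
      have "\<bar>a v k\<bar> \<le> e / 4" if "dist (l s) (l t) < \<delta> v k" for v k
        unfolding a_def by (rule less_imp_le[OF \<delta>(2)[OF lR[OF st(1,2)] lR[OF st(3,4)] that]])
      then have small: "\<bar>a 1 1\<bar> \<le> e / 4" "\<bar>a \<i> 1\<bar> \<le> e / 4" "\<bar>a 1 \<i>\<bar> \<le> e / 4" "\<bar>a \<i> \<i>\<bar> \<le> e / 4"
        using dist by (simp_all add: \<delta>0_def)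
      have prod: "\<bar>x * (y * c)\<bar> \<le> (e / 4) * (norm d)\<^sup>2" if "\<bar>x\<bar> \<le> norm d" "\<bar>y\<bar> \<le> norm d" "\<bar>c\<bar> \<le> e / 4"
          for x y c
      proof -
        have "\<bar>x\<bar> * (\<bar>y\<bar> * \<bar>c\<bar>) \<le> norm d * (norm d * (e / 4))"
          using that e by (intro mult_mono) auto
        then show ?thesis by (simp add: abs_mult power2_eq_square mult_ac)
      qed
      note ri = abs_Re_le_cmod[of d] abs_Im_le_cmod[of d]
      have "q s - q t = Re d * (Re d * a 1 1) + Re d * (Im d * a \<i> 1) + Im d * (Re d * a 1 \<i>)
          + Im d * (Im d * a \<i> \<i>)"
        by (simp only: q_def quad[of d]) (simp add: a_def algebra_simps)
      then show ?thesis
        using prod[OF ri(1) ri(1) small(1)] prod[OF ri(1) ri(2) small(2)] prod[OF ri(2) ri(1) small(3)]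
            prod[OF ri(2) ri(2) small(4)]
        by linarith
    qed
    \<comment> \<open>The trapezoidal error on the initial part of the segment. Its derivative is
      half the difference between an increment of the first derivative and s q(s); a second mean
      value step turns this into (s/2)(q(t) - q(s)), a pure oscillation.\<close>
    define r where "r s = U (l s) - U z - (1/2) * s * (dir_deriv d U z + dir_deriv d U (l s))" for s
    have dr: "(r has_real_derivative dir_deriv d U (l s)
        - (1/2) * (dir_deriv d U z + dir_deriv d U (l s)) - (1/2) * s * q s) (at s)" for s
      unfolding r_def[abs_def] by (auto intro!: derivative_eq_intros dU ddU simp: algebra_simps)
    have "\<exists>s>0. s < 1 \<and> r 1 - r 0 = (1 - 0) * (dir_deriv d U (l s)
        - (1/2) * (dir_deriv d U z + dir_deriv d U (l s)) - (1/2) * s * q s)"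
      by (rule MVT2[OF zero_less_one]) (rule dr)
    then obtain s where s01: "0 < s" "s < 1"
      and "r 1 - r 0 = dir_deriv d U (l s) - (1/2) * (dir_deriv d U z + dir_deriv d U (l s))
          - (1/2) * s * q s"
      by auto
    then have s: "0 < s" "s < 1"
      "r 1 - r 0 = (1/2) * (dir_deriv d U (l s) - dir_deriv d U (l 0)) - (1/2) * s * q s"
      by (simp_all add: l_def field_simps)
    have "\<exists>t>0. t < s \<and> dir_deriv d U (l s) - dir_deriv d U (l 0) = (s - 0) * q t"
      by (rule MVT2) (auto intro!: ddU s)
    then obtain t where t: "0 < t" "t < s" "dir_deriv d U (l s) - dir_deriv d U (l 0) = s * q t" by auto
    have "r 1 - r 0 = (1/2) * s * (q t - q s)" using s(3) t(3) by (simp add: algebra_simps)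
    moreover have "\<bar>(1/2) * s * (q t - q s)\<bar> \<le> 1 * (e * (norm d)\<^sup>2)"
      unfolding abs_mult[of "(1/2) * s"] by (intro mult_mono osc) (use s t in auto)
    moreover have "r 1 - r 0 = U w - U z + (1/2) * inner (F z + F w) (w - z)"
      by (simp add: r_def l_def d_def dir_deriv_potential inner_add_left field_simps)
    ultimately show ?thesis by (simp add: d_def)
  qed
  moreover have "\<delta>0 > 0" using \<delta>(1) by (simp add: \<delta>0_def)
  ultimately show ?thesis by blast
qed

text \<open>U is constant along the rotation of z, whose velocity at s = 0 is \<i> z. Hence F(z) is
  orthogonal to \<i> z, which says that the imaginary part of F(z) cnj z vanishes.\<close>

lemma force_radial:
  assumes "\<And>z. U z = u ((norm z)\<^sup>2)"
  shows "F z * cnj z \<in> \<real>"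
proof -
  have 1: "((\<lambda>s. cis s * z) has_derivative (\<lambda>s. of_real s * (\<i> * z))) (at 0)"
  proof -
    have "((\<lambda>w. exp (\<i> * w)) has_field_derivative \<i>) (at (of_real 0))"
      by (auto intro!: derivative_eq_intros)
    from has_vector_derivative_real_field[OF this]
    have "(cis has_derivative (\<lambda>s. of_real s * \<i>)) (at 0)"
      by (simp add: has_vector_derivative_def scaleR_conv_of_real cis_conv_exp[abs_def])
    from has_derivative_mult_left[OF this, of z] show ?thesis by (simp add: mult.assoc)
  qed
  have 2: "(U has_derivative (\<lambda>v. inner v (- F z))) (at (cis 0 * z))"
    using grad[of z] by (simp add: gderiv_def)
  have "((\<lambda>s. U (cis s * z)) has_derivative (\<lambda>s. inner (of_real s * (\<i> * z)) (- F z))) (at 0)"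
    by (rule has_derivative_compose[OF 1 2])
  moreover have "(\<lambda>s. U (cis s * z)) = (\<lambda>s. U z)" by (simp add: assms norm_mult)
  ultimately have "(\<lambda>s. inner (of_real s * (\<i> * z)) (- F z)) = (\<lambda>s. 0)"
    using has_derivative_unique[OF _ has_derivative_const] by metis
  then have "inner (of_real 1 * (\<i> * z)) (- F z) = 0" by meson
  then show ?thesis by (simp add: complex_is_Real_iff inner_complex_def algebra_simps)
qed

end

subsection \<open>Hoelder continuity\<close>

lemma powr_quarter:
  "x \<ge> 0 \<Longrightarrow> x powr (1/4) = sqrt (sqrt x)"
  by (simp add: powr_half_sqrt[symmetric] powr_powr)

text \<open>At distance at most 1 the square root in x is dominated by the fourth root. At larger
  distances the spatial estimate has the wrong growth, and the bound on the function takes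
  over.\<close>

lemma bounded_hoelder_pairI:
  fixes \<psi> :: "real \<Rightarrow> real \<Rightarrow> complex"
  assumes M: "\<And>x t. norm (\<psi> x t) \<le> M"
    and X: "\<And>x y t. norm (\<psi> x t - \<psi> y t) \<le> A * sqrt \<bar>x - y\<bar>" "A \<ge> 0"
    and T: "\<And>x s t. norm (\<psi> x t - \<psi> x s) \<le> B * \<bar>t - s\<bar> powr (1/4)" "B \<ge> 0"
  shows "bounded_hoelder (1/4) (\<lambda>(x, t). \<psi> x t)"
  unfolding bounded_hoelder_def
proof
  show "bounded (range (\<lambda>(x, t). \<psi> x t))"
    using M by (auto simp: bounded_iff)
  have M0: "M \<ge> 0" using order_trans[OF norm_ge_zero M] .
  show "\<exists>C. \<forall>p q. norm ((case p of (x, t) \<Rightarrow> \<psi> x t) - (case q of (x, t) \<Rightarrow> \<psi> x t)) \<le> C * dist p q powr (1/4)"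
  proof (intro exI allI)
    fix p q :: "real \<times> real"
    obtain x t y s where pq: "p = (x, t)" "q = (y, s)" by (cases p, cases q)
    let ?d = "dist p q"
    have dx: "\<bar>x - y\<bar> \<le> ?d" and dt: "\<bar>t - s\<bar> \<le> ?d"
      using dist_fst_le[of p q] dist_snd_le[of p q] by (simp_all add: pq dist_real_def)
    have d0: "0 \<le> ?d powr (1/4)" by simp
    show "norm ((case p of (x, t) \<Rightarrow> \<psi> x t) - (case q of (x, t) \<Rightarrow> \<psi> x t)) \<le> (2 * M + A + B) * ?d powr (1/4)"
    proof (cases "?d \<le> 1")
      case True
      have "sqrt \<bar>x - y\<bar> \<le> sqrt ?d" using dx by simp
      also have "\<dots> = ?d powr (1/2)" by (simp add: powr_half_sqrt)
      also have "\<dots> \<le> ?d powr (1/4)" using True by (cases "?d = 0") (auto intro: powr_mono')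
      finally have 1: "A * sqrt \<bar>x - y\<bar> \<le> A * ?d powr (1/4)" by (rule mult_left_mono[OF _ X(2)])
      have "\<bar>t - s\<bar> powr (1/4) \<le> ?d powr (1/4)" using dt by (intro powr_mono2) auto
      then have 2: "B * \<bar>t - s\<bar> powr (1/4) \<le> B * ?d powr (1/4)" by (rule mult_left_mono[OF _ T(2)])
      have "norm (\<psi> x t - \<psi> y s) \<le> norm (\<psi> x t - \<psi> y t) + norm (\<psi> y t - \<psi> y s)"
        using norm_triangle_ineq[of "\<psi> x t - \<psi> y t" "\<psi> y t - \<psi> y s"] by simp
      also have "\<dots> \<le> A * ?d powr (1/4) + B * ?d powr (1/4)"
        using X(1)[of x t y] T(1)[of y t s] 1 2 by linarith
      also have "\<dots> \<le> (2 * M + A + B) * ?d powr (1/4)"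
        using mult_nonneg_nonneg[OF M0 d0] by (simp add: algebra_simps)
      finally show ?thesis by (simp add: pq)
    next
      case False
      then have 1: "1 \<le> ?d powr (1/4)" by (intro ge_one_powr_ge_zero) auto
      have "norm (\<psi> x t - \<psi> y s) \<le> 2 * M"
        using norm_triangle_ineq4[of "\<psi> x t" "\<psi> y s"] M[of x t] M[of y s] by linarith
      also have "\<dots> \<le> (2 * M + A + B) * 1" using X(2) T(2) by simp
      also have "\<dots> \<le> (2 * M + A + B) * ?d powr (1/4)" using M0 X(2) T(2) by (intro mult_left_mono 1) auto
      finally show ?thesis by (simp add: pq)
    qed
  qed
qed

theorem theorem1p2:
  fixes U :: "complex \<Rightarrow> real" and u :: "real \<Rightarrow> real" and A B :: real
    and F :: "complex \<Rightarrow> complex"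
    and \<phi> :: "real \<Rightarrow> complex" and \<psi> :: "real \<Rightarrow> real \<Rightarrow> complex"
  assumes "Ck 2 U"
    and "\<And>z. U z = u ((norm z)\<^sup>2)"
    and "B > 0" and "\<And>z. U z \<ge> A - B * (norm z)\<^sup>2"
    and "\<And>z. GDERIV U z :> - F z"
    and "\<phi> \<in> H1"
    and "C_H1 \<psi>"
    and "schroedinger_delta F \<psi>"
    and "AE x in lborel. \<psi> x 0 = \<phi> x"
  shows "bounded_hoelder (1/4) (\<lambda>(x, t). \<psi> x t)"
proof -
  note U = assms(1) and grad = assms(5)
  define p where "p = (\<lambda>t x. \<psi> x t)"
  define G where "G t = h1_deriv (p t)" for t
  define f where "f t = F (p t 0)" for t
  have "delta_solution (\<lambda>t x. \<psi> x t) (\<lambda>t. h1_deriv (\<lambda>x. \<psi> x t)) (\<lambda>t. F (\<psi> 0 t))"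
    by (rule schroedinger_delta_solution[OF assms(7,8) continuous_force[OF U grad]])
  then have sol: "delta_solution p G f" by (simp add: p_def G_def[abs_def] f_def[abs_def])
  note c = delta_solutionD(1)[OF sol]
  define N where "N = l2norm (p 0)"
  have charge: "l2norm (p t) = N" for t
    unfolding N_def by (rule delta_solution_charge[OF sol]) (simp add: f_def force_radial[OF U grad assms(2)])
  define E where "E = (l2norm (G 0))\<^sup>2 + 2 * U (p 0 0)"
  have Uc: "continuous_on UNIV U" by (rule Ck_imp_continuous_on[OF U])
  have energy_le: "(l2norm (G b))\<^sup>2 + 2 * U (p b 0) = (l2norm (G a))\<^sup>2 + 2 * U (p a 0)" if "a \<le> b" for a b
    by (rule delta_solution_energy[OF sol f_def Uc force_lipschitz[OF U grad] trapezoid_error[OF U grad]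
        that])
  have energy: "(l2norm (G t))\<^sup>2 + 2 * U (p t 0) = E" for t
    using energy_le[of 0 t] energy_le[of t 0] by (cases "0 \<le> t") (simp_all add: E_def)
  have N0: "N \<ge> 0" by (simp add: N_def)
  \<comment> \<open>Energy, the lower bound on U and the Sobolev inequality give X^2 \<le> |E - 2A|
    + 4 B N X for X = \<open>l2norm (G t)\<close>. Its growth in X is only linear on the right,
    which bounds X; the summand 1 ensures that X > M1 implies X > 1, so the constant term may be
    multiplied by X.\<close>
  define M1 where "M1 = \<bar>E - 2 * A\<bar> + 4 * B * N + 1"
  have GM: "l2norm (G t) \<le> M1" for t
  proof (rule ccontr)
    define X where "X = l2norm (G t)"
    assume "\<not> l2norm (G t) \<le> M1"
    then have X: "X > \<bar>E - 2 * A\<bar> + 4 * B * N + 1" by (simp add: X_def M1_def)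
    have BN: "4 * B * N \<ge> 0" using N0 assms(3) by simp
    have "(norm (p t 0))\<^sup>2 \<le> 2 * N * X"
      using h1_pair_sobolev[OF h1_curveD(1)[OF c], of t 0] by (simp add: charge X_def)
    then have "B * (norm (p t 0))\<^sup>2 \<le> B * (2 * N * X)" using assms(3) by (intro mult_left_mono) auto
    then have "X\<^sup>2 \<le> \<bar>E - 2 * A\<bar> + 4 * B * N * X"
      using energy[of t] assms(4)[of "p t 0"] by (simp add: X_def) 
    also have "\<dots> \<le> \<bar>E - 2 * A\<bar> * X + 4 * B * N * X"
      using X BN mult_left_mono[of 1 X "\<bar>E - 2 * A\<bar>"] by simp
    also have "\<dots> = (\<bar>E - 2 * A\<bar> + 4 * B * N) * X" by (simp add: algebra_simps)
    also have "\<dots> < X * X" using X BN by (intro mult_strict_right_mono) auto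
    finally show False by (simp add: power2_eq_square)
  qed
  have M1: "M1 \<ge> 0" using GM[of 0] l2norm_nonneg[of "G 0"] by linarith
  define M3 where "M3 = sqrt (2 * N * M1)"
  have bd: "norm (p t x) \<le> M3" for t x
  proof -
    have "(norm (p t x))\<^sup>2 \<le> 2 * N * l2norm (G t)"
      using h1_pair_sobolev[OF h1_curveD(1)[OF c], of t x] by (simp add: charge)
    also have "\<dots> \<le> 2 * N * M1" using N0 by (intro mult_left_mono GM) auto
    finally show ?thesis unfolding M3_def by (rule real_le_rsqrt)
  qed
  obtain M2 where "\<forall>z\<in>cball 0 M3. norm (F z) \<le> M2"
    using compact_imp_bounded[OF compact_continuous_image[OF continuous_force[OF U grad, of "cball 0
        M3"] compact_cball]]
    by (auto simp: bounded_iff)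
  then have fb: "norm (f t) \<le> M2" for t using bd[of t 0] by (simp add: f_def)
  define D where "D = 2 * M1\<^sup>2 + 2 * M2 * M3"
  have D0: "D \<ge> 0"
    using order_trans[OF norm_ge_zero fb[of 0]] order_trans[OF norm_ge_zero bd[of 0 0]] by (simp add: D_def)
  show ?thesis
  proof (rule bounded_hoelder_pairI)
    show "norm (\<psi> x t) \<le> M3" for x t using bd[of t x] by (simp add: p_def)
    show "norm (\<psi> x t - \<psi> y t) \<le> M1 * sqrt \<bar>x - y\<bar>" for x y t
    proof -
      have "norm (p t x - p t y) \<le> sqrt \<bar>x - y\<bar> * l2norm (G t)"
        by (rule h1_pair_hoelder[OF h1_curveD(1)[OF c]])
      also have "\<dots> \<le> sqrt \<bar>x - y\<bar> * M1" by (intro mult_left_mono GM) auto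
      finally show ?thesis by (simp add: p_def mult.commute)
    qed
    show "norm (\<psi> x t - \<psi> x s) \<le> sqrt (4 * M1 * sqrt D) * \<bar>t - s\<bar> powr (1/4)" for x s t
    proof -
      let ?d = "\<lambda>x. p t x - p s x" and ?k = "\<lambda>x. G t x - G s x"
      have "(l2norm ?d)\<^sup>2 \<le> \<bar>t - s\<bar> * D"
        unfolding D_def
        \<comment> \<open>The bounds hold for all times, so any interval containing s and t will
          do.\<close>
        by (rule delta_solution_l2_increment[OF sol, of "min s t" "max s t"]) (auto intro: GM fb bd)
      then have d: "l2norm ?d \<le> sqrt (\<bar>t - s\<bar> * D)" by (rule real_le_rsqrt)
      have k: "l2norm ?k \<le> 2 * M1"
        using l2norm_triangle_diff[OF h1_curveD(3)[OF c] h1_curveD(3)[OF c], of t s] GM[of t] GM[of s]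
          by linarith
      \<comment> \<open>Interpolation: the L2 factor is of order |t - s|^(1/2), the derivative
        factor is merely bounded, and the square root of their product has order |t -
        s|^(1/4).\<close>
      have "(norm (?d x))\<^sup>2 \<le> 2 * l2norm ?d * l2norm ?k"
        by (intro h1_pair_sobolev h1_pair_diff h1_curveD(1)[OF c])
      also have "\<dots> \<le> 2 * sqrt (\<bar>t - s\<bar> * D) * (2 * M1)"
        using D0 by (intro mult_mono d k) auto
      also have "\<dots> = (4 * M1 * sqrt D) * sqrt \<bar>t - s\<bar>" by (simp add: real_sqrt_mult)
      finally have "norm (?d x) \<le> sqrt ((4 * M1 * sqrt D) * sqrt \<bar>t - s\<bar>)" by (rule real_le_rsqrt)
      then show ?thesis by (simp add: p_def powr_quarter real_sqrt_mult)
    qed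
    show "sqrt (4 * M1 * sqrt D) \<ge> 0" using M1 D0 by simp
  qed (rule M1)
qed

end
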